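(* Let $K$ be a field, let $H$ be a numerical semigroup, and let $K[[H]]$ be its numerical semigroup ring. Assume that $K[[H]]$ has type $3$. Then $K[[H]]$ is far-flung Gorenstein if and only if $H$ belongs to one of the following families of numerical semigroups (where $m$ denotes an integer): 1. $H=\langle 4,4m+1,4m+2,4m+3\rangle$, with $m\geq 1$; 2. $H=\langle 4,4m+3,4m+5,4m+6\rangle$, with $m\geq 1$; 3. $H=\langle 5,5m+4,10m+6,10m+7\rangle$, with $m\geq 1$; 4. $H=\langle 5,5m+1,10m+3,10m+4\rangle$, with $m\geq 1$; 5. $H=\langle 5,5m+2,10m+1,10m+3\rangle$, with $m\geq 1$; 6. $H=\langle 5,5m+3,10m+4,10m+7\rangle$, with $m\geq 1$.
   Context: A numerical semigroup $H$ is a submonoid of $(\mathbb N,+)$ (with $0\in\mathbb N$) such that $\mathbb N\setminus H$ is finite. $\langle a_1,\dots,a_k\rangle$ denotes the submonoid of $\mathbb N$ generated by $a_1,\dots,a_k$. For a field $K$, the numerical semigroup ring of $H$ is the subring $K[[H]]:=K[[t^h : h\in H]]$ of the power series ring $K[[t]]$; it is a one-dimensional Cohen-Macaulay local domain with integral closure $K[[t]]$. The type of $K[[H]]$ is its Cohen-Macaulay type. It equals the type $r(H)$ of $H$, i.e. the cardinality of the set of pseudo-Frobenius numbers $PF(H):=\{x\in\mathbb Z\setminus H : x+h\in H \text{ for all } h\in H\setminus\{0\}\}$. For a ring $R$ and an $R$-module $M$, the trace ideal of $M$ is $\mathrm{tr}(M):=\sum_{\varphi\in \mathrm{Hom}_R(M,R)}\mathrm{Im}(\varphi)$.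 A one-dimensional Cohen-Macaulay local ring $R$ with a canonical module $\omega_R$ is called far-flung Gorenstein if $\mathrm{tr}(\omega_R)=R:\overline{R}$, where $\overline{R}$ is the integral closure of $R$ in its total ring of fractions $Q(R)$ and the colon $R:\overline R=\{q\in Q(R): q\overline R\subseteq R\}$ is taken in $Q(R)$. *)

theory Defs
  imports
    "HOL-Algebra.Algebraic_Closure_Type"
    "HOL-Computational_Algebra.Formal_Laurent_Series"
begin

section \<open>Numerical semigroups\<close>

definition nat_add_monoid :: "nat monoid" where
  "nat_add_monoid = \<lparr>carrier = UNIV, monoid.mult = (+), one = 0\<rparr>"

definition numerical_semigroup :: "nat set \<Rightarrow> bool" where
  "numerical_semigroup H \<longleftrightarrow> submonoid H nat_add_monoid \<and> finite (UNIV - H)"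

definition submonoid_generated :: "nat set \<Rightarrow> nat set" where
  "submonoid_generated A = (\<lambda>S. submonoid S nat_add_monoid) hull A"

section \<open>The numerical semigroup ring inside \<open>K((t))\<close>\<close>

abbreviation laurent_field :: "'k::field fls ring" where
  "laurent_field \<equiv> ring_of_type_algebra"

text \<open>The power series supported on \<open>H\<close>, embedded into the field \<open>K((t))\<close>, which serves as an
  ambient field in which fractions, integral closures and colons are formed.\<close>

definition semigroup_ring_carrier :: "nat set \<Rightarrow> 'k::field fls set" where
  "semigroup_ring_carrier H = fps_to_fls ` {f. \<forall>n. fps_nth f n \<noteq> 0 \<longrightarrow> n \<in> H}"

section \<open>Linear algebra over a commutative ring\<close>

definition self_module :: "('a, 'c) ring_scheme \<Rightarrow> ('a, 'a) module" where
  "self_module R = \<lparr>carrier = carrier R, monoid.mult = monoid.mult R, one = one R, zero = zero R, add = add R,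
                    module.smult = monoid.mult R\<rparr>"

definition tuples :: "('m, 'c) ring_scheme \<Rightarrow> nat \<Rightarrow> (nat \<Rightarrow> 'm) set" where
  "tuples M n = {..<n} \<rightarrow>\<^sub>E carrier M"

definition zero_tuple :: "('m, 'c) ring_scheme \<Rightarrow> nat \<Rightarrow> (nat \<Rightarrow> 'm)" where
  "zero_tuple M n = (\<lambda>i\<in>{..<n}. \<zero>\<^bsub>M\<^esub>)"

text \<open>The combination \<open>\<Sum>k<d. r k \<odot> z k\<close> of \<open>d\<close> tuples \<open>z k \<in> M\<^sup>n\<close>.\<close>

definition tuple_comb ::
  "('a, 'm, 'c) module_scheme \<Rightarrow> nat \<Rightarrow> nat \<Rightarrow> (nat \<Rightarrow> 'a) \<Rightarrow> (nat \<Rightarrow> nat \<Rightarrow> 'm) \<Rightarrow> (nat \<Rightarrow> 'm)" where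
  "tuple_comb M n d r z = (\<lambda>i\<in>{..<n}. \<Oplus>\<^bsub>M\<^esub>k\<in>{..<d}. r k \<odot>\<^bsub>M\<^esub> z k i)"

definition fin_gen_module :: "('a, 'c) ring_scheme \<Rightarrow> ('a, 'm, 'd) module_scheme \<Rightarrow> bool" where
  "fin_gen_module R M \<longleftrightarrow>
     (\<exists>n g. g \<in> {..<n::nat} \<rightarrow> carrier M \<and>
        (\<forall>x\<in>carrier M. \<exists>r\<in>{..<n} \<rightarrow> carrier R. x = (\<Oplus>\<^bsub>M\<^esub>k\<in>{..<n}. r k \<odot>\<^bsub>M\<^esub> g k)))"

definition module_homs ::
  "('a, 'c) ring_scheme \<Rightarrow> ('a, 'm, 'd) module_scheme \<Rightarrow> ('a, 'n, 'e) module_scheme \<Rightarrow> ('m \<Rightarrow> 'n) set"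
where
  "module_homs R M N =
     {\<phi> \<in> carrier M \<rightarrow> carrier N.
        (\<forall>x\<in>carrier M. \<forall>y\<in>carrier M. \<phi> (x \<oplus>\<^bsub>M\<^esub> y) = \<phi> x \<oplus>\<^bsub>N\<^esub> \<phi> y) \<and>
        (\<forall>a\<in>carrier R. \<forall>x\<in>carrier M. \<phi> (a \<odot>\<^bsub>M\<^esub> x) = a \<odot>\<^bsub>N\<^esub> \<phi> x)}"

text \<open>The sum of the images of all homomorphisms \<open>M \<rightarrow> R\<close>, i.e. the set of all finite sums of
  elements of these images.\<close>

definition trace_ideal :: "('a, 'c) ring_scheme \<Rightarrow> ('a, 'm, 'd) module_scheme \<Rightarrow> 'a set" where
  "trace_ideal R M =
     {\<Oplus>\<^bsub>R\<^esub>k\<in>{..<n}. \<phi> k (x k) | (n::nat) \<phi> x.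
        \<phi> \<in> {..<n} \<rightarrow> module_homs R M (self_module R) \<and> x \<in> {..<n} \<rightarrow> carrier M}"

section \<open>\<open>Ext\<close> from the residue field, type and canonical modules\<close>

text \<open>For a local ring this is its maximal ideal.\<close>

definition nonunits :: "('a, 'c) ring_scheme \<Rightarrow> 'a set" where
  "nonunits R = carrier R - Units R"

text \<open>A resolution \<open>\<dots> \<rightarrow> R\<^bsup>n 2\<^esup> \<rightarrow> R\<^bsup>n 1\<^esup> \<rightarrow> R\<^bsup>n 0\<^esup> = R\<close> of the residue field \<open>k = R/\<mm>\<close> of a local ring
  \<open>R\<close> by free modules of finite rank, augmented by the projection \<open>R \<rightarrow> k\<close>.
  Its differential \<open>R\<^bsup>n (p+1)\<^esup> \<rightarrow> R\<^bsup>n p\<^esup>\<close> sends the \<open>i\<close>-th basis vector to the row \<open>D p i\<close>.\<close>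

definition residue_resolution ::
  "('a, 'c) ring_scheme \<Rightarrow> (nat \<Rightarrow> nat) \<Rightarrow> (nat \<Rightarrow> nat \<Rightarrow> nat \<Rightarrow> 'a) \<Rightarrow> bool" where
  "residue_resolution R n D \<longleftrightarrow>
     (let d = \<lambda>p x. tuple_comb (self_module R) (n p) (n (Suc p)) x (D p) in
        n 0 = 1 \<and>
        (\<forall>p. \<forall>i<n (Suc p). \<forall>j<n p. D p i j \<in> carrier R) \<and>
        d 0 ` tuples R (n 1) = {v \<in> tuples R 1. v 0 \<in> nonunits R} \<and>
        (\<forall>p. d (Suc p) ` tuples R (n (Suc (Suc p))) =
               {v \<in> tuples R (n (Suc p)). d p v = zero_tuple R (n p)}))"

text \<open>Under \<open>Hom(R\<^bsup>n p\<^esup>, M) = M\<^bsup>n p\<^esup>\<close>, \<open>\<phi> \<mapsto> (\<phi> e\<^sub>j)\<^sub>j\<close>, this is the map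
  \<open>Hom(R\<^bsup>n p\<^esup>, M) \<rightarrow> Hom(R\<^bsup>n (p+1)\<^esup>, M)\<close> induced by the differential.\<close>

definition coboundary_map ::
  "('a, 'm, 'c) module_scheme \<Rightarrow> (nat \<Rightarrow> nat) \<Rightarrow> (nat \<Rightarrow> nat \<Rightarrow> nat \<Rightarrow> 'a) \<Rightarrow> nat
     \<Rightarrow> (nat \<Rightarrow> 'm) \<Rightarrow> (nat \<Rightarrow> 'm)" where
  "coboundary_map M n D p v = (\<lambda>i\<in>{..<n (Suc p)}. \<Oplus>\<^bsub>M\<^esub>j\<in>{..<n p}. D p i j \<odot>\<^bsub>M\<^esub> v j)"

definition cocycles ::
  "('a, 'm, 'c) module_scheme \<Rightarrow> (nat \<Rightarrow> nat) \<Rightarrow> (nat \<Rightarrow> nat \<Rightarrow> nat \<Rightarrow> 'a) \<Rightarrow> nat \<Rightarrow> (nat \<Rightarrow> 'm) set" where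
  "cocycles M n D p = {v \<in> tuples M (n p). coboundary_map M n D p v = zero_tuple M (n (Suc p))}"

fun coboundaries ::
  "('a, 'm, 'c) module_scheme \<Rightarrow> (nat \<Rightarrow> nat) \<Rightarrow> (nat \<Rightarrow> nat \<Rightarrow> nat \<Rightarrow> 'a) \<Rightarrow> nat \<Rightarrow> (nat \<Rightarrow> 'm) set" where
  "coboundaries M n D 0 = {zero_tuple M (n 0)}"
| "coboundaries M n D (Suc p) = coboundary_map M n D p ` tuples M (n p)"

text \<open>\<open>dim\<^sub>k Ext\<^sup>p(k, M) = d\<close> for a Noetherian local ring \<open>R\<close> with residue field \<open>k = R/\<mm>\<close>: the
  cocycles \<open>z 0, \<dots>, z (d - 1)\<close> induce a \<open>k\<close>-basis of \<open>Ext\<^sup>p(k, M)\<close>, which is cocycles modulo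
  coboundaries and is annihilated by \<open>\<mm>\<close>. As usual, the resolution chosen does not matter.\<close>

definition residue_ext_dim ::
  "('a, 'c) ring_scheme \<Rightarrow> ('a, 'm, 'e) module_scheme \<Rightarrow> nat \<Rightarrow> nat \<Rightarrow> bool" where
  "residue_ext_dim R M p d \<longleftrightarrow>
     (\<exists>n D z. residue_resolution R n D \<and>
        z \<in> {..<d} \<rightarrow> cocycles M n D p \<and>
        (\<forall>v\<in>cocycles M n D p. \<exists>r\<in>{..<d} \<rightarrow> carrier R. \<exists>b\<in>coboundaries M n D p.
           \<forall>i<n p. v i = tuple_comb M (n p) d r z i \<oplus>\<^bsub>M\<^esub> b i) \<and>
        (\<forall>r\<in>{..<d} \<rightarrow> carrier R.
           tuple_comb M (n p) d r z \<in> coboundaries M n D p \<longrightarrow> (\<forall>k<d. r k \<in> nonunits R)))"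

text \<open>For a Cohen-Macaulay local ring \<open>R\<close> of dimension \<open>d\<close>: its type \<open>dim\<^sub>k Ext\<^sup>d(k, R)\<close> is \<open>r\<close>.\<close>

definition cohen_macaulay_type :: "nat \<Rightarrow> ('a, 'c) ring_scheme \<Rightarrow> nat \<Rightarrow> bool" where
  "cohen_macaulay_type d R r \<longleftrightarrow> residue_ext_dim R (self_module R) d r"

text \<open>For a Cohen-Macaulay local ring \<open>R\<close> of dimension \<open>d\<close>: \<open>W\<close> is a canonical module, i.e. it is
  finitely generated with \<open>dim\<^sub>k Ext\<^sup>p(k, W)\<close> equal to \<open>1\<close> for \<open>p = d\<close> and to \<open>0\<close> otherwise
  (equivalently: maximal Cohen-Macaulay, of type \<open>1\<close> and of finite injective dimension).\<close>

definition canonical_module ::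
  "nat \<Rightarrow> ('a, 'c) ring_scheme \<Rightarrow> ('a, 'm, 'e) module_scheme \<Rightarrow> bool" where
  "canonical_module d R W \<longleftrightarrow>
     module R W \<and> fin_gen_module R W \<and>
     (\<forall>p. residue_ext_dim R W p (if p = d then 1 else 0))"

section \<open>Fractions, integral closure, colon\<close>

text \<open>Throughout, \<open>S\<close> is a subring of a field \<open>L\<close>; the total ring of fractions of \<open>S\<close> is then the
  subfield of \<open>L\<close> of all fractions of elements of \<open>S\<close>.\<close>

definition fractions :: "('a, 'c) ring_scheme \<Rightarrow> 'a set \<Rightarrow> 'a set" where
  "fractions L S = {a \<otimes>\<^bsub>L\<^esub> inv\<^bsub>L\<^esub> b | a b. a \<in> S \<and> b \<in> S - {\<zero>\<^bsub>L\<^esub>}}"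

definition integral_closure :: "('a, 'c) ring_scheme \<Rightarrow> 'a set \<Rightarrow> 'a set" where
  "integral_closure L S =
     {x \<in> fractions L S. \<exists>n. \<exists>c\<in>{..<n::nat} \<rightarrow> S.
        x [^]\<^bsub>L\<^esub> n \<oplus>\<^bsub>L\<^esub> (\<Oplus>\<^bsub>L\<^esub>i\<in>{..<n}. c i \<otimes>\<^bsub>L\<^esub> x [^]\<^bsub>L\<^esub> i) = \<zero>\<^bsub>L\<^esub>}"

definition colon :: "('a, 'c) ring_scheme \<Rightarrow> 'a set \<Rightarrow> 'a set \<Rightarrow> 'a set" where
  "colon L S A = {q \<in> fractions L S. \<forall>a\<in>A. q \<otimes>\<^bsub>L\<^esub> a \<in> S}"

text \<open>For a one-dimensional Cohen-Macaulay local domain \<open>S \<subseteq> L\<close>. Canonical modules are unique up to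
  isomorphism and the trace ideal only depends on the isomorphism class. Taking the carrier of \<open>W\<close>
  inside the type of \<open>L\<close> is no restriction: a finitely generated module over an infinite ring \<open>S\<close>
  has at most as many elements as \<open>S\<close>, and \<open>W\<close> may carry any module structure. A finite domain is a
  field, hence not one-dimensional.\<close>

definition far_flung_gorenstein :: "('a, 'c) ring_scheme \<Rightarrow> 'a set \<Rightarrow> bool" where
  "far_flung_gorenstein L S \<longleftrightarrow>
     (\<exists>W :: ('a, 'a) module. canonical_module 1 (L\<lparr>carrier := S\<rparr>) W \<and>
        trace_ideal (L\<lparr>carrier := S\<rparr>) W = colon L S (integral_closure L S))"

end

theory Submission
  imports Defs "HOL-Library.Function_Algebras"
begin

text \<open>
  Let \<open>F\<close> be the Frobenius number of \<open>H\<close> and \<open>K = {z. F - z \<notin> H}\<close>. Since a resolution of the residue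
  field identifies \<open>Ext\<^sup>1(k, M)\<close> with \<open>(M : \<mm>)/M\<close> for a fractional ideal \<open>M\<close>, the type of the ring is the
  number of pseudo-Frobenius numbers. The series supported on \<open>K\<close> form a canonical ideal \<open>\<omega>\<close>, because
  \<open>q \<mapsto> (q * w) $$ F\<close> represents every linear functional on \<open>K((t))\<close> that vanishes on the ring by a unique
  \<open>w \<in> \<omega>\<close>. The same representation yields, for any canonical module \<open>W\<close>, a homomorphism \<open>W \<rightarrow> \<omega>\<close>
  that hits \<open>1\<close>, so the trace of \<open>W\<close> contains \<open>t\<^sup>b\<close> whenever \<open>b + K \<subseteq> H\<close>. Hence the ring is far-flung
  Gorenstein iff \<open>b + K \<subseteq> H\<close> forces \<open>b > F\<close>, which by the duality \<open>z \<mapsto> F - z\<close> means \<open>K + K = \<nat>\<close>.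
  In type 3, \<open>K\<close> is generated over \<open>H\<close> by \<open>0 < a < b\<close>, and the numbers below the multiplicity \<open>e\<close> must all
  be sums of two elements of \<open>{0, a, b}\<close>. This leaves \<open>a = 1\<close>, \<open>b \<in> {2, 3}\<close> and \<open>e \<in> {4, 5}\<close>.
\<close>

section \<open>Numerical semigroups\<close>

text \<open>Canonical modules are specified only through the dimensions of all Ext groups, each
  certified by a free resolution of the residue field. No resolution is constructed: the assumption
  on the type supplies one, and on it \<open>\<omega>\<close> is shown to be canonical. Far-flung
  asks for some \<open>W\<close>, so \<open>\<omega>\<close> is the witness in one direction; in the
  other \<open>W\<close> is arbitrary, and it suffices to find monomials in its trace. A linear
  functional that kills the ring kills every series of order above \<open>F\<close>. It therefore
  depends on finitely many coefficients of each argument and is represented by a Laurent series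
  without any topology. Injectivity arguments thus become extensions of functionals from subspaces
  of the vector space of tuples over K((t)).\<close>

lemma submonoid_nat_iff: "submonoid A nat_add_monoid \<longleftrightarrow> 0 \<in> A \<and> (\<forall>x\<in>A. \<forall>y\<in>A. x + y \<in> A)"
  by (auto simp: submonoid_def nat_add_monoid_def)

lemma submonoid_generated_zero: "0 \<in> submonoid_generated A"
    and submonoid_generated_add: "x \<in> submonoid_generated A \<Longrightarrow> y \<in> submonoid_generated A \<Longrightarrow> x + y \<in> submonoid_generated A"
    and submonoid_generated_inc: "x \<in> A \<Longrightarrow> x \<in> submonoid_generated A"
proof -
  have *: "submonoid (submonoid_generated A) nat_add_monoid"
    unfolding submonoid_generated_def by (rule hull_in) (auto simp: submonoid_nat_iff)
  show "0 \<in> submonoid_generated A"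
    and "x \<in> submonoid_generated A \<Longrightarrow> y \<in> submonoid_generated A \<Longrightarrow> x + y \<in> submonoid_generated A"
    using * by (auto simp: submonoid_nat_iff)
  show "x \<in> A \<Longrightarrow> x \<in> submonoid_generated A"
    unfolding submonoid_generated_def by (rule hull_inc)
qed

lemma submonoid_generated_mult:
  "x \<in> submonoid_generated A \<Longrightarrow> x * k \<in> submonoid_generated A"
  by (induction k) (simp_all add: submonoid_generated_zero submonoid_generated_add)

lemma submonoid_generated_eqI:
  assumes "A \<subseteq> B" "0 \<in> B" "\<And>x y. x \<in> B \<Longrightarrow> y \<in> B \<Longrightarrow> x + y \<in> B"
    and "\<And>n. n \<in> B \<Longrightarrow> n \<in> submonoid_generated A"
  shows "submonoid_generated A = B"
proof
  have "submonoid B nat_add_monoid" using assms(2,3) by (simp add: submonoid_nat_iff)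
  thus "submonoid_generated A \<subseteq> B"
    unfolding submonoid_generated_def by (rule hull_minimal[OF assms(1)])
qed (use assms(4) in blast)

lemma submonoid_generated_residue:
  assumes "e \<in> A" "w \<in> submonoid_generated A" "n mod e = w mod e" "w \<le> n"
  shows "n \<in> submonoid_generated A"
proof -
  have "e dvd n - w"
    using assms(3,4) mod_eq_dvd_iff_nat[of w n e] by simp
  then obtain k where "n - w = e * k" by (rule dvdE)
  hence "n = w + e * k" using assms by simp
  thus ?thesis
    using submonoid_generated_add[OF assms(2) submonoid_generated_mult[OF submonoid_generated_inc[OF assms(1)]]] by simp
qed

text \<open>\<open>w\<close> is a candidate Apery set. Subadditivity makes the numbers that dominate
  the entry of their own class a submonoid, and each such number is an entry plus a multiple of
  \<open>e\<close>.\<close>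

lemma submonoid_generated_apery:
  fixes w :: "nat \<Rightarrow> nat"
  assumes res: "\<And>i. i < e \<Longrightarrow> w i mod e = i"
    and add: "\<And>i j. i < e \<Longrightarrow> j < e \<Longrightarrow> w ((i + j) mod e) \<le> w i + w j"
    and e: "0 < e" "e \<in> A" and w0: "w 0 = 0" and A: "A \<subseteq> insert e (w ` {..<e})"
    and w: "\<And>i. i < e \<Longrightarrow> w i \<in> submonoid_generated A"
  shows "submonoid_generated A = {n. w (n mod e) \<le> n}"
proof (rule submonoid_generated_eqI)
  show "A \<subseteq> {n. w (n mod e) \<le> n}"
  proof
    fix x assume "x \<in> A"
    then consider "x = e" | i where "i < e" "x = w i" using A by blast
    thus "x \<in> {n. w (n mod e) \<le> n}" by cases (simp_all add: res w0)
  qed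
  show "0 \<in> {n. w (n mod e) \<le> n}" using w0 by simp
next
  fix x y assume xy: "x \<in> {n. w (n mod e) \<le> n}" "y \<in> {n. w (n mod e) \<le> n}"
  have "w ((x + y) mod e) \<le> w (x mod e) + w (y mod e)"
    using add[of "x mod e" "y mod e"] e(1) by (simp add: mod_add_eq)
  also have "\<dots> \<le> x + y" using xy by simp
  finally show "x + y \<in> {n. w (n mod e) \<le> n}" by simp
next
  fix n assume "n \<in> {n. w (n mod e) \<le> n}"
  moreover have "n mod e < e" using e by simp
  ultimately show "n \<in> submonoid_generated A"
    using submonoid_generated_residue[OF e(2) w] by (simp add: res)
qed

section \<open>Pseudo-Frobenius numbers and the canonical ideal of a semigroup\<close>

definition pseudo_frobenius :: "nat set \<Rightarrow> int set" where
  "pseudo_frobenius H = {z. z \<notin> int ` H \<and> (\<forall>h\<in>H. h > 0 \<longrightarrow> z + int h \<in> int ` H)}"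

locale numerical_semigroup_loc =
  fixes H :: "nat set"
  assumes numsg: "numerical_semigroup H"
begin

definition Z :: "int set" where "Z = int ` H"

definition conductor :: nat where "conductor = (LEAST c. \<forall>n\<ge>c. n \<in> H)"

text \<open>For \<open>H = UNIV\<close> this is -1, which is then the only pseudo-Frobenius number;
  hence integers instead of naturals.\<close>

definition F :: int where "F = int conductor - 1"

definition K :: "int set" where "K = {z. F - z \<notin> Z}"

lemma H_zero: "0 \<in> H" and H_add: "x \<in> H \<Longrightarrow> y \<in> H \<Longrightarrow> x + y \<in> H" and H_cofinite: "finite (UNIV - H)"
  using numsg by (auto simp: numerical_semigroup_def submonoid_nat_iff)

lemma Z_nonneg: "z \<in> Z \<Longrightarrow> 0 \<le> z"
  by (auto simp: Z_def)

lemma Z_iff: "int n \<in> Z \<longleftrightarrow> n \<in> H"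
  by (auto simp: Z_def)

lemma Z_zero [simp]: "0 \<in> Z"
  using H_zero Z_iff[of 0] by simp

lemma Z_add: "x \<in> Z \<Longrightarrow> y \<in> Z \<Longrightarrow> x + y \<in> Z"
  unfolding Z_def using H_add by (force simp flip: of_nat_add)

lemma Z_mult: "x \<in> Z \<Longrightarrow> 0 \<le> k \<Longrightarrow> x * k \<in> Z"
proof -
  have "x * int n \<in> Z" if "x \<in> Z" for n
    by (induction n) (auto simp: algebra_simps intro: Z_add that)
  thus "x \<in> Z \<Longrightarrow> 0 \<le> k \<Longrightarrow> x * k \<in> Z" by (metis zero_le_imp_eq_int)
qed

lemma conductor_in: "n \<ge> conductor \<Longrightarrow> n \<in> H"
proof -
  obtain c where c: "\<And>n. n \<in> UNIV - H \<Longrightarrow> n < c"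
    using H_cofinite finite_nat_set_iff_bounded[of "UNIV - H"] by blast
  hence "\<forall>n\<ge>c. n \<in> H" by (metis DiffI UNIV_I not_less)
  hence "\<forall>n\<ge>conductor. n \<in> H" unfolding conductor_def by (rule LeastI)
  thus "n \<ge> conductor \<Longrightarrow> n \<in> H" by blast
qed

lemma Z_above_F: "z > F \<Longrightarrow> z \<in> Z"
  using conductor_in[of "nat z"] Z_iff[of "nat z"] by (simp add: F_def)

lemma F_notin: "F \<notin> Z"
proof
  assume "F \<in> Z"
  hence "conductor > 0" "conductor - 1 \<in> H" using Z_nonneg[of F] Z_iff[of "conductor - 1"] by (auto simp: F_def of_nat_diff)
  hence "\<forall>n\<ge>conductor - 1. n \<in> H"
    by (metis Suc_diff_1 conductor_in le_neq_implies_less not_less_eq_eq linorder_not_less)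
  hence "conductor \<le> conductor - 1" unfolding conductor_def by (rule Least_le)
  thus False using \<open>conductor > 0\<close> by simp
qed

lemma F_ge: "F \<ge> -1" by (simp add: F_def)

lemma K_nonneg: "k \<in> K \<Longrightarrow> 0 \<le> k"
  using Z_above_F[of "F - k"] by (force simp: K_def)

lemma K_zero: "0 \<in> K"
  using F_notin by (simp add: K_def)

lemma K_add: "k \<in> K \<Longrightarrow> z \<in> Z \<Longrightarrow> k + z \<in> K"
  using Z_add[of "F - (k + z)" z] by (auto simp: K_def)

lemma PF_iff: "z \<in> pseudo_frobenius H \<longleftrightarrow> z \<notin> Z \<and> (\<forall>h\<in>Z. h > 0 \<longrightarrow> z + h \<in> Z)"
  by (auto simp: pseudo_frobenius_def Z_def)

lemma F_PF: "F \<in> pseudo_frobenius H"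
  using F_notin Z_above_F by (auto simp: PF_iff)

lemma PF_le: "z \<in> pseudo_frobenius H \<Longrightarrow> z \<le> F"
  using Z_above_F[of z] by (force simp: PF_iff)

text \<open>The shifts by elements of \<open>Z\<close> that keep \<open>x\<close> outside
  \<open>Z\<close> are bounded. After the largest one, every further positive shift enters
  \<open>Z\<close>.\<close>

lemma below_PF:
  assumes "x \<notin> Z" obtains h where "h \<in> Z" "x + h \<in> pseudo_frobenius H"
proof -
  define A where "A = {h\<in>Z. x + h \<notin> Z}"
  have "A \<subseteq> {0..F - x}" using Z_above_F Z_nonneg by (force simp: A_def)
  hence fin: "finite A" by (rule finite_subset) simp
  have ne: "A \<noteq> {}" using assms by (auto simp: A_def intro!: exI[of _ 0])
  define h where "h = Max A"
  have h: "h \<in> Z" "x + h \<notin> Z" using Max_in[OF fin ne] by (auto simp: h_def A_def)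
  have "x + h + g \<in> Z" if "g \<in> Z" "g > 0" for g
  proof (rule ccontr)
    assume "x + h + g \<notin> Z"
    hence "h + g \<in> A" using that h by (auto simp: A_def add_ac intro: Z_add)
    thus False using Max_ge[OF fin] that by (fastforce simp: h_def)
  qed
  thus ?thesis using that h by (auto simp: PF_iff)
qed

text \<open>Dual form of \<open>below_PF\<close>: over \<open>Z\<close> the set \<open>K\<close> is
  generated by the differences \<open>F - f\<close>.\<close>

lemma K_obtain_PF:
  assumes "k \<in> K" obtains f h where "f \<in> pseudo_frobenius H" "h \<in> Z" "k = F - f + h"
proof -
  from assms obtain h where "h \<in> Z" "F - k + h \<in> pseudo_frobenius H"
    using below_PF[of "F - k"] by (auto simp: K_def)
  thus ?thesis using that[of "F - k + h" h] by simp
qed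

text \<open>Put \<open>n = F - b\<close>. For \<open>k\<close> in \<open>K\<close>,
  \<open>b + k\<close> lies outside \<open>Z\<close> exactly when \<open>n - k\<close> lies in
  \<open>K\<close>, so a decomposition of \<open>n\<close> is the same as a witness against
  \<open>b + K \<subseteq> Z\<close>.\<close>

lemma double_K_iff:
  "(\<forall>n\<ge>0. \<exists>k\<in>K. \<exists>l\<in>K. n = k + l) \<longleftrightarrow> (\<forall>b. (\<forall>k\<in>K. b + k \<in> Z) \<longrightarrow> b > F)"
proof (intro iffI allI impI)
  fix b assume *: "\<forall>n\<ge>0. \<exists>k\<in>K. \<exists>l\<in>K. n = k + l" and b: "\<forall>k\<in>K. b + k \<in> Z"
  show "b > F"
  proof (rule ccontr)
    assume "\<not> b > F"
    then obtain k l where "k \<in> K" "l \<in> K" "F - b = k + l" using * by (metis diff_ge_0_iff_ge not_less)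
    hence "b + k = F - l" "b + k \<in> Z" using b by auto
    thus False using \<open>l \<in> K\<close> by (auto simp: K_def)
  qed
next
  fix n :: int assume *: "\<forall>b. (\<forall>k\<in>K. b + k \<in> Z) \<longrightarrow> b > F" and n: "n \<ge> 0"
  hence "\<not> F - n > F" by simp
  then obtain k where "k \<in> K" "F - n + k \<notin> Z" using * by blast
  hence "n - k \<in> K" by (simp add: K_def algebra_simps)
  thus "\<exists>k\<in>K. \<exists>l\<in>K. n = k + l" using \<open>k \<in> K\<close> by (intro bexI[of _ k] bexI[of _ "n - k"]) auto
qed

text \<open>The hypotheses on \<open>w\<close> make it the least element of \<open>Z\<close> in its
  class modulo \<open>e\<close>.\<close>

lemma apery_iff:
  assumes "e \<in> Z" "w \<in> Z" "w - e \<notin> Z" "z mod e = w mod e"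
  shows "z \<in> Z \<longleftrightarrow> w \<le> z"
proof -
  have e: "e > 0" using assms Z_nonneg[of e] by (metis diff_zero le_less)
  obtain k where k: "z = w + e * k" using assms(4) by (metis mod_eqE)
  show ?thesis
  proof
    assume "w \<le> z"
    thus "z \<in> Z" using e k assms by (auto intro!: Z_add Z_mult simp: zero_le_mult_iff)
  next
    assume "z \<in> Z"
    show "w \<le> z"
    proof (rule ccontr)
      assume "\<not> w \<le> z"
      hence "k < 0" using k e by (simp add: not_le mult_less_0_iff zero_le_mult_iff)
      \<comment> \<open>This sum is exactly \<open>w - e\<close>.\<close>
      hence "z + e * (-1 - k) \<in> Z" using \<open>z \<in> Z\<close> assms by (intro Z_add Z_mult) auto
      thus False using assms k by (simp add: algebra_simps)
    qed
  qed
qed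

text \<open>The remainder of \<open>n\<close> modulo \<open>e\<close> is at most 4, and 0, ..., 4
  are all sums of two of \<open>0, 1, b\<close> (such as 4 = 2 + 2 or 4 = 1 + 3). The multiple of
  \<open>e\<close> is absorbed by one summand.\<close>

lemma double_K_if:
  assumes "e \<in> Z" "e > 0" "e \<le> 5" "F - 1 \<notin> Z" "F - b \<notin> Z" "b = 2 \<or> b = 3" "n \<ge> 0"
  shows "\<exists>k\<in>K. \<exists>l\<in>K. n = k + l"
proof -
  have K: "0 \<in> K" "1 \<in> K" "b \<in> K" using assms F_notin by (auto simp: K_def)
  have "n mod e \<in> {0,1,2,3,4}"
    using pos_mod_bound[of e n] pos_mod_sign[of e n] assms(2,3) unfolding insert_iff empty_iff by linarith
  moreover have "\<exists>k\<in>{0,1,b}. \<exists>l\<in>{0,1,b}. r = k + l" if "r \<in> {0,1,2,3,4}" for r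
    using that assms(6) by auto
  ultimately obtain k l where "k \<in> {0,1,b}" "l \<in> {0,1,b}" and kl': "n mod e = k + l" by meson
  hence kl: "k \<in> K" "l \<in> K" using K by auto
  have "l + e * (n div e) \<in> K" using kl assms
    by (intro K_add Z_mult) (auto simp: pos_imp_zdiv_nonneg_iff)
  moreover have "n = k + (l + e * (n div e))" using kl' mod_mult_div_eq[of n e] by linarith
  ultimately show ?thesis using kl by blast
qed

end

section \<open>Generators of the six families\<close>

definition in_type3_family :: "nat set \<Rightarrow> bool" where
  "in_type3_family H \<longleftrightarrow> (\<exists>m::nat. m \<ge> 1 \<and>
      (H = submonoid_generated {4, 4*m+1, 4*m+2, 4*m+3} \<or>
       H = submonoid_generated {4, 4*m+3, 4*m+5, 4*m+6} \<or>
       H = submonoid_generated {5, 5*m+4, 10*m+6, 10*m+7} \<or>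
       H = submonoid_generated {5, 5*m+1, 10*m+3, 10*m+4} \<or>
       H = submonoid_generated {5, 5*m+2, 10*m+1, 10*m+3} \<or>
       H = submonoid_generated {5, 5*m+3, 10*m+4, 10*m+7}))"

lemma less_4_iff: "i < 4 \<longleftrightarrow> i = 0 \<or> i = 1 \<or> i = 2 \<or> i = (3::nat)" by auto
lemma less_5_iff: "i < 5 \<longleftrightarrow> i = 0 \<or> i = 1 \<or> i = 2 \<or> i = 3 \<or> i = (4::nat)" by auto

text \<open>The inequalities are the subadditivity conditions on an Apery set. Those not listed have
  the sum or a summand in class 0, where the entry is 0.\<close>

lemma submonoid_generated_4:
  assumes "w1 mod 4 = 1" "w2 mod 4 = 2" "w3 mod 4 = (3::nat)"
    and "w2 \<le> 2 * w1" "w2 \<le> 2 * w3" "w3 \<le> w1 + w2" "w1 \<le> w2 + w3"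
    and A: "A = {4, w1, w2, w3}"
  shows "submonoid_generated A = {n. [0, w1, w2, w3] ! (n mod 4) \<le> n}"
proof (rule submonoid_generated_apery)
  fix i j :: nat assume "i < 4" "j < 4"
  thus "[0, w1, w2, w3] ! ((i + j) mod 4) \<le> [0, w1, w2, w3] ! i + [0, w1, w2, w3] ! j"
    unfolding less_4_iff using assms by (elim disjE) simp_all
next
  fix i :: nat assume "i < 4"
  thus "[0, w1, w2, w3] ! i mod 4 = i"
    unfolding less_4_iff using assms by (elim disjE) simp_all
next
  fix i :: nat assume "i < 4"
  thus "[0, w1, w2, w3] ! i \<in> submonoid_generated A"
    unfolding less_4_iff using submonoid_generated_zero submonoid_generated_inc[of _ A] A
    by (elim disjE) simp_all
next
  have "(!) [0, w1, w2, w3] ` {..<4} = {0, w1, w2, w3}"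
    by (simp add: lessThan_nat_numeral lessThan_Suc eval_nat_numeral insert_commute)
  thus "A \<subseteq> insert 4 ((!) [0, w1, w2, w3] ` {..<4})" using A by auto
qed (simp_all add: A)

text \<open>As for multiplicity 4, but one Apery element may be missing from the generators: it is
  then the double of the generator \<open>u\<close>.\<close>

lemma submonoid_generated_5:
  assumes "w1 mod 5 = 1" "w2 mod 5 = 2" "w3 mod 5 = (3::nat)" "w4 mod 5 = 4"
    and "w2 \<le> 2 * w1" "w3 \<le> w1 + w2" "w4 \<le> w1 + w3" "w4 \<le> 2 * w2" "w1 \<le> w2 + w4" "w1 \<le> 2 * w3"
      "w2 \<le> w3 + w4" "w3 \<le> 2 * w4"
    and A: "5 \<in> A" "A \<subseteq> {5, w1, w2, w3, w4}" and u: "u \<in> A" "{w1, w2, w3, w4} \<subseteq> insert (u * 2) A"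
  shows "submonoid_generated A = {n. [0, w1, w2, w3, w4] ! (n mod 5) \<le> n}"
proof (rule submonoid_generated_apery)
  fix i j :: nat assume "i < 5" "j < 5"
  thus "[0, w1, w2, w3, w4] ! ((i + j) mod 5) \<le> [0, w1, w2, w3, w4] ! i + [0, w1, w2, w3, w4] ! j"
    unfolding less_5_iff using assms(1-12) by (elim disjE) simp_all
next
  fix i :: nat assume "i < 5"
  thus "[0, w1, w2, w3, w4] ! i mod 5 = i"
    unfolding less_5_iff using assms(1-12) by (elim disjE) simp_all
next
  have "insert (u * 2) A \<subseteq> submonoid_generated A"
    using u(1) by (auto intro: submonoid_generated_inc submonoid_generated_mult)
  hence *: "{w1, w2, w3, w4} \<subseteq> submonoid_generated A" using u(2) by blast
  fix i :: nat assume "i < 5"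
  thus "[0, w1, w2, w3, w4] ! i \<in> submonoid_generated A"
    unfolding less_5_iff using submonoid_generated_zero *
    by (elim disjE) simp_all
next
  have "(!) [0, w1, w2, w3, w4] ` {..<5} = {0, w1, w2, w3, w4}"
    by (simp add: lessThan_nat_numeral lessThan_Suc eval_nat_numeral insert_commute)
  thus "A \<subseteq> insert 5 ((!) [0, w1, w2, w3, w4] ` {..<5})" using A by auto
qed (auto simp: A)

lemma mod_eq_imp_le:
  assumes "n mod e = w mod e" "w < n + e"
  shows "w \<le> (n::nat)"
proof (rule ccontr)
  assume "\<not> w \<le> n"
  hence "e dvd w - n" "0 < w - n" using mod_eq_dvd_iff_nat[of n w e] assms(1) by auto
  thus False using dvd_imp_le[of e "w - n"] assms(2) by linarith
qed

lemma nat_mod_4_cases: obtains "n mod 4 = 0" | "n mod 4 = 1" | "n mod 4 = 2" | "n mod 4 = (3::nat)"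
  by linarith

lemma nat_mod_5_cases:
  obtains "n mod 5 = 0" | "n mod 5 = 1" | "n mod 5 = 2" | "n mod 5 = 3" | "n mod 5 = (4::nat)"
  by linarith

section \<open>The six families satisfy the sumset condition\<close>

context numerical_semigroup_loc begin

lemma F_eqI:
  assumes "f \<notin> H" "\<And>n. n > f \<Longrightarrow> n \<in> H"
  shows "F = int f"
proof (rule antisym)
  show "int f \<le> F" using Z_above_F[of "int f"] assms(1) by (force simp: Z_iff)
  show "F \<le> int f" 
  proof (rule ccontr)
    assume "\<not> F \<le> int f"
    hence "f < nat F" "int (nat F) = F" by simp_all
    thus False using assms(2)[of "nat F"] F_notin Z_iff[of "nat F"] by simp
  qed
qed

lemma double_K_ifI:
  assumes H: "\<And>n. n \<in> H \<longleftrightarrow> ws ! (n mod e) \<le> n" and e: "ws ! 0 = 0" "0 < e" "e \<le> 5"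
    and f: "\<And>n. n > f \<Longrightarrow> ws ! (n mod e) \<le> n" "\<not> ws ! (f mod e) \<le> f"
    and g: "\<not> ws ! (g mod e) \<le> g" "f = g + 1"
    and h: "\<not> ws ! (h mod e) \<le> h" "f = h + b" and b: "b = 2 \<or> b = 3" and n: "n \<ge> 0"
  shows "\<exists>k\<in>K. \<exists>l\<in>K. n = k + l"
proof -
  have "f \<notin> H" "\<And>n. n > f \<Longrightarrow> n \<in> H" using f by (simp_all add: H)
  hence F: "F = int f" by (rule F_eqI)
  have "e \<in> H" using e by (simp add: H)
  moreover have F': "F - 1 = int g" "F - int b = int h" using F g h by auto
  have "F - 1 \<notin> Z" "F - int b \<notin> Z" using g h unfolding F' Z_iff H by simp_all
  ultimately show ?thesis using double_K_if[of "int e" "int b" n] b e n by (auto simp: Z_iff)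
qed

lemma double_K_of_family:
  assumes "in_type3_family H" "n \<ge> 0"
  shows "\<exists>k\<in>K. \<exists>l\<in>K. n = k + l"
proof -
  from assms(1) obtain m where m: "m \<ge> 1" and H:
    "H = submonoid_generated {4, 4*m+1, 4*m+2, 4*m+3} \<or>
       H = submonoid_generated {4, 4*m+3, 4*m+5, 4*m+6} \<or>
       H = submonoid_generated {5, 5*m+4, 10*m+6, 10*m+7} \<or>
       H = submonoid_generated {5, 5*m+1, 10*m+3, 10*m+4} \<or>
       H = submonoid_generated {5, 5*m+2, 10*m+1, 10*m+3} \<or>
       H = submonoid_generated {5, 5*m+3, 10*m+4, 10*m+7}"
    unfolding in_type3_family_def by blast
  \<comment> \<open>Writing \<open>m\<close> as a successor keeps truncated subtraction out of the
    Frobenius numbers, such as 4m - 1 in the first family.\<close>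
  obtain j where j: "m = Suc j" using m by (cases m) auto
  have res5: "(5 * j + c) mod 5 = c mod 5" "(10 * j + c) mod 5 = c mod 5" "(4 * j + c) mod 4 = c mod 4" for c
    using mod_mult_self4[of 5 "2 * j" c] by simp_all
  from H show ?thesis
  proof (elim disjE)
    assume H: "H = submonoid_generated {4, 4*m+1, 4*m+2, 4*m+3}"
    have res: "(4*j+5) mod 4 = 1" "(4*j+6) mod 4 = 2" "(4*j+7) mod 4 = 3" "(4*j+3) mod 4 = 3" "(4*j+2) mod 4 = 2" "(4*j+1) mod 4 = 1"
      by (simp_all only: res5, simp_all)
    have "submonoid_generated {4, 4*m+1, 4*m+2, 4*m+3} = {n. [0, 4*j+5, 4*j+6, 4*j+7] ! (n mod 4) \<le> n}"
      by (rule submonoid_generated_4; (simp only: res; fail | auto simp: j))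
    hence H: "n \<in> H \<longleftrightarrow> [0, 4*j+5, 4*j+6, 4*j+7] ! (n mod 4) \<le> n" for n unfolding H by blast
    have up: "[0, 4*j+5, 4*j+6, 4*j+7] ! (n mod 4) \<le> n" if "n > 4*j+3" for n
      by (rule nat_mod_4_cases[where n = n]; simp; rule mod_eq_imp_le[of _ 4]; (simp only: res)?; use that in simp)
    \<comment> \<open>Here and in the other five cases \<open>f\<close>, \<open>g\<close>,
      \<open>h\<close> are Apery elements minus the multiplicity, \<open>f\<close> coming from the
      largest one.\<close>
    show ?thesis
      by (rule double_K_ifI[OF H _ _ _ up, where f = "4*j+3" and g = "4*j+2" and h = "4*j+1" and b = 2])
        (simp_all add: res[simplified] assms(2))
  next
    assume H: "H = submonoid_generated {4, 4*m+3, 4*m+5, 4*m+6}"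
    have res: "(4*j+9) mod 4 = 1" "(4*j+10) mod 4 = 2" "(4*j+7) mod 4 = 3" "(4*j+6) mod 4 = 2" "(4*j+5) mod 4 = 1" "(4*j+3) mod 4 = 3"
      by (simp_all only: res5, simp_all)
    have "submonoid_generated {4, 4*m+3, 4*m+5, 4*m+6} = {n. [0, 4*j+9, 4*j+10, 4*j+7] ! (n mod 4) \<le> n}"
      by (rule submonoid_generated_4; (simp only: res; fail | auto simp: j))
    hence H: "n \<in> H \<longleftrightarrow> [0, 4*j+9, 4*j+10, 4*j+7] ! (n mod 4) \<le> n" for n unfolding H by blast
    have up: "[0, 4*j+9, 4*j+10, 4*j+7] ! (n mod 4) \<le> n" if "n > 4*j+6" for n
      by (rule nat_mod_4_cases[where n = n]; simp; rule mod_eq_imp_le[of _ 4]; (simp only: res)?; use that in simp)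
    show ?thesis
      by (rule double_K_ifI[OF H _ _ _ up, where f = "4*j+6" and g = "4*j+5" and h = "4*j+3" and b = 3])
        (simp_all add: res[simplified] assms(2))
  next
    assume H: "H = submonoid_generated {5, 5*m+4, 10*m+6, 10*m+7}"
    have res: "(10*j+16) mod 5 = 1" "(10*j+17) mod 5 = 2" "(10*j+18) mod 5 = 3" "(5*j+9) mod 5 = 4" "(10*j+13) mod 5 = 3" "(10*j+12) mod 5 = 2" "(10*j+11) mod 5 = 1"
      by (simp_all only: res5, simp_all)
    have "submonoid_generated {5, 5*m+4, 10*m+6, 10*m+7} = {n. [0, 10*j+16, 10*j+17, 10*j+18, 5*j+9] ! (n mod 5) \<le> n}"
      by (rule submonoid_generated_5[where u = "5*j+9"]; (simp only: res; fail | auto simp: j))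
    hence H: "n \<in> H \<longleftrightarrow> [0, 10*j+16, 10*j+17, 10*j+18, 5*j+9] ! (n mod 5) \<le> n" for n unfolding H by blast
    have up: "[0, 10*j+16, 10*j+17, 10*j+18, 5*j+9] ! (n mod 5) \<le> n" if "n > 10*j+13" for n
      by (rule nat_mod_5_cases[where n = n]; simp; rule mod_eq_imp_le[of _ 5]; (simp only: res)?; use that in simp)
    show ?thesis
      by (rule double_K_ifI[OF H _ _ _ up, where f = "10*j+13" and g = "10*j+12" and h = "10*j+11" and b = 2])
        (simp_all add: res[simplified] assms(2))
  next
    assume H: "H = submonoid_generated {5, 5*m+1, 10*m+3, 10*m+4}"
    have res: "(5*j+6) mod 5 = 1" "(10*j+12) mod 5 = 2" "(10*j+13) mod 5 = 3" "(10*j+14) mod 5 = 4" "(10*j+9) mod 5 = 4" "(10*j+8) mod 5 = 3" "(10*j+7) mod 5 = 2"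
      by (simp_all only: res5, simp_all)
    have "submonoid_generated {5, 5*m+1, 10*m+3, 10*m+4} = {n. [0, 5*j+6, 10*j+12, 10*j+13, 10*j+14] ! (n mod 5) \<le> n}"
      by (rule submonoid_generated_5[where u = "5*j+6"]; (simp only: res; fail | auto simp: j))
    hence H: "n \<in> H \<longleftrightarrow> [0, 5*j+6, 10*j+12, 10*j+13, 10*j+14] ! (n mod 5) \<le> n" for n unfolding H by blast
    have up: "[0, 5*j+6, 10*j+12, 10*j+13, 10*j+14] ! (n mod 5) \<le> n" if "n > 10*j+9" for n
      by (rule nat_mod_5_cases[where n = n]; simp; rule mod_eq_imp_le[of _ 5]; (simp only: res)?; use that in simp)
    show ?thesis
      by (rule double_K_ifI[OF H _ _ _ up, where f = "10*j+9" and g = "10*j+8" and h = "10*j+7" and b = 2])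
        (simp_all add: res[simplified] assms(2))
  next
    assume H: "H = submonoid_generated {5, 5*m+2, 10*m+1, 10*m+3}"
    have res: "(10*j+11) mod 5 = 1" "(5*j+7) mod 5 = 2" "(10*j+13) mod 5 = 3" "(10*j+14) mod 5 = 4" "(10*j+9) mod 5 = 4" "(10*j+8) mod 5 = 3" "(10*j+6) mod 5 = 1"
      by (simp_all only: res5, simp_all)
    have "submonoid_generated {5, 5*m+2, 10*m+1, 10*m+3} = {n. [0, 10*j+11, 5*j+7, 10*j+13, 10*j+14] ! (n mod 5) \<le> n}"
      by (rule submonoid_generated_5[where u = "5*j+7"]; (simp only: res; fail | auto simp: j))
    hence H: "n \<in> H \<longleftrightarrow> [0, 10*j+11, 5*j+7, 10*j+13, 10*j+14] ! (n mod 5) \<le> n" for n unfolding H by blast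
    have up: "[0, 10*j+11, 5*j+7, 10*j+13, 10*j+14] ! (n mod 5) \<le> n" if "n > 10*j+9" for n
      by (rule nat_mod_5_cases[where n = n]; simp; rule mod_eq_imp_le[of _ 5]; (simp only: res)?; use that in simp)
    show ?thesis
      by (rule double_K_ifI[OF H _ _ _ up, where f = "10*j+9" and g = "10*j+8" and h = "10*j+6" and b = 3])
        (simp_all add: res[simplified] assms(2))
  next
    assume H: "H = submonoid_generated {5, 5*m+3, 10*m+4, 10*m+7}"
    have res: "(10*j+16) mod 5 = 1" "(10*j+17) mod 5 = 2" "(5*j+8) mod 5 = 3" "(10*j+14) mod 5 = 4" "(10*j+12) mod 5 = 2" "(10*j+11) mod 5 = 1" "(10*j+9) mod 5 = 4"
      by (simp_all only: res5, simp_all)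
    have "submonoid_generated {5, 5*m+3, 10*m+4, 10*m+7} = {n. [0, 10*j+16, 10*j+17, 5*j+8, 10*j+14] ! (n mod 5) \<le> n}"
      by (rule submonoid_generated_5[where u = "5*j+8"]; (simp only: res; fail | auto simp: j))
    hence H: "n \<in> H \<longleftrightarrow> [0, 10*j+16, 10*j+17, 5*j+8, 10*j+14] ! (n mod 5) \<le> n" for n unfolding H by blast
    have up: "[0, 10*j+16, 10*j+17, 5*j+8, 10*j+14] ! (n mod 5) \<le> n" if "n > 10*j+12" for n
      by (rule nat_mod_5_cases[where n = n]; simp; rule mod_eq_imp_le[of _ 5]; (simp only: res)?; use that in simp)
    show ?thesis
      by (rule double_K_ifI[OF H _ _ _ up, where f = "10*j+12" and g = "10*j+11" and h = "10*j+9" and b = 3])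
        (simp_all add: res[simplified] assms(2))
  qed
qed

section \<open>From the sumset condition to the six families\<close>

lemma H_eq_generated:
  assumes "0 < e" "e \<in> A" "A \<subseteq> H"
    and w: "\<And>i. i < e \<Longrightarrow> w i \<in> submonoid_generated A"
      "\<And>i. i < e \<Longrightarrow> w i mod e = i" "\<And>i. i < e \<Longrightarrow> int (w i) - int e \<notin> Z"
  shows "H = submonoid_generated A"
proof (rule submonoid_generated_eqI[symmetric, OF \<open>A \<subseteq> H\<close> H_zero])
  fix n assume "n \<in> H"
  have i: "n mod e < e" using assms by simp
  show "n \<in> submonoid_generated A"
  proof (rule submonoid_generated_residue[OF \<open>e \<in> A\<close> w(1)[OF i]])
    show "n mod e = w (n mod e) mod e" using w(2)[OF i] by simp
    show "w (n mod e) \<le> n"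
    proof (rule mod_eq_imp_le)
      show "n mod e = w (n mod e) mod e" using w(2)[OF i] by simp
      show "w (n mod e) < n + e"
      proof (rule ccontr)
        assume *: "\<not> w (n mod e) < n + e"
        have "e dvd w (n mod e) - n"
          using * w(2)[OF i] mod_eq_dvd_iff_nat[of n "w (n mod e)" e] by simp
        then obtain k where k: "w (n mod e) - n = e * k" ..
        have "k \<noteq> 0" using k * \<open>0 < e\<close> by (cases k) auto
        then obtain l where l: "k = Suc l" by (cases k) auto
        \<comment> \<open>An element of \<open>H\<close> below the Apery element of its class would
          put \<open>w (n mod e) - e\<close> into \<open>Z\<close>.\<close>
        have "w (n mod e) = n + e * l + e" using k l * by simp
        hence "int (w (n mod e)) - int e = int n + int e * int l" by simp
        moreover have "int n + int e * int l \<in> Z"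
          using \<open>n \<in> H\<close> assms(2,3) by (intro Z_add Z_mult) (auto simp: Z_iff)
        ultimately show False using w(3)[OF i] by simp
      qed
    qed
  qed
qed (rule H_add)

text \<open>Two distinct ones in a class would differ by a positive multiple of \<open>e\<close>,
  and adding that multiple to the smaller one would put the larger one into
  \<open>Z\<close>.\<close>

lemma PF_eqI:
  assumes "f \<in> pseudo_frobenius H" "g \<in> pseudo_frobenius H" "e \<in> Z" "e > 0" "f mod e = g mod e"
  shows "f = g"
proof -
  have *: "\<not> f < g" if "f \<in> pseudo_frobenius H" "g \<in> pseudo_frobenius H" "f mod e = g mod e" for f g
  proof
    assume "f < g"
    obtain k where k: "g = f + e * k" using \<open>f mod e = g mod e\<close> by (metis mod_eqE)
    hence "k > 0" using \<open>f < g\<close> \<open>e > 0\<close> by (simp add: zero_less_mult_iff)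
    hence "e * k \<in> Z" "e * k > 0" using Z_mult[OF \<open>e \<in> Z\<close>, of k] \<open>e > 0\<close> by auto
    thus False using \<open>f \<in> _\<close> \<open>g \<in> _\<close> k by (auto simp: PF_iff)
  qed
  show ?thesis using *[of f g] *[of g f] assms by force
qed

lemma PF_mod_nonzero:
  assumes "f \<in> pseudo_frobenius H" "e \<in> Z" "e > 1"
  shows "f mod e \<noteq> 0"
proof
  assume "f mod e = 0"
  then obtain k where k: "f = e * k" by auto
  have "k < 0"
    using Z_mult[of e k] assms k by (force simp: PF_iff)
  have "F + e \<in> Z" "F + e > 0" using assms F_ge Z_above_F by auto
  hence "f + (F + e) \<in> Z" using assms by (auto simp: PF_iff)
  \<comment> \<open>With \<open>f = e * k\<close> the sum collapses to \<open>F\<close>. The summand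
    \<open>F + e\<close> is positive because \<open>F\<close> is at least -1 and \<open>e\<close>
    exceeds 1.\<close>
  hence "f + (F + e) + e * (-1 - k) \<in> Z" using Z_mult[OF assms(2), of "-1 - k"] \<open>k < 0\<close> by (intro Z_add[of "f + (F + e)"]) auto
  thus False using k F_notin by (simp add: algebra_simps)
qed

text \<open>For \<open>e = 5\<close> the Apery set has one nonzero element \<open>w\<close> that is not maximal. A maximal element above \<open>w\<close> exceeds it by a nonzero, nonmaximal Apery element, which can only be \<open>w\<close> itself.\<close>

lemma PF_fourth_residue:
  assumes "5 \<in> Z" "w \<in> Z" "w - 5 \<notin> Z" "w mod 5 \<noteq> 0"
    and w: "\<And>f. f \<in> pseudo_frobenius H \<Longrightarrow> f mod 5 \<noteq> w mod 5"
    and all: "\<And>z. z mod 5 = 0 \<or> z mod 5 = w mod 5 \<or> (\<exists>f\<in>pseudo_frobenius H. z mod 5 = f mod 5)"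
  shows "2 * w - 5 \<in> pseudo_frobenius H"
proof -
  obtain h where h: "h \<in> Z" "w - 5 + h \<in> pseudo_frobenius H"
    using below_PF[OF assms(3)] .
  have "w + (h - 5) \<notin> Z" using h by (simp add: PF_iff algebra_simps)
  \<comment> \<open>So \<open>h\<close> is itself an Apery element, and its residue class determines
    it.\<close>
  hence h5: "h - 5 \<notin> Z" using Z_add[OF \<open>w \<in> Z\<close>] by blast
  note ap = apery_iff[OF \<open>5 \<in> Z\<close>]
  from all[of h] consider "h mod 5 = 0" | "h mod 5 = w mod 5"
    | f where "f \<in> pseudo_frobenius H" "h mod 5 = f mod 5" by blast
  thus ?thesis
  proof cases
    case 1
    hence "(w - 5 + h) mod 5 = w mod 5" by presburger
    thus ?thesis using w h by blast
  next
    case 2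
    hence "w \<le> h" "\<not> w \<le> h - 5"
      using ap[OF assms(2,3), of h] ap[OF assms(2,3), of "h - 5"] h h5 by (auto simp: mod_diff_right_eq)
    hence "h = w" using 2 by presburger
    thus ?thesis using h by (simp add: algebra_simps)
  next
    case 3
    have f5: "f + 5 \<in> Z" "f + 5 - 5 \<notin> Z" using 3 assms(1) by (auto simp: PF_iff)
    have "f + 5 \<le> h" "\<not> f + 5 \<le> h - 5"
      using ap[OF f5, of h] ap[OF f5, of "h - 5"] h h5 3 by auto
    hence "h = f + 5" using 3 by presburger
    \<comment> \<open>Impossible, since \<open>f\<close> is pseudo-Frobenius and \<open>w\<close> is
      a positive element of \<open>Z\<close>.\<close>
    hence "w + f \<notin> Z" using h by (simp add: PF_iff algebra_simps)
    moreover have "w > 0" using assms(2,4) Z_nonneg[of w] by (cases "w = 0") auto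
    ultimately show ?thesis using 3 assms(2) by (auto simp: PF_iff add.commute)
  qed
qed

lemma multiplicity_ex:
  obtains e where "e \<in> H" "e > 0" "\<And>z. z \<in> Z \<Longrightarrow> z = 0 \<or> int e \<le> z"
proof -
  define e where "e = (LEAST n. n \<in> H \<and> n > 0)"
  have "e \<in> H \<and> e > 0"
    unfolding e_def by (rule LeastI[of _ "Suc conductor"]) (simp add: conductor_in)
  moreover have "z = 0 \<or> int e \<le> z" if "z \<in> Z" for z
  proof -
    obtain n where n: "z = int n" "n \<in> H" using \<open>z \<in> Z\<close> by (auto simp: Z_def)
    have "e \<le> n" if "n > 0" using n that unfolding e_def by (intro Least_le) auto
    thus ?thesis using n by auto
  qed
  ultimately show thesis using that by blast
qed

lemma PF_shape_of_double_K:
  assumes card: "card (pseudo_frobenius H) = 3" and K2: "\<forall>n\<ge>0. \<exists>k\<in>K. \<exists>l\<in>K. n = k + l"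
    and e: "e \<in> Z" "e > 0" "\<And>z. z \<in> Z \<Longrightarrow> z = 0 \<or> e \<le> z"
  obtains b where "b = 2 \<or> b = 3" "e = 4 \<or> e = 5" "pseudo_frobenius H = {F, F - 1, F - b}"
proof -
  have "card (pseudo_frobenius H - {F}) = 2"
    using card F_PF by (simp add: card_gt_0_iff)
  then obtain x y where xy: "pseudo_frobenius H - {F} = {x, y}" "x \<noteq> y"
    by (auto simp: card_2_iff)
  define a b where "a = F - max x y" and "b = F - min x y"
  have "x < F" "y < F" using xy PF_le[of x] PF_le[of y] by force+
  hence ab: "0 < a" "a < b" using xy(2) by (auto simp: a_def b_def)
  have PF: "pseudo_frobenius H = {F, F - a, F - b}"
    using xy F_PF by (auto simp: a_def b_def max_def min_def)
  \<comment> \<open>The generators \<open>F - f\<close> of \<open>K\<close> are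
    \<open>0, a, b\<close>. Decomposing a number below \<open>e\<close> leaves no room for a
    positive element of \<open>Z\<close>, which is at least \<open>e\<close>.\<close>
  have sums: "\<exists>k\<in>{0,a,b}. \<exists>l\<in>{0,a,b}. n = k + l" if n: "0 \<le> n" "n < e" for n
  proof -
    obtain k l where kl: "k \<in> K" "l \<in> K" "n = k + l" using K2 n by blast
    obtain f h where f: "f \<in> pseudo_frobenius H" "h \<in> Z" "k = F - f + h" using kl K_obtain_PF by blast
    obtain f' h' where f': "f' \<in> pseudo_frobenius H" "h' \<in> Z" "l = F - f' + h'" using kl K_obtain_PF by blast
    have "f \<le> F" "f' \<le> F" using PF_le f f' by auto
    moreover have "h \<ge> 0" "h' \<ge> 0" using f f' Z_nonneg by auto
    ultimately have "h = 0" "h' = 0"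
      using n kl(3) f(3) f'(3) e(3)[OF f(2)] e(3)[OF f'(2)] by linarith+
    moreover have "F - f \<in> {0,a,b}" "F - f' \<in> {0,a,b}" using f(1) f'(1) PF by auto
    ultimately show ?thesis using kl(3) f(3) f'(3) by (intro bexI[of _ "F - f"] bexI[of _ "F - f'"]) simp_all
  qed
  have mod_ne: "f \<noteq> g \<Longrightarrow> f \<in> {F, F-a, F-b} \<Longrightarrow> g \<in> {F, F-a, F-b} \<Longrightarrow> f mod e \<noteq> g mod e" for f g
    using PF_eqI[of f g e] PF e by auto
  have mod_ne0: "e > 1 \<Longrightarrow> f \<in> {F, F-a, F-b} \<Longrightarrow> f mod e \<noteq> 0" for f
    using PF_mod_nonzero[of f e] PF e by auto
  \<comment> \<open>Three pseudo-Frobenius numbers occupy three different nonzero classes modulo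
    \<open>e\<close>.\<close>
  have "e \<ge> 4"
  proof (rule ccontr)
    assume "\<not> e \<ge> 4"
    hence "e = 1 \<or> e = 2 \<or> e = 3" using e by linarith
    thus False
    proof (elim disjE)
      assume "e = 1" thus False using mod_ne[of F "F - a"] ab by simp
    next
      assume "e = 2" thus False
        using mod_ne[of F "F - a"] mod_ne0[of F] mod_ne0[of "F - a"] ab by simp
    next
      assume "e = 3" 
      thus False
        using mod_ne[of F "F - a"] mod_ne[of F "F - b"] mod_ne[of "F - a" "F - b"]
          mod_ne0[of F] mod_ne0[of "F - a"] mod_ne0[of "F - b"] ab
          pos_mod_bound[of 3 F] pos_mod_sign[of 3 F] pos_mod_bound[of 3 "F-a"] pos_mod_sign[of 3 "F-a"]
          pos_mod_bound[of 3 "F-b"] pos_mod_sign[of 3 "F-b"] 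
        by (simp del: pos_mod_bound pos_mod_sign)
    qed
  qed
  \<comment> \<open>Decomposing 1 forces \<open>a = 1\<close>, and decomposing 3 forces
    \<open>b\<close> to be 2 or 3. Then 5 is no sum of two of \<open>0, 1, b\<close>, which bounds
    \<open>e\<close>.\<close>
  have "a = 1" using sums[of 1] ab \<open>e \<ge> 4\<close> by auto
  moreover have "b = 2 \<or> b = 3" using sums[of 3] ab \<open>e \<ge> 4\<close> \<open>a = 1\<close> by auto
  moreover have "e \<le> 5"
  proof (rule ccontr)
    assume "\<not> e \<le> 5"
    thus False using sums[of 5] \<open>a = 1\<close> \<open>b = 2 \<or> b = 3\<close> by auto
  qed
  moreover have "e = 4 \<or> e = 5" using \<open>e \<ge> 4\<close> \<open>e \<le> 5\<close> by linarith
  ultimately show thesis using that[of b] PF by simp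
qed

lemma apery_ex:
  assumes "e \<in> H" "r < e"
  obtains w where "w \<in> H" "w mod e = r" "int w - int e \<notin> Z"
proof -
  define w where "w = (LEAST n. n \<in> H \<and> n mod e = r)"
  have "e * conductor + r \<in> H"
    using assms by (intro conductor_in) (cases e; simp)
  moreover have "(e * conductor + r) mod e = r" using assms(2) by simp
  ultimately have w: "w \<in> H \<and> w mod e = r"
    unfolding w_def by (rule LeastI[of _ "e * conductor + r", OF conjI])
  have "int w - int e \<notin> Z"
  proof
    assume "int w - int e \<in> Z"
    then obtain n where n: "int w - int e = int n" "n \<in> H" by (auto simp: Z_def)
    hence wn: "w = n + e" by linarith
    hence "n mod e = r" using w by simp
    hence "w \<le> n" unfolding w_def using n by (intro Least_le) simp
    thus False using wn assms by simp
  qed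
  thus thesis using that w by blast
qed

lemma family_of_double_K:
  assumes card: "card (pseudo_frobenius H) = 3" and K2: "\<forall>n\<ge>0. \<exists>k\<in>K. \<exists>l\<in>K. n = k + l"
  shows "in_type3_family H"
proof -
  obtain e where e: "e \<in> H" "e > 0" "\<And>z. z \<in> Z \<Longrightarrow> z = 0 \<or> int e \<le> z"
    using multiplicity_ex by blast
  have eZ: "int e \<in> Z" using e by (simp add: Z_iff)
  obtain b where b: "b = 2 \<or> b = 3" "int e = 4 \<or> int e = 5" "pseudo_frobenius H = {F, F - 1, F - b}"
    using PF_shape_of_double_K[OF card K2 eZ] e by auto
  have PF: "f + int e \<in> Z" "f \<notin> Z" "f mod int e \<noteq> 0" if "f \<in> {F, F - 1, F - b}" for f
    using that b(2,3) eZ PF_iff[of f] PF_mod_nonzero[OF _ eZ, of f] by auto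
  \<comment> \<open>All three pseudo-Frobenius numbers are nonnegative; for \<open>e = 4\<close>
    this is what makes the parameter \<open>m\<close> at least 1.\<close>
  have up: "int e \<le> f + int e" if "f \<in> {F, F - 1, F - b}" for f
  proof -
    have "f + int e \<noteq> 0"
    proof
      assume "f + int e = 0"
      hence "f = int e * (-1)" by simp
      hence "f mod int e = 0" by simp
      thus False using PF(3)[OF that] by blast
    qed
    thus ?thesis using e(3)[OF PF(1)[OF that]] by blast
  qed
  from b(2) have "e = 4 \<or> e = 5" by linarith
  thus ?thesis
  proof
    assume e4: "e = 4"
    have mods: "F mod 4 \<noteq> 0" "(F - 1) mod 4 \<noteq> 0" "(F - b) mod 4 \<noteq> 0"
      using PF(3)[of F] PF(3)[of "F - 1"] PF(3)[of "F - b"] e4 by auto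
    \<comment> \<open>For \<open>e = 4\<close> the pseudo-Frobenius numbers fill the three nonzero
      classes, so adding 4 to them yields all nonzero Apery elements.\<close>
    have gen: "H = submonoid_generated A"
      if res: "w1 mod 4 = 1" "w2 mod 4 = 2" "w3 mod 4 = 3" and A: "A = {4, w1, w2, w3}"
        and F: "{int w1 - 4, int w2 - 4, int w3 - 4} \<subseteq> {F, F - 1, F - b}" for A w1 w2 w3
    proof -
      have w: "int w - 4 \<notin> Z" "w \<in> H" if "w \<in> {w1, w2, w3}" for w
      proof -
        have *: "int w - 4 \<in> {F, F - 1, F - b}" using that F by blast
        show "int w - 4 \<notin> Z" "w \<in> H" using PF(1,2)[OF *] e4 Z_iff[of w] by simp_all
      qed
      show ?thesis
      proof (rule H_eq_generated[where w = "(!) [0, w1, w2, w3]"])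
        fix i :: nat assume "i < 4"
        hence "int ([0, w1, w2, w3] ! i) - int 4 \<notin> Z \<and>
          [0, w1, w2, w3] ! i mod 4 = i \<and> [0, w1, w2, w3] ! i \<in> submonoid_generated A"
          unfolding less_4_iff using w(1) res A Z_nonneg[of "-4"] submonoid_generated_zero[of A] submonoid_generated_inc[of _ A]
          by (elim disjE) (simp_all, (blast+)?)
        thus "int ([0, w1, w2, w3] ! i) - int 4 \<notin> Z"
          "[0, w1, w2, w3] ! i mod 4 = i" "[0, w1, w2, w3] ! i \<in> submonoid_generated A" by blast+
      qed (use w(2) e(1) e4 A in simp_all)
    qed
    from b(1) show ?thesis
    proof
      assume b2: "b = 2"
      have "F mod 4 = 3" using mods unfolding b2 by presburger
      then obtain q where q: "F = 4 * q + 3" by (metis mult_div_mod_eq)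
      have "q \<ge> 0" using up[of "F - 2"] b2 q by simp
      then obtain j where j: "q = int j" using nonneg_int_cases by blast
      define m where "m = j + 1"
      have "H = submonoid_generated {4, 4*m+1, 4*m+2, 4*m+3}"
        by (rule gen[of "4*m+1" "4*m+2" "4*m+3"]) (use q j b2 in \<open>simp_all add: m_def\<close>)
      thus ?thesis unfolding in_type3_family_def by (intro exI[of _ m]) (simp add: m_def)
    next
      assume b3: "b = 3"
      have "F mod 4 = 2" using mods unfolding b3 by presburger
      then obtain q where q: "F = 4 * q + 2" by (metis mult_div_mod_eq)
      have "q \<ge> 1" using up[of "F - 3"] b3 q by simp
      then obtain j where j: "q = int j + 1" by (metis add.commute zle_iff_zadd)
      define m where "m = j + 1"
      have "H = submonoid_generated {4, 4*m+3, 4*m+5, 4*m+6}"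
        by (rule gen[of "4*m+5" "4*m+6" "4*m+3"]) (use q j b3 in \<open>auto simp: m_def\<close>)
      thus ?thesis unfolding in_type3_family_def by (intro exI[of _ m]) (simp add: m_def)
    qed
  next
    assume e5: "e = 5"
    have mods: "F mod 5 \<noteq> 0" "(F - 1) mod 5 \<noteq> 0" "(F - b) mod 5 \<noteq> 0"
      using PF(3)[of F] PF(3)[of "F - 1"] PF(3)[of "F - b"] e5 by auto
    \<comment> \<open>\<open>r\<close> is the class missed by 0 and the three pseudo-Frobenius
      numbers. Its Apery element is \<open>5 * m + r\<close>, and by
      \<open>PF_fourth_residue\<close> its double minus 5 is one of the three.\<close>
    have fourth: "\<exists>m\<ge>1. 5 * m + r \<in> H \<and> int (5 * m + r) - 5 \<notin> Z \<and>
        (10 * int m + 2 * int r - 5 = F \<or> 10 * int m + 2 * int r - 5 = F - 1 \<or> 10 * int m + 2 * int r - 5 = F - b)"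
      if r: "0 < r" "r < 5" and all: "\<And>z. z mod 5 = 0 \<or> z mod 5 = int r \<or>
          z mod 5 = F mod 5 \<or> z mod 5 = (F - 1) mod 5 \<or> z mod 5 = (F - b) mod 5"
        and ne: "F mod 5 \<noteq> int r" "(F - 1) mod 5 \<noteq> int r" "(F - b) mod 5 \<noteq> int r" for r
    proof -
      obtain w where w: "w \<in> H" "w mod 5 = r" "int w - 5 \<notin> Z"
        using apery_ex[OF e(1), of r] e5 r by auto
      have wr: "int w mod 5 = int r" using w(2) zmod_int[of w 5] by simp
      have "2 * int w - 5 \<in> pseudo_frobenius H"
      proof (rule PF_fourth_residue)
        show "5 \<in> Z" "int w \<in> Z" "int w - 5 \<notin> Z" using eZ e5 w by (simp_all add: Z_iff)
        show "int w mod 5 \<noteq> 0" using wr r by simp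
        show "f mod 5 \<noteq> int w mod 5" if "f \<in> pseudo_frobenius H" for f
          using that ne unfolding wr b(3) by blast
        show "z mod 5 = 0 \<or> z mod 5 = int w mod 5 \<or> (\<exists>f\<in>pseudo_frobenius H. z mod 5 = f mod 5)" for z
          using all[of z] unfolding wr b(3) by blast
      qed
      hence 2: "2 * int w - 5 \<in> {F, F - 1, F - b}" using b(3) by simp
      define m where "m = w div 5"
      have wm: "w = 5 * m + r" using w(2) mult_div_mod_eq[of 5 w] by (simp add: m_def)
      have "w \<noteq> 0" using wm r by simp
      hence "5 \<le> w" using e(3)[of "int w"] w(1) e5 by (simp add: Z_iff)
      hence "m \<ge> 1" by (simp add: m_def div_greater_zero_iff Suc_le_eq)
      moreover have "2 * int w - 5 = 10 * int m + 2 * int r - 5" using wm by simp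
      ultimately show ?thesis using w(1,3) 2 unfolding wm by (intro exI[of _ m]) simp
    qed
    have gen: "H = submonoid_generated A"
      if res: "w1 mod 5 = 1" "w2 mod 5 = 2" "w3 mod 5 = 3" "w4 mod 5 = 4"
        and A: "A \<subseteq> {5, w1, w2, w3, w4}" "5 \<in> A" and u: "u \<in> A" "{w1, w2, w3, w4} \<subseteq> insert (u * 2) A"
        and F: "\<And>w. w \<in> {w1, w2, w3, w4} \<Longrightarrow> w = u \<or> int w - 5 \<in> {F, F - 1, F - b}"
        and uH: "u \<in> H" "int u - 5 \<notin> Z"
      for A w1 w2 w3 w4 u
    proof -
      have w: "int w - 5 \<notin> Z" "w \<in> H" if "w \<in> {w1, w2, w3, w4}" for w
        using F[OF that]
      proof (atomize(full), elim disjE)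
        assume "w = u" thus "int w - 5 \<notin> Z \<and> w \<in> H" using uH by simp
      next
        assume *: "int w - 5 \<in> {F, F - 1, F - b}"
        show "int w - 5 \<notin> Z \<and> w \<in> H" using PF(1,2)[OF *] e5 Z_iff[of w] by simp
      qed
      have "insert (u * 2) A \<subseteq> submonoid_generated A"
        using u(1) by (auto intro: submonoid_generated_inc submonoid_generated_mult)
      hence *: "{w1, w2, w3, w4} \<subseteq> submonoid_generated A" using u(2) by blast
      show ?thesis
      proof (rule H_eq_generated[where w = "(!) [0, w1, w2, w3, w4]"])
        fix i :: nat assume "i < 5"
        hence "int ([0, w1, w2, w3, w4] ! i) - int 5 \<notin> Z \<and>
          [0, w1, w2, w3, w4] ! i mod 5 = i \<and> [0, w1, w2, w3, w4] ! i \<in> submonoid_generated A"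
          unfolding less_5_iff using w(1) res * Z_nonneg[of "-5"] submonoid_generated_zero[of A] 
          by (elim disjE) (simp_all, (blast+)?)
        thus "int ([0, w1, w2, w3, w4] ! i) - int 5 \<notin> Z"
          "[0, w1, w2, w3, w4] ! i mod 5 = i" "[0, w1, w2, w3, w4] ! i \<in> submonoid_generated A" by blast+
      qed (use w(2) e(1) e5 A in \<open>simp_all, blast\<close>)
    qed
    have mod5: "z mod 5 = 0 \<or> z mod 5 = 1 \<or> z mod 5 = 2 \<or> z mod 5 = 3 \<or> z mod 5 = 4" for z :: int
      by presburger
    have res: "(5 * m + c) mod 5 = c mod 5" "(10 * m + c) mod 5 = c mod 5" for m c :: nat
      using mod_mult_self4[of 5 "2 * m" c] by simp_all
    have res': "Suc (5 * m) mod 5 = 1" "Suc (Suc (5 * m)) mod 5 = 2" "Suc (10 * m) mod 5 = 1"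
      "Suc (Suc (10 * m)) mod 5 = 2" for m :: nat
      using res[of m 1] res[of m 2] by simp_all
    from b(1) show ?thesis
    proof
      assume b: "b = 2"
      \<comment> \<open>Each value of \<open>b\<close> leaves two classes for \<open>F\<close>, and
        each class leaves a single free \<open>r\<close>. The four combinations are the four
        families of multiplicity 5.\<close>
      have "F mod 5 = 3 \<or> F mod 5 = 4" using mods unfolding b by presburger
      thus ?thesis
      proof
        assume r: "F mod 5 = 3"
        have r': "(F - 1) mod 5 = 2" "(F - b) mod 5 = 1" using r b by presburger+
        have "\<exists>m\<ge>1. 5 * m + 4 \<in> H \<and> int (5 * m + 4) - 5 \<notin> Z \<and>
          (10 * int m + 2 * int 4 - 5 = F \<or> 10 * int m + 2 * int 4 - 5 = F - 1 \<or> 10 * int m + 2 * int 4 - 5 = F - b)"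
        proof (rule fourth, unfold r r')
          show "z mod 5 = 0 \<or> z mod 5 = int 4 \<or> z mod 5 = 3 \<or> z mod 5 = 2 \<or> z mod 5 = 1" for z
            using mod5[of z] by auto
        qed simp_all
        then obtain m where m: "m \<ge> 1" "5*m+4 \<in> H" "int (5*m+4) - 5 \<notin> Z"
          and mF: "10 * int m + 2 * int 4 - 5 = F \<or> 10 * int m + 2 * int 4 - 5 = F - 1 \<or> 10 * int m + 2 * int 4 - 5 = F - b"
          by blast
        obtain q where q: "F = 5 * q + 3" using r by (metis mult_div_mod_eq)
        \<comment> \<open>The double of the Apery element minus 5 lies in class 3 modulo 5, and of
          the three candidates only \<open>F\<close> does. The other cases are decided in the same
          way.\<close>
        have F: "F = 10 * int m + 3" using mF q unfolding b by presburger
        have "H = submonoid_generated {5, 5*m+4, 10*m+6, 10*m+7}"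
          by (rule gen[of "10*m+6" "10*m+7" "10*m+8" "5*m+4" _ "5*m+4"])
            (use m(2,3) in \<open>auto simp: res res' F b\<close>)
        thus ?thesis unfolding in_type3_family_def using m(1) by blast
      next
        assume r: "F mod 5 = 4"
        have r': "(F - 1) mod 5 = 3" "(F - b) mod 5 = 2" using r b by presburger+
        have "\<exists>m\<ge>1. 5 * m + 1 \<in> H \<and> int (5 * m + 1) - 5 \<notin> Z \<and>
          (10 * int m + 2 * int 1 - 5 = F \<or> 10 * int m + 2 * int 1 - 5 = F - 1 \<or> 10 * int m + 2 * int 1 - 5 = F - b)"
        proof (rule fourth, unfold r r')
          show "z mod 5 = 0 \<or> z mod 5 = int 1 \<or> z mod 5 = 4 \<or> z mod 5 = 3 \<or> z mod 5 = 2" for z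
            using mod5[of z] by auto
        qed simp_all
        then obtain m where m: "m \<ge> 1" "5*m+1 \<in> H" "int (5*m+1) - 5 \<notin> Z"
          and mF: "10 * int m + 2 * int 1 - 5 = F \<or> 10 * int m + 2 * int 1 - 5 = F - 1 \<or> 10 * int m + 2 * int 1 - 5 = F - b"
          by blast
        obtain q where q: "F = 5 * q + 4" using r by (metis mult_div_mod_eq)
        have F: "F = 10 * int m + (-1)" using mF q unfolding b by presburger
        have "H = submonoid_generated {5, 5*m+1, 10*m+3, 10*m+4}"
          by (rule gen[of "5*m+1" "10*m+2" "10*m+3" "10*m+4" _ "5*m+1"])
            (use m(2,3) in \<open>auto simp: res res' F b\<close>)
        thus ?thesis unfolding in_type3_family_def using m(1) by blast
      qed
    next
      assume b: "b = 3"
      have "F mod 5 = 2 \<or> F mod 5 = 4" using mods unfolding b by presburger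
      thus ?thesis
      proof
        assume r: "F mod 5 = 2"
        have r': "(F - 1) mod 5 = 1" "(F - b) mod 5 = 4" using r b by presburger+
        have "\<exists>m\<ge>1. 5 * m + 3 \<in> H \<and> int (5 * m + 3) - 5 \<notin> Z \<and>
          (10 * int m + 2 * int 3 - 5 = F \<or> 10 * int m + 2 * int 3 - 5 = F - 1 \<or> 10 * int m + 2 * int 3 - 5 = F - b)"
        proof (rule fourth, unfold r r')
          show "z mod 5 = 0 \<or> z mod 5 = int 3 \<or> z mod 5 = 2 \<or> z mod 5 = 1 \<or> z mod 5 = 4" for z
            using mod5[of z] by auto
        qed simp_all
        then obtain m where m: "m \<ge> 1" "5*m+3 \<in> H" "int (5*m+3) - 5 \<notin> Z"
          and mF: "10 * int m + 2 * int 3 - 5 = F \<or> 10 * int m + 2 * int 3 - 5 = F - 1 \<or> 10 * int m + 2 * int 3 - 5 = F - b"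
          by blast
        obtain q where q: "F = 5 * q + 2" using r by (metis mult_div_mod_eq)
        have F: "F = 10 * int m + 2" using mF q unfolding b by presburger
        have "H = submonoid_generated {5, 5*m+3, 10*m+4, 10*m+7}"
          by (rule gen[of "10*m+6" "10*m+7" "5*m+3" "10*m+4" _ "5*m+3"])
            (use m(2,3) in \<open>auto simp: res res' F b\<close>)
        thus ?thesis unfolding in_type3_family_def using m(1) by blast
      next
        assume r: "F mod 5 = 4"
        have r': "(F - 1) mod 5 = 3" "(F - b) mod 5 = 1" using r b by presburger+
        have "\<exists>m\<ge>1. 5 * m + 2 \<in> H \<and> int (5 * m + 2) - 5 \<notin> Z \<and>
          (10 * int m + 2 * int 2 - 5 = F \<or> 10 * int m + 2 * int 2 - 5 = F - 1 \<or> 10 * int m + 2 * int 2 - 5 = F - b)"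
        proof (rule fourth, unfold r r')
          show "z mod 5 = 0 \<or> z mod 5 = int 2 \<or> z mod 5 = 4 \<or> z mod 5 = 3 \<or> z mod 5 = 1" for z
            using mod5[of z] by auto
        qed simp_all
        then obtain m where m: "m \<ge> 1" "5*m+2 \<in> H" "int (5*m+2) - 5 \<notin> Z"
          and mF: "10 * int m + 2 * int 2 - 5 = F \<or> 10 * int m + 2 * int 2 - 5 = F - 1 \<or> 10 * int m + 2 * int 2 - 5 = F - b"
          by blast
        obtain q where q: "F = 5 * q + 4" using r by (metis mult_div_mod_eq)
        have F: "F = 10 * int m + (-1)" using mF q unfolding b by presburger
        have "H = submonoid_generated {5, 5*m+2, 10*m+1, 10*m+3}"
          by (rule gen[of "10*m+1" "5*m+2" "10*m+3" "10*m+4" _ "5*m+2"])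
            (use m(2,3) in \<open>auto simp: res res' F b\<close>)
        thus ?thesis unfolding in_type3_family_def using m(1) by blast
      qed
    qed
  qed
qed

end

unbundle fps_syntax

section \<open>Laurent series with prescribed support\<close>

definition tpow :: "int \<Rightarrow> 'k::field fls" where "tpow i = fls_X_intpow i"

lemma tpow_nth: "tpow i $$ n = (if n = i then 1 else 0)"
  by (simp add: tpow_def)

lemma tpow_times_nth [simp]: "(tpow i * f) $$ n = f $$ (n - i)" "(f * tpow i) $$ n = f $$ (n - i)"
  by (simp_all add: tpow_def fls_shifted_times_simps)

lemma tpow_0 [simp]: "tpow 0 = 1"
  by (simp add: tpow_def)

lemma tpow_nonzero [simp]: "tpow i \<noteq> 0"
  by (simp add: tpow_def)

lemma tpow_mult: "tpow i * tpow j = tpow (i + j)"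
  by (rule fls_eqI) (auto simp: tpow_nth)

text \<open>With \<open>Z\<close> for \<open>A\<close> this is the semigroup ring, with
  \<open>K\<close> the canonical ideal, and with \<open>{F<..}\<close> the conductor.\<close>

definition supported :: "int set \<Rightarrow> 'k::field fls set" where
  "supported A = {f. \<forall>n. f $$ n \<noteq> 0 \<longrightarrow> n \<in> A}"

lemma supportedI: "(\<And>n. f $$ n \<noteq> 0 \<Longrightarrow> n \<in> A) \<Longrightarrow> f \<in> supported A"
  by (simp add: supported_def)

lemma supportedD: "f \<in> supported A \<Longrightarrow> f $$ n \<noteq> 0 \<Longrightarrow> n \<in> A"
  by (simp add: supported_def)

lemma supported_nth_eq_0: "f \<in> supported A \<Longrightarrow> n \<notin> A \<Longrightarrow> f $$ n = 0"
  by (auto simp: supported_def)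

lemma supported_mono: "A \<subseteq> B \<Longrightarrow> f \<in> supported A \<Longrightarrow> f \<in> supported B"
  by (auto simp: supported_def)

lemma supported_0 [simp]: "0 \<in> supported A"
  by (simp add: supported_def)

lemma supported_add: "f \<in> supported A \<Longrightarrow> g \<in> supported A \<Longrightarrow> f + g \<in> supported A"
  by (auto simp: supported_def) (metis add.left_neutral)

lemma supported_uminus_iff [simp]: "- f \<in> supported A \<longleftrightarrow> f \<in> supported A"
  by (auto simp: supported_def)

lemma supported_diff: "f \<in> supported A \<Longrightarrow> g \<in> supported A \<Longrightarrow> f - g \<in> supported A"
  using supported_add[of f A "- g"] by simp

lemma supported_sum: "(\<And>i. i \<in> I \<Longrightarrow> f i \<in> supported A) \<Longrightarrow> sum f I \<in> supported A"
  by (induction I rule: infinite_finite_induct) (auto intro: supported_add)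

lemma fls_times_nth_nonzeroE:
  fixes f g :: "'k::field fls"
  assumes "(f * g) $$ n \<noteq> 0"
  obtains i j where "f $$ i \<noteq> 0" "g $$ j \<noteq> 0" "n = i + j"
proof -
  from assms obtain i where "f $$ i * g $$ (n - i) \<noteq> 0"
    unfolding fls_times_nth(2) by (meson sum.not_neutral_contains_not_neutral)
  thus thesis using that[of i "n - i"] by auto
qed

lemma supported_mult:
  assumes "f \<in> supported A" "g \<in> supported B" "\<And>a b. a \<in> A \<Longrightarrow> b \<in> B \<Longrightarrow> a + b \<in> C"
  shows "f * g \<in> supported C"
  using assms by (auto intro!: supportedI elim!: fls_times_nth_nonzeroE dest: supportedD)

lemma supported_const_mult: "f \<in> supported A \<Longrightarrow> fls_const c * f \<in> supported A"
  by (auto simp: supported_def)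

lemma supported_const [simp]: "0 \<in> A \<Longrightarrow> fls_const c \<in> supported A"
  by (auto simp: supported_def split: if_splits)

lemma supported_1 [simp]: "0 \<in> A \<Longrightarrow> 1 \<in> supported A"
  by (auto simp: supported_def split: if_splits)

lemma tpow_supported_iff [simp]: "tpow i \<in> supported A \<longleftrightarrow> i \<in> A"
  by (auto simp: supported_def tpow_nth)

lemma tpow_times_supported_iff: "tpow i * f \<in> supported A \<longleftrightarrow> (\<forall>n. f $$ n \<noteq> 0 \<longrightarrow> n + i \<in> A)"
  unfolding supported_def
proof (safe, goal_cases)
  case (1 n)
  from 1(1)[rule_format, of "n + i"] 1(2) show ?case by simp
next
  case (2 n)
  from 2(1)[rule_format, of "n - i"] 2(2) show ?case by simp
qed

lemma semigroup_ring_carrier_eq: "semigroup_ring_carrier H = (supported (int ` H) :: 'k::field fls set)"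
proof (intro equalityI subsetI)
  fix f :: "'k fls" assume "f \<in> supported (int ` H)"
  hence f: "f $$ n \<noteq> 0 \<Longrightarrow> n \<in> int ` H" for n by (rule supportedD)
  have "f = fps_to_fls (Abs_fps (\<lambda>n. f $$ int n))"
    using f by (intro fls_eqI) force
  moreover have "\<forall>n. fps_nth (Abs_fps (\<lambda>n. f $$ int n)) n \<noteq> 0 \<longrightarrow> n \<in> H"
    using f by force
  ultimately show "f \<in> semigroup_ring_carrier H"
    unfolding semigroup_ring_carrier_def by blast
qed (auto simp: semigroup_ring_carrier_def supported_def split: if_splits intro!: rev_image_eqI[of "nat _"])

text \<open>The coefficients of \<open>g = inverse f\<close> satisfy a recursion that expresses
  \<open>f $$ 0 * g $$ n\<close> through products \<open>f $$ i * g $$ (n - i)\<close> with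
  \<open>i > 0\<close>. By induction a nonzero product makes \<open>n\<close> a sum of two elements
  of \<open>A\<close>.\<close>

lemma fls_inverse_supported:
  fixes f :: "'k::field fls"
  assumes f: "f \<in> supported A" and f0: "f $$ 0 \<noteq> 0" and A: "A \<subseteq> {0..}" "\<And>a b. a \<in> A \<Longrightarrow> b \<in> A \<Longrightarrow> a + b \<in> A"
  shows "inverse f \<in> supported A"
proof -
  have "0 \<in> A" using f f0 by (rule supportedD)
  have sd: "fls_subdegree f = 0"
    using f f0 A(1) by (intro fls_subdegree_eqI) (auto dest: supported_nth_eq_0)
  define g where "g = inverse f"
  have "f \<noteq> 0" using f0 by auto
  hence fg: "f * g = 1" by (simp add: g_def)
  have sg: "fls_subdegree g = 0" by (simp add: g_def sd)
  have "g $$ int n \<noteq> 0 \<Longrightarrow> int n \<in> A" for n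
  proof (induction n rule: less_induct)
    case (less n)
    show ?case
    proof (rule ccontr)
      assume nA: "int n \<notin> A"
      hence "n \<noteq> 0" using \<open>0 \<in> A\<close> by (cases n) auto
      have "(\<Sum>i=0..int n. f $$ i * g $$ (int n - i)) = 0"
        using arg_cong[OF fg, of "\<lambda>h. h $$ int n"] \<open>n \<noteq> 0\<close>
        unfolding fls_times_nth(2) sd sg by simp
      moreover have "(\<Sum>i=0..int n. f $$ i * g $$ (int n - i)) = (\<Sum>i\<in>{0}. f $$ i * g $$ (int n - i))"
      proof (rule sum.mono_neutral_right)
        show "\<forall>i\<in>{0..int n} - {0}. f $$ i * g $$ (int n - i) = 0"
        proof (rule ballI, rule ccontr)
          fix i assume i: "i \<in> {0..int n} - {0}" and "f $$ i * g $$ (int n - i) \<noteq> 0"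
          hence "f $$ i \<noteq> 0" "g $$ int (nat (int n - i)) \<noteq> 0" by auto
          hence "i \<in> A" "int (nat (int n - i)) \<in> A"
            using supportedD[OF f] less.IH[of "nat (int n - i)"] i by auto
          hence "i + int (nat (int n - i)) \<in> A" by (rule A)
          thus False using nA i by simp
        qed
      qed auto
      ultimately show False using f0 less.prems by simp
    qed
  qed
  moreover have "g $$ n = 0" if "n < 0" for n
    using that sg by simp
  ultimately show ?thesis
    unfolding g_def[symmetric] by (intro supportedI) (metis int_nat_eq not_less nat_0_le)
qed

section \<open>Subrings and fractional ideals of K((t)) as algebraic structures\<close>

abbreviation laurent_subring :: "'k::field fls set \<Rightarrow> 'k fls ring" where
  "laurent_subring S \<equiv> laurent_field\<lparr>carrier := S\<rparr>"

text \<open>Multiplication and unit are filled in as in \<open>self_module\<close>, so that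
  \<open>self_module\<close> of a subring is literally an \<open>lmod\<close>.\<close>

definition lmod :: "'k::field fls set \<Rightarrow> ('k fls, 'k fls) module" where
  "lmod M = \<lparr>carrier = M, monoid.mult = (*), one = 1, zero = 0, add = (+), module.smult = (*)\<rparr>"

lemma lmod_simps [simp]:
  "carrier (lmod M) = M" "zero (lmod M) = 0" "add (lmod M) = (+)" "module.smult (lmod M) = (*)"
  "monoid.mult (lmod M) = (*)" "one (lmod M) = 1"
  by (simp_all add: lmod_def)

lemma laurent_subring_simps [simp]:
  "carrier (laurent_subring S) = S" "zero (laurent_subring S) = 0" "add (laurent_subring S) = (+)"
  "monoid.mult (laurent_subring S) = (*)" "one (laurent_subring S) = 1"
  by (simp_all add: ring_of_type_algebra_def)

lemma laurent_field_simps [simp]: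
  "carrier laurent_field = UNIV" "zero laurent_field = 0" "add laurent_field = (+)"
  "monoid.mult laurent_field = (*)" "one laurent_field = 1"
  by (simp_all add: ring_of_type_algebra_def)

lemma self_module_laurent: "self_module (laurent_subring S) = lmod S"
  by (simp add: self_module_def lmod_def)

lemma finsum_eq_sum:
  assumes "abelian_monoid G" "finite A" "f \<in> A \<rightarrow> carrier G"
    and "add G = (+)" "zero G = (0 :: 'a::comm_monoid_add)"
  shows "finsum G f A = sum f A"
  using assms(2,3)
proof (induction A rule: finite_induct)
  case empty
  thus ?case using abelian_monoid.finsum_empty[OF assms(1)] assms by simp
next
  case (insert x A)
  have "finsum G f (insert x A) = f x \<oplus>\<^bsub>G\<^esub> finsum G f A"
    using insert by (intro abelian_monoid.finsum_insert[OF assms(1)]) auto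
  thus ?case using insert assms by simp
qed

lemma abelian_group_lmod: "abelian_group (lmod (supported A :: 'k::field fls set))"
proof (rule abelian_groupI)
  fix x :: "'k fls" assume "x \<in> carrier (lmod (supported A))"
  thus "\<exists>y\<in>carrier (lmod (supported A)). y \<oplus>\<^bsub>lmod (supported A)\<^esub> x = \<zero>\<^bsub>lmod (supported A)\<^esub>"
    by (intro bexI[of _ "- x"]) auto
qed (auto intro: supported_add)

lemma finsum_lmod:
  assumes "finite I" "\<And>i. i \<in> I \<Longrightarrow> f i \<in> supported A"
  shows "finsum (lmod (supported A :: 'k::field fls set)) f I = sum f I"
  using assms
  by (intro finsum_eq_sum abelian_group.axioms(1) abelian_group_lmod) auto

section \<open>Units, fractions, integral closure and conductor of the semigroup ring\<close>

context numerical_semigroup_loc begin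

lemma supported_Z_mult: "f \<in> supported Z \<Longrightarrow> g \<in> supported Z \<Longrightarrow> f * g \<in> supported Z"
  by (intro supported_mult[of f Z g Z Z] Z_add)

lemma supported_Z_K_mult: "f \<in> supported Z \<Longrightarrow> g \<in> supported K \<Longrightarrow> f * g \<in> supported K"
  by (rule supported_mult[of f Z g K K]) (simp_all, subst add.commute, rule K_add)

lemma cring_Z: "cring (laurent_subring (supported Z :: 'k::field fls set))"
proof (rule cringI)
  show "abelian_group (laurent_subring (supported Z :: 'k fls set))"
  proof (rule abelian_groupI)
    fix x :: "'k fls" assume "x \<in> carrier (laurent_subring (supported Z))"
    thus "\<exists>y\<in>carrier (laurent_subring (supported Z)). y \<oplus>\<^bsub>laurent_subring (supported Z)\<^esub> x = \<zero>\<^bsub>laurent_subring (supported Z)\<^esub>"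
      by (intro bexI[of _ "- x"]) auto
  qed (auto intro: supported_add)
  show "comm_monoid (laurent_subring (supported Z :: 'k fls set))"
    by (rule comm_monoidI) (auto intro: supported_Z_mult)
qed (auto simp: algebra_simps)

lemma finsum_Z:
  assumes "finite I" "\<And>i. i \<in> I \<Longrightarrow> f i \<in> supported Z"
  shows "finsum (laurent_subring (supported Z :: 'k::field fls set)) f I = sum f I"
proof -
  interpret cring "laurent_subring (supported Z :: 'k::field fls set)" by (rule cring_Z)
  show ?thesis using assms by (intro finsum_eq_sum) (auto intro: abelian_monoid_axioms)
qed

lemma nonunits_Z:
  "nonunits (laurent_subring (supported Z)) = {f :: 'k::field fls. f \<in> supported Z \<and> f $$ 0 = 0}"
proof -
  have "f \<in> Units (laurent_subring (supported Z)) \<longleftrightarrow> f $$ 0 \<noteq> 0" if f: "f \<in> supported Z" for f :: "'k fls"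
  proof
    assume "f \<in> Units (laurent_subring (supported Z))"
    then obtain g where g: "g \<in> supported Z" "f * g = 1" by (auto simp: Units_def mult.commute)
    hence "(f * g) $$ 0 \<noteq> 0" by simp
    then obtain i j where "f $$ i \<noteq> 0" "g $$ j \<noteq> 0" "0 = i + j" by (rule fls_times_nth_nonzeroE)
    moreover from this have "i = 0" using supportedD f g Z_nonneg by (smt (verit))
    ultimately show "f $$ 0 \<noteq> 0" by simp
  next
    assume f0: "f $$ 0 \<noteq> 0"
    hence "inverse f \<in> supported Z" using f
      by (intro fls_inverse_supported) (auto intro: Z_add Z_nonneg)
    moreover have "f \<noteq> 0" using f0 by auto
    ultimately show "f \<in> Units (laurent_subring (supported Z))"
      using f by (auto simp: Units_def intro!: bexI[of _ "inverse f"])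
  qed
  thus ?thesis by (auto simp: nonunits_def)
qed

lemma tpow_times_in_Z: "F < N + fls_subdegree x \<Longrightarrow> tpow N * x \<in> supported Z"
  by (auto simp: tpow_times_supported_iff intro!: Z_above_F dest: fls_subdegree_leI)

text \<open>A high power of \<open>t\<close> is a common denominator for finitely many Laurent
  series.\<close>

lemma ex_tpow_times_in_Z:
  assumes "finite I"
  obtains N where "N > F" "\<And>i M. i \<in> I \<Longrightarrow> M \<ge> N \<Longrightarrow> tpow M * x i \<in> supported Z"
proof -
  define N where "N = F + 1 + (\<Sum>i\<in>I. \<bar>fls_subdegree (x i)\<bar>)"
  have "(\<Sum>i\<in>I. \<bar>fls_subdegree (x i)\<bar>) \<ge> 0" by (rule sum_nonneg) simp
  hence "N > F" unfolding N_def by linarith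
  moreover have "tpow M * x i \<in> supported Z" if "i \<in> I" "M \<ge> N" for i M
  proof (rule tpow_times_in_Z)
    have "\<bar>fls_subdegree (x i)\<bar> \<le> (\<Sum>i\<in>I. \<bar>fls_subdegree (x i)\<bar>)"
      using that assms by (intro member_le_sum) auto
    thus "F < M + fls_subdegree (x i)" using that by (simp add: N_def)
  qed
  ultimately show thesis by (rule that)
qed

lemma fractions_Z: "fractions laurent_field (supported Z :: 'k::field fls set) = UNIV"
proof -
  have inv: "inv\<^bsub>laurent_field\<^esub> b = inverse b" if "b \<noteq> 0" for b :: "'k fls"
    unfolding m_inv_def
    by (rule the_equality) (use that in \<open>auto simp: field_simps\<close>)
  have "x \<in> fractions laurent_field (supported Z)" for x :: "'k fls"
  proof -
    obtain N where N: "N > F" "tpow N * x \<in> supported Z"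
      using ex_tpow_times_in_Z[of "{()}" "\<lambda>_. x"] by auto
    have "x = (tpow N * x) * inverse (tpow N)" by simp
    thus ?thesis unfolding fractions_def using N inv[of "tpow N"] Z_above_F[of N]
      by (intro CollectI exI[of _ "tpow N * x"] exI[of _ "tpow N"]) auto
  qed
  thus ?thesis by blast
qed

lemma laurent_pow: "x [^]\<^bsub>laurent_field\<^esub> (n::nat) = (x :: 'k::field fls) ^ n"
  by (induction n) (simp_all add: nat_pow_def mult.commute)

lemma finsum_laurent: "finite I \<Longrightarrow> finsum laurent_field f I = (sum f I :: 'k::field fls)"
proof -
  interpret cring "laurent_field :: 'k fls ring" by (rule cring_from_type_algebra)
  show "finite I \<Longrightarrow> finsum laurent_field f I = (sum f I :: 'k::field fls)"
    by (intro finsum_eq_sum) (auto intro: abelian_monoid_axioms)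
qed

lemma integral_closure_Z: "integral_closure laurent_field (supported Z :: 'k::field fls set) = supported {0..}"
proof (intro equalityI subsetI)
  fix x :: "'k fls" assume "x \<in> integral_closure laurent_field (supported Z)"
  then obtain n :: nat and c where c: "c \<in> {..<n} \<rightarrow> supported Z" and eq: "x ^ n + (\<Sum>i<n. c i * x ^ i) = 0"
    by (auto simp: integral_closure_def laurent_pow finsum_laurent)
  show "x \<in> supported {0..}"
  proof (cases "fls_subdegree x \<ge> 0 \<or> x = 0")
    case True
    thus ?thesis by (auto intro!: supportedI dest: fls_subdegree_leI)
  next
    case False
    define d where "d = fls_subdegree x"
    have d: "d < 0" "x \<noteq> 0" using False by (auto simp: d_def)
    \<comment> \<open>With \<open>d < 0\<close> the term \<open>x ^ n\<close> starts in degree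
      \<open>n * d\<close>, strictly below all other terms of the equation, so its leading
      coefficient cannot cancel.\<close>
    have "(c i * x ^ i) $$ (int n * d) = 0" if "i < n" for i
    proof (rule ccontr)
      assume "(c i * x ^ i) $$ (int n * d) \<noteq> 0"
      then obtain j k where jk: "c i $$ j \<noteq> 0" "(x ^ i) $$ k \<noteq> 0" "int n * d = j + k"
        by (rule fls_times_nth_nonzeroE)
      have "j \<ge> 0" using jk(1) c that Z_nonneg by (blast dest: supportedD)
      moreover have "k \<ge> int i * d" using jk(2) fls_pow_nth_below_subdegree[of k i x] unfolding d_def by force
      moreover have "int n * d < int i * d" using that d by simp
      ultimately show False using jk(3) by linarith
    qed
    hence "(x ^ n + (\<Sum>i<n. c i * x ^ i)) $$ (int n * d) = (x $$ d) ^ n"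
      by (simp add: fls_nth_sum d_def)
    thus ?thesis using eq d by (simp add: d_def)
  qed
next
  fix x :: "'k fls" assume x: "x \<in> supported {0..}"
  define a where "a = fls_const (x $$ 0)"
  define y where "y = x - a"
  \<comment> \<open>\<open>y\<close> has positive order, so \<open>y ^ N\<close> has order at least
    the conductor and lies in the ring. Thus \<open>x\<close> is a root of the monic polynomial
    \<open>(X - a) ^ N - y ^ N\<close> over the ring; the extra 1 keeps the degree positive when the
    conductor is 0.\<close>
  define N where "N = conductor + 1"
  have "y \<in> supported {1..}"
  proof (rule supportedI)
    fix n assume "y $$ n \<noteq> 0"
    moreover have "n = 0 \<Longrightarrow> y $$ n = 0" by (simp add: y_def a_def)
    moreover have "n < 0 \<Longrightarrow> y $$ n = 0" using supported_nth_eq_0[OF x, of n] by (simp add: y_def a_def)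
    ultimately have "n \<noteq> 0" "\<not> n < 0" by blast+
    thus "n \<in> {1..}" by simp
  qed
  hence "y ^ n \<in> supported {int n..}" for n
  proof (induction n)
    case (Suc n)
    have "y * y ^ n \<in> supported {int (Suc n)..}"
      by (rule supported_mult[OF Suc.prems Suc.IH[OF Suc.prems]]) auto
    thus ?case by simp
  qed simp
  hence "y ^ N \<in> supported {int N..}" .
  hence yN: "y ^ N \<in> supported Z"
    by (rule supported_mono[rotated]) (auto simp: N_def F_def intro!: Z_above_F)
  have const: "of_nat k * (-a) ^ l \<in> supported Z" for k l
    by (simp add: a_def fls_of_nat flip: fls_const_power fls_const_uminus)
  define c where "c = (\<lambda>i. of_nat (N choose i) * (-a) ^ (N - i) - (if i = 0 then y ^ N else 0))"
  have c: "c \<in> {..<N} \<rightarrow> supported Z"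
    using const yN by (auto simp: c_def intro!: supported_diff)
  have "(x + (- a)) ^ N = (\<Sum>i\<le>N. of_nat (N choose i) * x ^ i * (-a) ^ (N - i))"
    by (rule binomial_ring)
  also have "\<dots> = x ^ N + (\<Sum>i<N. of_nat (N choose i) * x ^ i * (-a) ^ (N - i))"
    by (simp add: lessThan_Suc_atMost[symmetric] add.commute)
  also have "(\<Sum>i<N. of_nat (N choose i) * x ^ i * (-a) ^ (N - i)) = (\<Sum>i<N. c i * x ^ i) + y ^ N"
  proof -
    have "(\<Sum>i<N. c i * x ^ i) = (\<Sum>i<N. of_nat (N choose i) * x ^ i * (-a) ^ (N - i)) - (\<Sum>i<N. if i = 0 then y ^ N else 0)"
      unfolding sum_subtractf[symmetric] by (rule sum.cong) (auto simp: c_def algebra_simps)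
    thus ?thesis by (simp add: N_def)
  qed
  finally have "x ^ N + (\<Sum>i<N. c i * x ^ i) = 0" by (simp add: y_def)
  thus "x \<in> integral_closure laurent_field (supported Z)"
    using c by (auto simp: integral_closure_def fractions_Z laurent_pow finsum_laurent intro!: exI[of _ N] bexI[of _ c])
qed

lemma colon_Z:
  "colon laurent_field (supported Z) (integral_closure laurent_field (supported Z)) = (supported {F<..} :: 'k::field fls set)"
proof (intro equalityI subsetI)
  fix q :: "'k fls" assume "q \<in> colon laurent_field (supported Z) (integral_closure laurent_field (supported Z))"
  hence q: "q * a \<in> supported Z" if "a \<in> supported {0..}" for a
    using that by (auto simp: colon_def integral_closure_Z)
  show "q \<in> supported {F<..}"
  proof (rule supportedI, rule ccontr)
    fix n assume "q $$ n \<noteq> 0" "n \<notin> {F<..}"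
    \<comment> \<open>A power of \<open>t\<close> moves an exponent \<open>n \<le> F\<close> of
      \<open>q\<close> onto the gap \<open>F\<close>.\<close>
    hence "(q * tpow (F - n)) $$ F \<noteq> 0" "q * tpow (F - n) \<in> supported Z"
      by (auto intro!: q)
    thus False using F_notin by (blast dest: supportedD)
  qed
next
  fix q :: "'k fls" assume q: "q \<in> supported {F<..}"
  have "q * a \<in> supported Z" if "a \<in> supported {0..}" for a
    by (rule supported_mult[OF q that]) (auto intro: Z_above_F)
  thus "q \<in> colon laurent_field (supported Z) (integral_closure laurent_field (supported Z))"
    by (auto simp: colon_def integral_closure_Z fractions_Z)
qed

end

section \<open>Ext of the residue field in degree one\<close>

lemma tuple_comb_lmod:
  assumes "\<And>k i. k < d \<Longrightarrow> i < m \<Longrightarrow> r k * z k i \<in> supported A"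
  shows "tuple_comb (lmod (supported A)) m d r z = (\<lambda>i\<in>{..<m}. \<Sum>k<d. r k * z k i)"
  unfolding tuple_comb_def using assms by (intro restrict_ext) (auto intro!: finsum_lmod)

lemma coboundary_map_lmod:
  assumes "\<And>i j. i < n (Suc p) \<Longrightarrow> j < n p \<Longrightarrow> D p i j * v j \<in> supported A"
  shows "coboundary_map (lmod (supported A)) n D p v = (\<lambda>i\<in>{..<n (Suc p)}. \<Sum>j<n p. D p i j * v j)"
  unfolding coboundary_map_def using assms by (intro restrict_ext) (auto intro!: finsum_lmod)

locale residue_resolution_loc = numerical_semigroup_loc +
  fixes n :: "nat \<Rightarrow> nat" and D :: "nat \<Rightarrow> nat \<Rightarrow> nat \<Rightarrow> 'k::field fls"
  assumes resolution: "residue_resolution (laurent_subring (supported Z)) n D"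
begin

text \<open>As \<open>n 0 = 1\<close>, the first differential is one column; its entries generate
  the maximal ideal.\<close>

definition gen :: "nat \<Rightarrow> 'k fls" where "gen i = D 0 i 0"

lemma n_0: "n 0 = 1"
  using resolution by (simp add: residue_resolution_def Let_def)

lemma D_in: "i < n (Suc p) \<Longrightarrow> j < n p \<Longrightarrow> D p i j \<in> supported Z"
  using resolution by (simp add: residue_resolution_def Let_def)

lemma differential_eq:
  assumes "\<And>j. j < n (Suc p) \<Longrightarrow> y j \<in> supported Z"
  shows "tuple_comb (self_module (laurent_subring (supported Z))) (n p) (n (Suc p)) y (D p) =
    (\<lambda>i\<in>{..<n p}. \<Sum>k<n (Suc p). y k * D p k i)"
  unfolding self_module_laurent using assms D_in by (intro tuple_comb_lmod supported_Z_mult) auto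

lemma restrict_eq_iff: "(\<lambda>i\<in>A. f i) = (\<lambda>i\<in>A. g i) \<longleftrightarrow> (\<forall>i\<in>A. f i = g i)"
  by (auto simp: restrict_def fun_eq_iff)

lemma exact:
  assumes v: "\<And>j. j < n (Suc p) \<Longrightarrow> v j \<in> supported Z"
    and "\<And>i. i < n p \<Longrightarrow> (\<Sum>j<n (Suc p). v j * D p j i) = 0"
  obtains y where "\<And>k. k < n (Suc (Suc p)) \<Longrightarrow> y k \<in> supported Z"
    "\<And>j. j < n (Suc p) \<Longrightarrow> v j = (\<Sum>k<n (Suc (Suc p)). y k * D (Suc p) k j)"
proof -
  let ?d = "\<lambda>p x. tuple_comb (self_module (laurent_subring (supported Z))) (n p) (n (Suc p)) x (D p)"
  define v' where "v' = (\<lambda>j\<in>{..<n (Suc p)}. v j)"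
  have "?d p v' = zero_tuple (laurent_subring (supported Z)) (n p)"
    using assms by (subst differential_eq) (auto simp: v'_def zero_tuple_def intro!: restrict_ext)
  moreover have "v' \<in> tuples (laurent_subring (supported Z)) (n (Suc p))"
    using v by (auto simp: v'_def tuples_def)
  ultimately have "v' \<in> ?d (Suc p) ` tuples (laurent_subring (supported Z)) (n (Suc (Suc p)))"
    using resolution unfolding residue_resolution_def Let_def by blast
  then obtain y where y: "y \<in> tuples (laurent_subring (supported Z)) (n (Suc (Suc p)))" "v' = ?d (Suc p) y"
    by blast
  hence yZ: "y k \<in> supported Z" if "k < n (Suc (Suc p))" for k using that by (auto simp: tuples_def)
  have "v j = (\<Sum>k<n (Suc (Suc p)). y k * D (Suc p) k j)" if "j < n (Suc p)" for j
    using fun_cong[OF y(2), of j] that by (subst (asm) differential_eq) (auto simp: v'_def yZ)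
  thus thesis using that yZ by blast
qed

text \<open>Exactness applied to the image of the basis vector \<open>e\<close> with index
  \<open>i\<close>.\<close>

lemma complex:
  assumes "i < n (Suc (Suc p))" "l < n p"
  shows "(\<Sum>j<n (Suc p). D (Suc p) i j * D p j l) = 0"
proof -
  let ?R = "laurent_subring (supported Z) :: 'k fls ring"
  let ?d = "\<lambda>p x. tuple_comb (self_module ?R) (n p) (n (Suc p)) x (D p)"
  define e where "e = (\<lambda>k\<in>{..<n (Suc (Suc p))}. if k = i then 1 else 0 :: 'k fls)"
  have e: "e k \<in> supported Z" if "k < n (Suc (Suc p))" for k using that by (simp add: e_def)
  have "e \<in> tuples ?R (n (Suc (Suc p)))" using e by (auto simp: tuples_def e_def)
  hence "?d (Suc p) e \<in> {v \<in> tuples ?R (n (Suc p)). ?d p v = zero_tuple ?R (n p)}"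
    using resolution unfolding residue_resolution_def Let_def by blast
  hence *: "?d p (?d (Suc p) e) = zero_tuple ?R (n p)" by blast
  have de: "?d (Suc p) e = (\<lambda>j\<in>{..<n (Suc p)}. D (Suc p) i j)"
    using e assms(1) by (subst differential_eq)
      (auto simp: e_def if_distrib[of "\<lambda>x. x * _"] intro!: restrict_ext cong: if_cong)
  show ?thesis
    using fun_cong[OF *, of l] assms D_in unfolding de
    by (subst (asm) differential_eq) (auto simp: zero_tuple_def)
qed

lemma gen_image:
  "(\<lambda>y. \<lambda>i\<in>{..<Suc 0}. \<Sum>k<n (Suc 0). y k * gen k) ` ({..<n (Suc 0)} \<rightarrow>\<^sub>E supported Z) =
    {v \<in> {..<Suc 0} \<rightarrow>\<^sub>E supported Z. v 0 $$ 0 = 0}"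
proof -
  let ?R = "laurent_subring (supported Z) :: 'k fls ring"
  have "tuple_comb (self_module ?R) (n 0) (n (Suc 0)) y (D 0) = (\<lambda>i\<in>{..<Suc 0}. \<Sum>k<n (Suc 0). y k * gen k)"
    if "y \<in> tuples ?R (n (Suc 0))" for y
    using that by (subst differential_eq) (auto simp: tuples_def n_0 gen_def intro!: restrict_ext)
  moreover have "(\<lambda>y. tuple_comb (self_module ?R) (n 0) (n (Suc 0)) y (D 0)) ` tuples ?R (n (Suc 0)) = {v \<in> tuples ?R (Suc 0). v 0 \<in> nonunits ?R}"
    using resolution unfolding residue_resolution_def Let_def One_nat_def by blast
  ultimately have "(\<lambda>y. \<lambda>i\<in>{..<Suc 0}. \<Sum>k<n (Suc 0). y k * gen k) ` tuples ?R (n (Suc 0)) = {v \<in> tuples ?R (Suc 0). v 0 \<in> nonunits ?R}"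
    by simp
  moreover have "tuples ?R (n (Suc 0)) = {..<n (Suc 0)} \<rightarrow>\<^sub>E supported Z" by (simp add: tuples_def)
  moreover have "{v \<in> tuples ?R (Suc 0). v 0 \<in> nonunits ?R} = {v \<in> {..<Suc 0} \<rightarrow>\<^sub>E supported Z. v 0 $$ 0 = 0}"
    by (auto simp: tuples_def nonunits_Z)
  ultimately show ?thesis by simp
qed

lemma gen_in: 
  assumes "i < n 1" shows "gen i \<in> supported (Z - {0})"
proof -
  define e where "e = (\<lambda>k\<in>{..<n (Suc 0)}. if k = i then 1 else 0 :: 'k fls)"
  have "e \<in> {..<n (Suc 0)} \<rightarrow>\<^sub>E supported Z" by (auto simp: e_def)
  hence "(\<lambda>i\<in>{..<Suc 0}. \<Sum>k<n (Suc 0). e k * gen k) \<in> {v \<in> {..<Suc 0} \<rightarrow>\<^sub>E supported Z. v 0 $$ 0 = 0}"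
    unfolding gen_image[symmetric] by blast
  moreover have "(\<Sum>k<n (Suc 0). e k * gen k) = gen i"
    using assms by (simp add: e_def if_distrib[of "\<lambda>x. x * _"] cong: if_cong)
  ultimately have "gen i \<in> supported Z \<and> gen i $$ 0 = 0" by auto
  thus ?thesis by (auto simp: supported_def)
qed

lemma gen_Z: "i < n 1 \<Longrightarrow> gen i \<in> supported Z"
  using supported_mono[OF _ gen_in] by blast

lemma gen_obtain:
  assumes "x \<in> supported (Z - {0})"
  obtains y where "\<And>i. i < n 1 \<Longrightarrow> y i \<in> supported Z" "x = (\<Sum>i<n 1. y i * gen i)"
proof -
  have "x \<in> supported Z" by (rule supported_mono[OF _ assms]) blast
  moreover have "x $$ 0 = 0" using assms by (rule supported_nth_eq_0) blast
  ultimately have "(\<lambda>i\<in>{..<Suc 0}. x) \<in> {v \<in> {..<Suc 0} \<rightarrow>\<^sub>E supported Z. v 0 $$ 0 = 0}" by auto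
  then obtain y where y: "y \<in> {..<n (Suc 0)} \<rightarrow>\<^sub>E supported Z"
    "(\<lambda>i\<in>{..<Suc 0}. x) = (\<lambda>i\<in>{..<Suc 0}. \<Sum>k<n (Suc 0). y k * gen k)"
    unfolding gen_image[symmetric] by blast
  show thesis
    using that[of y] y(1) fun_cong[OF y(2), of 0] by auto
qed

lemma gen_nonzero_ex: obtains j where "j < n 1" "gen j \<noteq> 0"
proof -
  \<comment> \<open>\<open>F + 2\<close> and not \<open>F + 1\<close>: the exponent must be positive
    even if \<open>F\<close> is -1.\<close>
  have "tpow (F + 2) \<in> supported (Z - {0})" using F_ge by (auto intro!: Z_above_F)
  then obtain y where y: "tpow (F + 2) = (\<Sum>i<n 1. y i * gen i)" using gen_obtain by blast
  have "(\<Sum>i<n 1. y i * gen i) \<noteq> 0" unfolding y[symmetric] by simp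
  then obtain i where "i < n 1" "y i * gen i \<noteq> 0" by (meson lessThan_iff sum.not_neutral_contains_not_neutral)
  thus thesis using that by auto
qed

end

context numerical_semigroup_loc begin

definition Z_module :: "int set \<Rightarrow> bool" where
  "Z_module A \<longleftrightarrow> (\<forall>a\<in>A. \<forall>z\<in>Z. z + a \<in> A)"

lemma Z_module_Z: "Z_module Z" and Z_module_K: "Z_module K"
  by (auto simp: Z_module_def intro: Z_add K_add) (metis K_add add.commute)

lemma supported_Z_module_mult:
  "Z_module A \<Longrightarrow> f \<in> supported Z \<Longrightarrow> g \<in> supported A \<Longrightarrow> f * g \<in> supported A"
  by (rule supported_mult[of f Z g A A]) (simp_all add: Z_module_def)

definition colon_max :: "int set \<Rightarrow> 'k::field fls set" where
  "colon_max A = {q. \<forall>m\<in>supported (Z - {0}). m * q \<in> supported A}"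

text \<open>The exponents of the monomials that span the socle of K((t)) modulo
  \<open>supported A\<close>; for \<open>A = Z\<close> these are the pseudo-Frobenius numbers of
  \<open>H\<close>.\<close>

definition rel_pseudo_frobenius :: "int set \<Rightarrow> int set" where
  "rel_pseudo_frobenius A = {z. z \<notin> A \<and> (\<forall>h\<in>Z. h > 0 \<longrightarrow> z + h \<in> A)}"

text \<open>\<open>colon_max A\<close> is the fractional ideal \<open>M : \<mm>\<close> for \<open>M = supported A\<close>.\<close>

lemma colon_max_eq:
  assumes "Z_module A"
  shows "colon_max A = (supported (A \<union> rel_pseudo_frobenius A) :: 'k::field fls set)"
proof (intro equalityI subsetI)
  fix q :: "'k fls" assume q: "q \<in> colon_max A"
  show "q \<in> supported (A \<union> rel_pseudo_frobenius A)"
  proof (rule supportedI)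
    fix n assume "q $$ n \<noteq> 0"
    have "n + h \<in> A" if "h \<in> Z" "h > 0" for h
    proof -
      have "tpow h * q \<in> supported A" using q that by (simp add: colon_max_def)
      moreover have "(tpow h * q) $$ (n + h) \<noteq> 0" using \<open>q $$ n \<noteq> 0\<close> by simp
      ultimately show ?thesis by (rule supportedD)
    qed
    thus "n \<in> A \<union> rel_pseudo_frobenius A" by (auto simp: rel_pseudo_frobenius_def)
  qed
next
  fix q :: "'k fls" assume q: "q \<in> supported (A \<union> rel_pseudo_frobenius A)"
  have "m * q \<in> supported A" if m: "m \<in> supported (Z - {0})" for m
  proof (rule supported_mult[OF m q])
    fix a b assume ab: "a \<in> Z - {0}" "b \<in> A \<union> rel_pseudo_frobenius A"
    hence "a > 0" using Z_nonneg[of a] by auto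
    thus "a + b \<in> A" using ab assms by (auto simp: rel_pseudo_frobenius_def Z_module_def add.commute)
  qed
  thus "q \<in> colon_max A" by (simp add: colon_max_def)
qed

text \<open>The \<open>q k\<close> induce a basis of \<open>colon_max A\<close> modulo
  \<open>supported A\<close> over the residue field. Ring coefficients match
  \<open>residue_ext_dim\<close>; a vanishing constant term means a coefficient in the maximal
  ideal.\<close>

definition socle_basis :: "int set \<Rightarrow> nat \<Rightarrow> (nat \<Rightarrow> 'k::field fls) \<Rightarrow> bool" where
  "socle_basis A d q \<longleftrightarrow> (\<forall>k<d. q k \<in> colon_max A) \<and>
     (\<forall>y\<in>colon_max A. \<exists>r. (\<forall>k<d. r k \<in> supported Z) \<and> y - (\<Sum>k<d. r k * q k) \<in> supported A) \<and>
     (\<forall>r. (\<forall>k<d. r k \<in> supported Z) \<longrightarrow> (\<Sum>k<d. r k * q k) \<in> supported A \<longrightarrow> (\<forall>k<d. r k $$ 0 = 0))"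

end

context residue_resolution_loc begin

lemma cocycles_lmod:
  assumes "Z_module A"
  shows "v \<in> cocycles (lmod (supported A)) n D p \<longleftrightarrow> v \<in> {..<n p} \<rightarrow>\<^sub>E supported A \<and>
    (\<forall>i<n (Suc p). (\<Sum>j<n p. D p i j * v j) = 0)"
proof -
  have "coboundary_map (lmod (supported A)) n D p v = zero_tuple (lmod (supported A)) (n (Suc p)) \<longleftrightarrow>
    (\<forall>i<n (Suc p). (\<Sum>j<n p. D p i j * v j) = 0)" if "v \<in> {..<n p} \<rightarrow>\<^sub>E supported A"
    using that assms D_in
    by (subst coboundary_map_lmod)
      (auto intro!: supported_Z_module_mult simp: zero_tuple_def restrict_eq_iff)
  thus ?thesis by (auto simp: cocycles_def tuples_def)
qed

lemma coboundaries_lmod: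
  assumes "Z_module A"
  shows "v \<in> coboundaries (lmod (supported A)) n D (Suc p) \<longleftrightarrow>
    (\<exists>w\<in>{..<n p} \<rightarrow>\<^sub>E supported A. v = (\<lambda>i\<in>{..<n (Suc p)}. \<Sum>j<n p. D p i j * w j))"
proof -
  have "coboundary_map (lmod (supported A)) n D p w = (\<lambda>i\<in>{..<n (Suc p)}. \<Sum>j<n p. D p i j * w j)"
    if "w \<in> {..<n p} \<rightarrow>\<^sub>E supported A" for w
    using that assms D_in by (subst coboundary_map_lmod) (auto intro!: supported_Z_module_mult)
  thus ?thesis by (auto simp: tuples_def image_iff)
qed

text \<open>By exactness the Koszul syzygies \<open>gen j * e_i - gen i * e_j\<close> come from the
  second differential, so a cocycle satisfies \<open>gen j * v i = gen i * v j\<close>. All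
  quotients \<open>v i / gen i\<close> with \<open>gen i\<close> nonzero therefore agree. Their
  common value \<open>q\<close> multiplies the maximal ideal into the module because the
  \<open>gen i\<close> generate that ideal.\<close>

lemma cocycles_1:
  assumes A: "Z_module A"
  shows "v \<in> cocycles (lmod (supported A)) n D 1 \<longleftrightarrow>
    (\<exists>q\<in>colon_max A. v = (\<lambda>j\<in>{..<n 1}. gen j * q))"
proof
  assume "v \<in> cocycles (lmod (supported A)) n D 1"
  hence v: "v \<in> {..<n 1} \<rightarrow>\<^sub>E supported A" and syz: "\<And>i. i < n (Suc 1) \<Longrightarrow> (\<Sum>j<n 1. D 1 i j * v j) = 0"
    using cocycles_lmod[OF A, of v 1] by auto
  have koszul: "gen j * v i = gen i * v j" if ij: "i < n 1" "j < n 1" for i j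
  proof -
    \<comment> \<open>The coefficient vector of the Koszul syzygy for \<open>i\<close> and
      \<open>j\<close>.\<close>
    define y where "y = (\<lambda>k. (if k = i then gen j else 0) - (if k = j then gen i else 0))"
    have "y k \<in> supported Z" if "k < n (Suc 0)" for k
      using ij gen_Z by (auto simp: y_def intro!: supported_diff)
    moreover have "(\<Sum>k<n (Suc 0). y k * D 0 k l) = 0" if "l < n 0" for l
      using ij that by (simp add: y_def n_0 gen_def[symmetric] left_diff_distrib sum_subtractf
          if_distrib[of "\<lambda>x. x * _"] cong: if_cong)
    ultimately obtain s where s: "\<And>k. k < n (Suc 0) \<Longrightarrow> y k = (\<Sum>l<n (Suc (Suc 0)). s l * D (Suc 0) l k)"
      using exact[of 0 y] by blast
    have "(\<Sum>k<n (Suc 0). y k * v k) = (\<Sum>k<n (Suc 0). \<Sum>l<n (Suc (Suc 0)). s l * (D (Suc 0) l k * v k))"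
      by (simp add: s sum_distrib_right mult.assoc)
    also have "\<dots> = (\<Sum>l<n (Suc (Suc 0)). s l * (\<Sum>k<n (Suc 0). D (Suc 0) l k * v k))"
      by (subst sum.swap) (simp add: sum_distrib_left)
    also have "\<dots> = 0" using syz by simp
    finally show ?thesis
      using ij by (simp add: y_def left_diff_distrib sum_subtractf if_distrib[of "\<lambda>x. x * _"] cong: if_cong)
  qed
  obtain j where j: "j < n 1" "gen j \<noteq> 0" by (rule gen_nonzero_ex)
  define q where "q = v j / gen j"
  have vq: "v i = gen i * q" if "i < n 1" for i
    using koszul[OF that j(1)] j(2) by (simp add: q_def field_simps)
  have "q \<in> colon_max A"
    unfolding colon_max_def
  proof (intro CollectI ballI)
    fix m :: "'k fls" assume "m \<in> supported (Z - {0})"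
    then obtain y where y: "\<And>i. i < n 1 \<Longrightarrow> y i \<in> supported Z" "m = (\<Sum>i<n 1. y i * gen i)"
      by (rule gen_obtain) blast
    have "m * q = (\<Sum>i<n 1. y i * v i)" unfolding y(2) by (simp add: sum_distrib_right mult.assoc vq)
    also have "\<dots> \<in> supported A" using y v A by (auto intro!: supported_sum supported_Z_module_mult)
    finally show "m * q \<in> supported A" .
  qed
  moreover have "v = (\<lambda>j\<in>{..<n 1}. gen j * q)"
    using v vq by (auto simp: PiE_def extensional_def fun_eq_iff)
  ultimately show "\<exists>q\<in>colon_max A. v = (\<lambda>j\<in>{..<n 1}. gen j * q)" by blast
next
  assume "\<exists>q\<in>colon_max A. v = (\<lambda>j\<in>{..<n 1}. gen j * q)"
  then obtain q where q: "q \<in> colon_max A" and v: "v = (\<lambda>j\<in>{..<n 1}. gen j * q)" by blast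
  have "v \<in> {..<n 1} \<rightarrow>\<^sub>E supported A" using q gen_in by (auto simp: v colon_max_def)
  moreover have "(\<Sum>j<n 1. D 1 i j * v j) = 0" if "i < n (Suc 1)" for i
  proof -
    have "(\<Sum>j<n 1. D 1 i j * v j) = (\<Sum>j<n (Suc 0). D (Suc 0) i j * D 0 j 0) * q"
      by (simp add: v gen_def sum_distrib_right mult.assoc)
    thus ?thesis using complex[of i 0 0] that n_0 by simp
  qed
  ultimately show "v \<in> cocycles (lmod (supported A)) n D 1" by (simp add: cocycles_lmod[OF A])
qed

lemma coboundaries_1:
  assumes A: "Z_module A"
  shows "v \<in> coboundaries (lmod (supported A)) n D 1 \<longleftrightarrow>
    (\<exists>w\<in>supported A. v = (\<lambda>j\<in>{..<n 1}. gen j * w))"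
proof -
  have "v \<in> coboundaries (lmod (supported A)) n D (Suc 0) \<longleftrightarrow>
    (\<exists>w\<in>{..<n 0} \<rightarrow>\<^sub>E supported A. v = (\<lambda>i\<in>{..<n (Suc 0)}. \<Sum>j<n 0. D 0 i j * w j))"
    by (rule coboundaries_lmod[OF A])
  also have "\<dots> \<longleftrightarrow> (\<exists>w\<in>supported A. v = (\<lambda>j\<in>{..<n 1}. gen j * w))" (is "?L \<longleftrightarrow> ?R")
  proof
    assume ?L
    then obtain w where "w \<in> {..<n 0} \<rightarrow>\<^sub>E supported A" "v = (\<lambda>i\<in>{..<n (Suc 0)}. \<Sum>j<n 0. D 0 i j * w j)" ..
    thus ?R by (intro bexI[of _ "w 0"]) (auto simp: n_0 gen_def)
  next
    assume ?R
    then obtain w where "w \<in> supported A" "v = (\<lambda>j\<in>{..<n 1}. gen j * w)" ..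
    thus ?L by (intro bexI[of _ "\<lambda>j\<in>{..<n 0}. w"]) (auto simp: n_0 gen_def)
  qed
  finally show ?thesis by simp
qed

lemma gen_mult_inject: "(\<lambda>j\<in>{..<n 1}. gen j * q) = (\<lambda>j\<in>{..<n 1}. gen j * q') \<longleftrightarrow> q = q'"
proof -
  obtain j where "j < n 1" "gen j \<noteq> 0" by (rule gen_nonzero_ex)
  thus ?thesis by (auto simp: restrict_eq_iff)
qed

end

section \<open>Linear functionals and the socle\<close>

text \<open>\<open>G\<close> is the graph of a functional on a subspace, given as a relation because
  its values arise from non-unique preimages. The functional is extended from a basis of the
  subspace.\<close>

lemma (in vector_space) ex_linear_functional:
  fixes G :: "('b \<times> 'a) set"
  assumes zero: "(0, 0) \<in> G"
    and add: "\<And>x y c d. (x, c) \<in> G \<Longrightarrow> (y, d) \<in> G \<Longrightarrow> (x + y, c + d) \<in> G"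
    and scale: "\<And>a x c. (x, c) \<in> G \<Longrightarrow> (scale a x, a * c) \<in> G"
    and functional: "\<And>c. (0, c) \<in> G \<Longrightarrow> c = 0"
  obtains f where "\<And>x y. f (x + y) = f x + f y" "\<And>a x. f (scale a x) = a * f x"
    "\<And>x c. (x, c) \<in> G \<Longrightarrow> f x = c"
proof -
  interpret scalar: vector_space "(*) :: 'a \<Rightarrow> 'a \<Rightarrow> 'a"
    by unfold_locales (auto simp: algebra_simps)
  interpret vector_space_pair scale "(*) :: 'a \<Rightarrow> 'a \<Rightarrow> 'a" ..
  have unique: "c = d" if "(x, c) \<in> G" "(x, d) \<in> G" for x c d
  proof -
    have "(x + scale (-1) x, c + (-1) * d) \<in> G" using that by (intro add scale)
    thus ?thesis using functional[of "c - d"] by simp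
  qed
  define g where "g = (\<lambda>x. THE c. (x, c) \<in> G)"
  have g: "g x = c" if "(x, c) \<in> G" for x c
    unfolding g_def using that unique by blast
  obtain B where B: "B \<subseteq> fst ` G" "independent B" "fst ` G \<subseteq> span B"
    using maximal_independent_subset by blast
  obtain f where f: "Vector_Spaces.linear scale (*) f" "\<forall>x\<in>B. f x = g x"
    using linear_independent_extend[OF B(2)] by blast
  interpret f: Vector_Spaces.linear scale "(*)" f by (rule f(1))
  have graph: "(x, f x) \<in> G" if "x \<in> span B" for x
    using that
  proof (induction rule: span_induct_alt)
    case base
    thus ?case using zero by (simp add: f.zero)
  next
    case (step c x y)
    have "(x, f x) \<in> G" using step(1) B(1) f(2) g by fastforce
    thus ?case using step(2) add scale by (auto simp: f.add f.scale)
  qed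
  have "f x = c" if "(x, c) \<in> G" for x c
  proof (rule unique)
    have "x \<in> fst ` G" using that by (rule image_eqI[rotated]) simp
    thus "(x, f x) \<in> G" using B(3) by (intro graph) (rule subsetD)
  qed (rule that)
  thus thesis using that[of f] by (simp add: f.add f.scale)
qed

lemma vector_space_fls_tuples: "vector_space (\<lambda>(c :: 'k::field) (x :: nat \<Rightarrow> 'k fls) i. fls_const c * x i)"
  by unfold_locales (auto simp: fun_eq_iff algebra_simps simp flip: fls_plus_const)

context numerical_semigroup_loc begin

text \<open>The coefficient of \<open>w\<close> at \<open>n\<close> has to be
  \<open>\<mu> (tpow (F - n))\<close>. It vanishes for \<open>n < 0\<close>, where the exponent
  exceeds \<open>F\<close>, so \<open>w\<close> is a Laurent series; it also vanishes when
  \<open>F - n\<close> lies in \<open>Z\<close>, which places the support in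
  \<open>K\<close>.\<close>

lemma ex_functional_representative:
  fixes \<mu> :: "'k::field fls \<Rightarrow> 'k"
  assumes add: "\<And>x y. \<mu> (x + y) = \<mu> x + \<mu> y" and scale: "\<And>c x. \<mu> (fls_const c * x) = c * \<mu> x"
    and vanish: "\<And>x. x \<in> supported Z \<Longrightarrow> \<mu> x = 0"
  obtains w where "w \<in> supported K" "\<And>q. \<mu> q = (q * w) $$ F"
proof -
  define w where "w = Abs_fls (\<lambda>n. \<mu> (tpow (F - n)))"
  have w: "w $$ n = \<mu> (tpow (F - n))" for n
    unfolding w_def by (rule nth_Abs_fls_lower_bound[of 0]) (auto intro!: vanish Z_above_F)
  have wK: "w \<in> supported K"
    by (rule supportedI) (auto simp: w K_def intro: vanish)
  moreover have "\<mu> q = (q * w) $$ F" for q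
  proof -
    \<comment> \<open>The part of \<open>q\<close> up to degree \<open>F\<close> is a finite sum of
      monomials. Neither \<open>\<mu>\<close> nor the coefficient at \<open>F\<close> of the product
      with \<open>w\<close> sees the rest.\<close>
    define p where "p = (\<Sum>k\<in>{fls_subdegree q..F}. fls_const (q $$ k) * tpow k)"
    have pn: "p $$ n = (if n \<in> {fls_subdegree q..F} then q $$ n else 0)" for n
      by (simp add: p_def fls_nth_sum tpow_nth if_distrib[of "\<lambda>x. _ * x"] cong: if_cong)
    have r: "q - p \<in> supported {F<..}"
      by (rule supportedI) (auto simp: pn split: if_splits)
    have sum: "\<mu> (sum h I) = (\<Sum>i\<in>I. \<mu> (h i))" if "finite I" for h and I :: "int set"
      using that vanish[of 0] by (induction I rule: finite_induct) (auto simp: add)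
    have "\<mu> (q - p) = 0"
      using r by (intro vanish supported_mono[OF _ r]) (auto intro: Z_above_F)
    moreover have "\<mu> q = \<mu> p + \<mu> (q - p)" by (simp flip: add)
    ultimately have "\<mu> q = \<mu> p" by simp
    also have "\<dots> = (\<Sum>k\<in>{fls_subdegree q..F}. q $$ k * w $$ (F - k))"
      unfolding p_def by (simp add: sum scale w)
    also have "\<dots> = (p * w) $$ F"
      unfolding p_def by (simp add: sum_distrib_right fls_nth_sum mult.assoc)
    also have "\<dots> = (q * w) $$ F"
    proof -
      have "(q - p) * w \<in> supported {F<..}"
        by (rule supported_mult[OF r wK]) (use K_nonneg in force)
      hence "((q - p) * w) $$ F = 0" by (rule supported_nth_eq_0) simp
      thus ?thesis by (simp add: left_diff_distrib)
    qed
    finally show ?thesis .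
  qed
  ultimately show thesis by (rule that)
qed

lemma eq_if_F_coeffs_eq:
  fixes x y :: "'k::field fls"
  assumes "\<And>q. (q * x) $$ F = (q * y) $$ F"
  shows "x = y"
proof (rule fls_eqI)
  fix n show "x $$ n = y $$ n" using assms[of "tpow (F - n)"] by simp
qed

lemma rel_pseudo_frobenius_Z: "rel_pseudo_frobenius Z = pseudo_frobenius H"
  by (auto simp: rel_pseudo_frobenius_def PF_iff)

lemma finite_PF: "finite (pseudo_frobenius H)"
proof (rule finite_subset)
  show "pseudo_frobenius H \<subseteq> {- (F + 2)..F}"
  proof
    fix z assume z: "z \<in> pseudo_frobenius H"
    have "F + 2 \<in> Z" "F + 2 > 0" using F_ge by (auto intro: Z_above_F)
    hence "z + (F + 2) \<in> Z" using z by (auto simp: PF_iff)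
    thus "z \<in> {- (F + 2)..F}" using Z_nonneg PF_le[OF z] by force
  qed
qed simp

text \<open>If \<open>z\<close> is outside \<open>K\<close>, then \<open>F - z\<close> lies in
  \<open>Z\<close>. Were it positive, adding it to \<open>z\<close> would give \<open>F\<close> in
  \<open>K\<close>, although \<open>F - F = 0\<close> lies in \<open>Z\<close>. This is type 1 of
  the canonical ideal.\<close>

lemma rel_pseudo_frobenius_K: "rel_pseudo_frobenius K = {F}"
proof -
  have "z = F" if "z \<in> rel_pseudo_frobenius K" for z
  proof (rule ccontr)
    assume "z \<noteq> F"
    have "F - z \<in> Z" using that by (auto simp: rel_pseudo_frobenius_def K_def)
    moreover from this have "F - z > 0" using Z_nonneg \<open>z \<noteq> F\<close> by force
    ultimately have "z + (F - z) \<in> K" using that unfolding rel_pseudo_frobenius_def by blast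
    thus False by (simp add: K_def)
  qed
  moreover have "- h \<notin> Z" if "h > 0" for h using Z_nonneg[of "-h"] that by auto
  hence "F \<in> rel_pseudo_frobenius K" by (simp add: rel_pseudo_frobenius_def K_def)
  ultimately show ?thesis by blast
qed

lemma socle_basis_K: "socle_basis K 1 (\<lambda>_. tpow F :: 'k::field fls)"
  unfolding socle_basis_def colon_max_eq[OF Z_module_K] rel_pseudo_frobenius_K
proof (intro conjI ballI allI impI)
  fix y :: "'k fls" assume y: "y \<in> supported (K \<union> {F})"
  have "y - fls_const (y $$ F) * tpow F \<in> supported K"
    using y by (intro supportedI) (auto simp: tpow_nth split: if_splits dest: supportedD)
  thus "\<exists>r. (\<forall>k<1::nat. r k \<in> supported Z) \<and> y - (\<Sum>k<1. r k * tpow F) \<in> supported K"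
    by (intro exI[of _ "\<lambda>_. fls_const (y $$ F)"]) auto
next
  fix r :: "nat \<Rightarrow> 'k fls" and k :: nat
  assume "(\<Sum>k<1. r k * tpow F) \<in> supported K" "k < 1"
  hence "r 0 * tpow F \<in> supported K" by simp
  hence "(r 0 * tpow F) $$ F = 0" by (rule supported_nth_eq_0) (simp add: K_def)
  thus "r k $$ 0 = 0" using \<open>k < 1\<close> by simp
qed simp

text \<open>The coefficient functions of the \<open>q k\<close> on the finite set \<open>?P\<close>
  and the indicator functions of its points are two bases of one vector space. Ring coefficients act
  on the socle through their constant terms.\<close>

lemma card_rel_pseudo_frobenius:
  fixes q :: "nat \<Rightarrow> 'k::field fls"
  assumes A: "Z_module A" and fin: "finite (rel_pseudo_frobenius A)" and q: "socle_basis A d q"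
  shows "card (rel_pseudo_frobenius A) = d"
proof -
  let ?P = "rel_pseudo_frobenius A"
  define scale :: "'k \<Rightarrow> (int \<Rightarrow> 'k) \<Rightarrow> int \<Rightarrow> 'k" where "scale = (\<lambda>c f z. c * f z)"
  interpret vector_space scale
    by unfold_locales (auto simp: scale_def fun_eq_iff algebra_simps)
  have sum_apply: "(\<Sum>i\<in>I. f i) z = (\<Sum>i\<in>I. f i z)" for f :: "'i \<Rightarrow> int \<Rightarrow> 'k" and I z
    by (induction I rule: infinite_finite_induct) auto
  define p where "p k = (\<lambda>z. if z \<in> ?P then q k $$ z else 0)" for k
  define e where "e x = (\<lambda>z::int. if z = x then 1 else 0 :: 'k)" for x
  have qP: "q k \<in> supported (A \<union> ?P)" if "k < d" for k
    using q that unfolding socle_basis_def colon_max_eq[OF A] by blast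
  have indep: "u k = 0" if u: "(\<Sum>k<d. scale (u k) (p k)) = 0" "k < d" for u k
  proof -
    have "(\<Sum>k<d. fls_const (u k) * q k) \<in> supported A"
    proof (rule supportedI, rule ccontr)
      fix z assume z: "(\<Sum>k<d. fls_const (u k) * q k) $$ z \<noteq> 0" "z \<notin> A"
      have "(\<Sum>k<d. fls_const (u k) * q k) \<in> supported (A \<union> ?P)"
        using qP by (intro supported_sum supported_const_mult) auto
      hence "z \<in> ?P" using z supportedD by blast
      hence "(\<Sum>k<d. fls_const (u k) * q k) $$ z = (\<Sum>k<d. scale (u k) (p k)) z"
        by (simp add: sum_apply fls_nth_sum scale_def p_def)
      thus False using z u by simp
    qed
    hence "fls_const (u k) $$ 0 = 0"
      using q \<open>k < d\<close> unfolding socle_basis_def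
      by (elim conjE allE[of _ "\<lambda>k. fls_const (u k)"]) auto
    thus ?thesis by simp
  qed
  have inj: "inj_on p {..<d}"
  proof (rule inj_onI, rule ccontr)
    fix i j assume ij: "i \<in> {..<d}" "j \<in> {..<d}" "p i = p j" "i \<noteq> j"
    define u where "u = (\<lambda>k. (if k = i then 1 else 0) - (if k = j then 1 else 0) :: 'k)"
    have "(\<Sum>k<d. scale (u k) (p k)) = 0"
      using ij by (simp add: u_def scale_left_diff_distrib sum_subtractf if_distrib[of "\<lambda>c. scale c _"] cong: if_cong)
    hence "u i = 0" using indep[of u i] ij by simp
    thus False using ij by (simp add: u_def)
  qed
  have ind_p: "independent (p ` {..<d})"
  proof
    assume "dependent (p ` {..<d})"
    then obtain u v where u: "v \<in> p ` {..<d}" "u v \<noteq> 0" "(\<Sum>v\<in>p ` {..<d}. scale (u v) v) = 0"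
      using dependent_finite[of "p ` {..<d}"] by auto
    have "(\<Sum>k<d. scale (u (p k)) (p k)) = 0" using u(3) inj by (simp add: sum.reindex)
    thus False using indep[of "\<lambda>k. u (p k)"] u(1,2) by blast
  qed
  have inj_e: "inj_on e ?P"
    by (rule inj_onI) (auto simp: e_def fun_eq_iff split: if_splits)
  have ind_e: "independent (e ` ?P)"
  proof
    assume "dependent (e ` ?P)"
    then obtain u v where u: "v \<in> e ` ?P" "u v \<noteq> 0" "(\<Sum>v\<in>e ` ?P. scale (u v) v) = 0"
      using dependent_finite[of "e ` ?P"] fin by auto
    have "(\<Sum>x\<in>?P. scale (u (e x)) (e x)) = 0" using u(3) inj_e by (simp add: sum.reindex)
    hence "(\<Sum>x\<in>?P. scale (u (e x)) (e x) z) = 0" for z by (metis sum_apply zero_fun_apply)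
    moreover obtain z where "z \<in> ?P" "v = e z" using u(1) by blast
    moreover have "(\<Sum>x\<in>?P. scale (u (e x)) (e x) z) = u (e z)" if "z \<in> ?P" for z
      using that fin by (simp add: scale_def e_def if_distrib[of "\<lambda>c. _ * c"] cong: if_cong)
    ultimately show False using u(2) by metis
  qed
  have "p k \<in> span (e ` ?P)" for k
  proof -
    have "p k = (\<Sum>x\<in>?P. scale (q k $$ x) (e x))"
      using fin by (auto simp: fun_eq_iff sum_apply scale_def p_def e_def if_distrib[of "\<lambda>c. _ * c"] cong: if_cong)
    also have "\<dots> \<in> span (e ` ?P)" by (intro span_sum span_scale span_base) auto
    finally show ?thesis .
  qed
  moreover have "e x \<in> span (p ` {..<d})" if x: "x \<in> ?P" for x
  proof -
    have "tpow x \<in> (colon_max A :: 'k fls set)" unfolding colon_max_eq[OF A] using x by simp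
    then obtain r where r: "\<And>k. k < d \<Longrightarrow> r k \<in> supported Z" "tpow x - (\<Sum>k<d. r k * q k) \<in> supported A"
      using q unfolding socle_basis_def by blast
    have "e x z = (\<Sum>k<d. scale (r k $$ 0) (p k)) z" for z
    proof (cases "z \<in> ?P")
      case False
      thus ?thesis using x by (auto simp: e_def sum_apply scale_def p_def)
    next
      case True
      hence zA: "z \<notin> A" by (simp add: rel_pseudo_frobenius_def)
      \<comment> \<open>\<open>r k\<close> minus its constant term lies in the maximal ideal, which
        multiplies \<open>q k\<close> into \<open>supported A\<close>.\<close>
      have "(r k * q k) $$ z = r k $$ 0 * q k $$ z" if "k < d" for k
      proof -
        have "r k - fls_const (r k $$ 0) \<in> supported (Z - {0})"
          using r(1)[OF that] by (intro supportedI) (auto split: if_splits dest: supportedD)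
        hence "(r k - fls_const (r k $$ 0)) * q k \<in> supported A"
          using q that unfolding socle_basis_def colon_max_def by blast
        hence "((r k - fls_const (r k $$ 0)) * q k) $$ z = 0" using zA by (rule supported_nth_eq_0)
        thus ?thesis by (simp add: left_diff_distrib)
      qed
      moreover have "(tpow x - (\<Sum>k<d. r k * q k)) $$ z = 0" using r(2) zA by (rule supported_nth_eq_0)
      ultimately show ?thesis using True by (simp add: tpow_nth e_def sum_apply scale_def p_def fls_nth_sum)
    qed
    hence "e x = (\<Sum>k<d. scale (r k $$ 0) (p k))" by (simp add: fun_eq_iff)
    also have "\<dots> \<in> span (p ` {..<d})" by (intro span_sum span_scale span_base) auto
    finally show ?thesis .
  qed
  ultimately have "span (p ` {..<d}) = span (e ` ?P)"
    by (intro equalityI span_minimal) auto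
  hence "card (p ` {..<d}) = card (e ` ?P)"
    using dim_span_eq_card_independent[OF ind_p] dim_span_eq_card_independent[OF ind_e] by simp
  thus ?thesis using inj inj_e by (simp add: card_image)
qed

end

section \<open>Injective dimension of the canonical ideal\<close>

context residue_resolution_loc begin

lemma tuple_comb_gen:
  assumes A: "Z_module A" and r: "r \<in> {..<d} \<rightarrow> supported Z"
    and q: "\<forall>k<d. q k \<in> colon_max A" and z: "\<forall>k<d. z k = (\<lambda>j\<in>{..<n 1}. gen j * q k)"
  shows "tuple_comb (lmod (supported A)) (n 1) d r z = (\<lambda>j\<in>{..<n 1}. gen j * (\<Sum>k<d. r k * q k))"
proof -
  have "r k * z k i \<in> supported A" if "k < d" "i < n 1" for k i
    using that r q z gen_in[OF \<open>i < n 1\<close>] A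
    by (intro supported_Z_module_mult) (auto simp: colon_max_def)
  hence "tuple_comb (lmod (supported A)) (n 1) d r z = (\<lambda>j\<in>{..<n 1}. \<Sum>k<d. r k * z k j)"
    by (intro tuple_comb_lmod)
  also have "\<dots> = (\<lambda>j\<in>{..<n 1}. gen j * (\<Sum>k<d. r k * q k))"
    using z by (intro restrict_ext) (auto simp: sum_distrib_left mult_ac intro!: sum.cong)
  finally show ?thesis .
qed

text \<open>The injective map \<open>q \<mapsto> (gen j * q)_j\<close> identifies cocycles modulo
  coboundaries with \<open>colon_max A\<close> modulo \<open>supported A\<close>; equalities are
  recovered by cancelling one nonzero \<open>gen j\<close>.\<close>

lemma socle_basis_of_ext_1:
  assumes A: "Z_module A"
    and z: "z \<in> {..<d} \<rightarrow> cocycles (lmod (supported A)) n D 1"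
    and span: "\<forall>v\<in>cocycles (lmod (supported A)) n D 1. \<exists>r\<in>{..<d} \<rightarrow> carrier (laurent_subring (supported Z)).
      \<exists>b\<in>coboundaries (lmod (supported A)) n D 1.
           \<forall>i<n 1. v i = tuple_comb (lmod (supported A)) (n 1) d r z i \<oplus>\<^bsub>lmod (supported A)\<^esub> b i"
    and ind: "\<forall>r\<in>{..<d} \<rightarrow> carrier (laurent_subring (supported Z)).
           tuple_comb (lmod (supported A)) (n 1) d r z \<in> coboundaries (lmod (supported A)) n D 1 \<longrightarrow>
             (\<forall>k<d. r k \<in> nonunits (laurent_subring (supported Z)))"
  obtains q :: "nat \<Rightarrow> 'k fls" where "socle_basis A d q"
proof -
  have "\<forall>k<d. \<exists>q\<in>colon_max A. z k = (\<lambda>j\<in>{..<n 1}. gen j * q)"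
    using z cocycles_1[OF A] by blast
  then obtain q where q: "\<forall>k<d. q k \<in> colon_max A" "\<forall>k<d. z k = (\<lambda>j\<in>{..<n 1}. gen j * q k)"
    by metis
  note comb = tuple_comb_gen[OF A _ q]
  have "socle_basis A d q"
    unfolding socle_basis_def
  proof (intro conjI ballI allI impI)
    fix y :: "'k fls" assume "y \<in> colon_max A"
    hence "(\<lambda>j\<in>{..<n 1}. gen j * y) \<in> cocycles (lmod (supported A)) n D 1"
      using cocycles_1[OF A] by blast
    then obtain r b where r: "r \<in> {..<d} \<rightarrow> supported Z" and "b \<in> coboundaries (lmod (supported A)) n D 1"
      and *: "\<forall>i<n 1. (\<lambda>j\<in>{..<n 1}. gen j * y) i = tuple_comb (lmod (supported A)) (n 1) d r z i + b i"
      using span by (auto simp del: One_nat_def)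
    then obtain w where w: "w \<in> supported A" "b = (\<lambda>j\<in>{..<n 1}. gen j * w)"
      using coboundaries_1[OF A] by blast
    obtain j where j: "j < n 1" "gen j \<noteq> 0" by (rule gen_nonzero_ex)
    have "gen j * y = gen j * ((\<Sum>k<d. r k * q k) + w)"
      using *[rule_format, OF j(1)] j(1) unfolding comb[OF r] w(2) by (simp add: distrib_left)
    hence "y - (\<Sum>k<d. r k * q k) = w" using j(2) by simp
    thus "\<exists>r. (\<forall>k<d. r k \<in> supported Z) \<and> y - (\<Sum>k<d. r k * q k) \<in> supported A"
      using r w(1) by (intro exI[of _ r]) auto
  next
    fix r k assume r: "\<forall>k<d. r k \<in> supported Z" "(\<Sum>k<d. r k * q k) \<in> supported A" and "k < d"
    have r': "r \<in> {..<d} \<rightarrow> supported Z" using r by auto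
    hence "tuple_comb (lmod (supported A)) (n 1) d r z \<in> coboundaries (lmod (supported A)) n D 1"
      unfolding coboundaries_1[OF A] comb[OF r'] using r(2) by blast
    thus "r k $$ 0 = 0" using ind r' \<open>k < d\<close> by (simp add: nonunits_Z)
  qed (use q(1) in blast)
  thus thesis by (rule that)
qed

lemma ext_1_of_socle_basis:
  fixes q :: "nat \<Rightarrow> 'k fls"
  assumes A: "Z_module A" and q: "socle_basis A d q"
  shows "residue_ext_dim (laurent_subring (supported Z)) (lmod (supported A :: 'k fls set)) 1 d"
  unfolding residue_ext_dim_def
proof (intro exI conjI ballI impI)
  define z where "z = (\<lambda>k. \<lambda>j\<in>{..<n 1}. gen j * q k)"
  have qc: "\<forall>k<d. q k \<in> colon_max A" using q by (simp add: socle_basis_def)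
  have z_eq: "\<forall>k<d. z k = (\<lambda>j\<in>{..<n 1}. gen j * q k)" by (simp add: z_def)
  show "residue_resolution (laurent_subring (supported Z)) n D" by (rule resolution)
  show "z \<in> {..<d} \<rightarrow> cocycles (lmod (supported A)) n D 1"
    using cocycles_1[OF A] qc by (fastforce simp: z_def)
  note comb = tuple_comb_gen[OF A _ qc z_eq]
  {
    fix v assume "v \<in> cocycles (lmod (supported A)) n D 1"
    then obtain y where y: "y \<in> colon_max A" "v = (\<lambda>j\<in>{..<n 1}. gen j * y)"
      using cocycles_1[OF A] by blast
    then obtain r where r: "\<forall>k<d. r k \<in> supported Z" "y - (\<Sum>k<d. r k * q k) \<in> supported A"
      using q unfolding socle_basis_def by blast
    have r': "r \<in> {..<d} \<rightarrow> supported Z" using r by auto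
    define w where "w = y - (\<Sum>k<d. r k * q k)"
    have "(\<lambda>j\<in>{..<n 1}. gen j * w) \<in> coboundaries (lmod (supported A)) n D 1"
      using coboundaries_1[OF A] r(2) unfolding w_def by blast
    moreover have "\<forall>i<n 1. v i = tuple_comb (lmod (supported A)) (n 1) d r z i \<oplus>\<^bsub>lmod (supported A)\<^esub> (\<lambda>j\<in>{..<n 1}. gen j * w) i"
      unfolding comb[OF r'] y(2) by (auto simp: w_def right_diff_distrib)
    ultimately show "\<exists>r\<in>{..<d} \<rightarrow> carrier (laurent_subring (supported Z)). \<exists>b\<in>coboundaries (lmod (supported A)) n D 1.
      \<forall>i<n 1. v i = tuple_comb (lmod (supported A)) (n 1) d r z i \<oplus>\<^bsub>lmod (supported A)\<^esub> b i"
      using r' by (intro bexI[of _ r] bexI[of _ "\<lambda>j\<in>{..<n 1}. gen j * w"]) simp_all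
  }
  {
    fix r assume "r \<in> {..<d} \<rightarrow> carrier (laurent_subring (supported Z))"
      and co: "tuple_comb (lmod (supported A)) (n 1) d r z \<in> coboundaries (lmod (supported A)) n D 1"
    hence r: "r \<in> {..<d} \<rightarrow> supported Z" by simp
    obtain w where w: "w \<in> supported A" "tuple_comb (lmod (supported A)) (n 1) d r z = (\<lambda>j\<in>{..<n 1}. gen j * w)"
      using co coboundaries_1[OF A] by blast
    hence "(\<Sum>k<d. r k * q k) = w" unfolding comb[OF r] gen_mult_inject by blast
    hence "\<forall>k<d. r k $$ 0 = 0" using q r w(1) unfolding socle_basis_def by blast
    thus "\<forall>k<d. r k \<in> nonunits (laurent_subring (supported Z))" using r by (auto simp: nonunits_Z)
  }
qed

lemma ext_0:
  assumes A: "Z_module A"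
  shows "residue_ext_dim (laurent_subring (supported Z)) (lmod (supported A :: 'k fls set)) 0 0"
  unfolding residue_ext_dim_def
proof (intro exI conjI ballI impI)
  show "residue_resolution (laurent_subring (supported Z)) n D" by (rule resolution)
  fix v assume "v \<in> cocycles (lmod (supported A)) n D 0"
  hence v: "\<And>i. i < n 1 \<Longrightarrow> gen i * v 0 = 0"
    unfolding cocycles_lmod[OF A] by (simp add: n_0 gen_def)
  obtain j where "j < n 1" "gen j \<noteq> 0" by (rule gen_nonzero_ex)
  hence "v 0 = 0" using v[of j] by simp
  thus "\<exists>r\<in>{..<0} \<rightarrow> carrier (laurent_subring (supported Z)). \<exists>b\<in>coboundaries (lmod (supported A)) n D 0.
      \<forall>i<n 0. v i = tuple_comb (lmod (supported A)) (n 0) 0 r (\<lambda>_ _. 0) i \<oplus>\<^bsub>lmod (supported A)\<^esub> b i"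
    by (auto simp: n_0 zero_tuple_def tuple_comb_lmod)
qed (simp_all)

text \<open>A cocycle \<open>v\<close> defines a functional on the image of the differential over \<open>K((t))\<close>, namely \<open>d y \<mapsto> ev y $$ F\<close>. Exactness makes it vanish on integral vectors, so it extends to a linear functional that vanishes on them, and the representing series are the preimage of \<open>v\<close>.\<close>

lemma cocycle_is_coboundary:
  assumes v: "v \<in> cocycles (lmod (supported K)) n D (Suc (Suc p))"
  shows "v \<in> coboundaries (lmod (supported K)) n D (Suc (Suc p))"
proof -
  let ?P = "Suc (Suc p)" and ?Q = "Suc p"
  have vK: "\<And>i. i < n ?P \<Longrightarrow> v i \<in> supported K" and vext: "v \<in> extensional {..<n ?P}"
    and syz: "\<And>i. i < n (Suc ?P) \<Longrightarrow> (\<Sum>j<n ?P. D ?P i j * v j) = 0"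
    using v unfolding cocycles_lmod[OF Z_module_K] by (auto simp: PiE_def)
  define d where "d y l = (\<Sum>i<n ?P. y i * D ?Q i l)" for y l
  define ev where "ev y = (\<Sum>i<n ?P. y i * v i)" for y
  have d_add: "d (\<lambda>i. y i + y' i) l = d y l + d y' l" and ev_add: "ev (\<lambda>i. y i + y' i) = ev y + ev y'"
    and d_diff: "d (\<lambda>i. y i - y' i) l = d y l - d y' l" and ev_diff: "ev (\<lambda>i. y i - y' i) = ev y - ev y'"
    and d_mult: "d (\<lambda>i. c * y i) l = c * d y l" and ev_mult: "ev (\<lambda>i. c * y i) = c * ev y" for y y' c l
    by (simp_all add: d_def ev_def algebra_simps sum.distrib sum_subtractf sum_distrib_left)
  \<comment> \<open>After clearing denominators, exactness writes \<open>y\<close> through the next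
    differential, and \<open>ev\<close> of that is a combination of the cocycle equations.\<close>
  have ev_kernel: "ev y = 0" if "\<And>l. l < n ?Q \<Longrightarrow> d y l = 0" for y
  proof -
    obtain N where N: "\<And>i. i < n ?P \<Longrightarrow> tpow N * y i \<in> supported Z"
      using ex_tpow_times_in_Z[of "{..<n ?P}" y] by (metis finite_lessThan lessThan_iff order_refl)
    have d0: "(\<Sum>j<n ?P. tpow N * y j * D ?Q j l) = 0" if "l < n ?Q" for l
      using d_mult[of "tpow N" y l] \<open>\<And>l. l < n ?Q \<Longrightarrow> d y l = 0\<close>[OF that] by (simp add: d_def)
    obtain s where "\<And>k. k < n (Suc ?P) \<Longrightarrow> s k \<in> supported Z"
      and s: "\<And>j. j < n ?P \<Longrightarrow> tpow N * y j = (\<Sum>k<n (Suc ?P). s k * D ?P k j)"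
      by (rule exact[of ?Q "\<lambda>j. tpow N * y j", OF N d0]) (assumption | blast)+
    have "tpow N * ev y = (\<Sum>j<n ?P. (\<Sum>k<n (Suc ?P). s k * D ?P k j) * v j)"
      unfolding ev_def sum_distrib_left mult.assoc[symmetric] using s by (intro sum.cong) auto
    also have "\<dots> = (\<Sum>k<n (Suc ?P). s k * (\<Sum>j<n ?P. D ?P k j * v j))"
      unfolding sum_distrib_right sum_distrib_left by (subst sum.swap) (simp add: mult.assoc)
    also have "\<dots> = 0" using syz by simp
    finally show "ev y = 0" by simp
  qed
  \<comment> \<open>An integral \<open>d y\<close> is a cycle, hence equal to \<open>d y'\<close>
    with \<open>y'\<close> integral. Then \<open>ev y = ev y'\<close> is supported on
    \<open>K\<close>, which does not contain \<open>F\<close>.\<close>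
  have ev_integral: "ev y $$ F = 0" if dy: "\<And>l. l < n ?Q \<Longrightarrow> d y l \<in> supported Z" for y
  proof -
    have d0: "(\<Sum>l<n ?Q. d y l * D p l m) = 0" if "m < n p" for m
    proof -
      have "(\<Sum>l<n ?Q. d y l * D p l m) = (\<Sum>i<n ?P. y i * (\<Sum>l<n ?Q. D ?Q i l * D p l m))"
        unfolding d_def sum_distrib_right sum_distrib_left by (subst sum.swap) (simp add: mult.assoc)
      thus ?thesis using complex[OF _ that] by simp
    qed
    obtain y' where y': "\<And>k. k < n ?P \<Longrightarrow> y' k \<in> supported Z"
      "\<And>l. l < n ?Q \<Longrightarrow> d y l = (\<Sum>k<n ?P. y' k * D ?Q k l)"
      by (rule exact[of p "d y", OF dy d0]) (assumption | blast)+
    have "ev (\<lambda>i. y i - y' i) = 0"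
      by (rule ev_kernel) (simp add: d_diff y'(2), simp add: d_def)
    hence "ev y = ev y'" by (simp add: ev_diff)
    also have "ev y' \<in> supported K"
      unfolding ev_def using y'(1) vK by (intro supported_sum supported_Z_K_mult) auto
    finally show ?thesis by (rule supported_nth_eq_0) (simp add: K_def)
  qed
  interpret fls_tuples: vector_space "\<lambda>(c :: 'k) (x :: nat \<Rightarrow> 'k fls) i. fls_const c * x i"
    by (rule vector_space_fls_tuples)
  \<comment> \<open>The graph of the functional on images plus integral vectors; coordinates from
    \<open>n ?Q\<close> on are unconstrained and contribute nothing.\<close>
  define G where "G = {(z, c). \<exists>y. (\<forall>l<n ?Q. z l - d y l \<in> supported Z) \<and> c = ev y $$ F}"
  have G_0: "(0, 0) \<in> G" by (auto simp: G_def d_def ev_def intro!: exI[of _ "\<lambda>_. 0"])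
  have G_add: "(x + y, a + b) \<in> G" if "(x, a) \<in> G" "(y, b) \<in> G" for x y a b
  proof -
    from that obtain s t where s: "\<And>l. l < n ?Q \<Longrightarrow> x l - d s l \<in> supported Z" "a = ev s $$ F"
      and t: "\<And>l. l < n ?Q \<Longrightarrow> y l - d t l \<in> supported Z" "b = ev t $$ F" by (auto simp: G_def)
    have "(x l + y l) - (d s l + d t l) \<in> supported Z" if "l < n ?Q" for l
      using supported_add[OF s(1)[OF that] t(1)[OF that]] by (simp add: algebra_simps)
    thus ?thesis using s(2) t(2)
      by (auto simp: G_def d_add ev_add intro!: exI[of _ "\<lambda>i. s i + t i"])
  qed
  have G_scale: "((\<lambda>i. fls_const c * x i), c * a) \<in> G" if "(x, a) \<in> G" for c x a
  proof -
    from that obtain s where s: "\<And>l. l < n ?Q \<Longrightarrow> x l - d s l \<in> supported Z" "a = ev s $$ F"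
      by (auto simp: G_def)
    have "fls_const c * x l - fls_const c * d s l \<in> supported Z" if "l < n ?Q" for l
      using supported_const_mult[OF s(1)[OF that], of c] by (simp add: algebra_simps)
    thus ?thesis using s(2)
      by (auto simp: G_def d_mult ev_mult intro!: exI[of _ "\<lambda>i. fls_const c * s i"])
  qed
  have G_fun: "c = 0" if "(0, c) \<in> G" for c
    using that ev_integral by (auto simp: G_def)
  obtain \<Lambda> where \<Lambda>_add: "\<And>x y. \<Lambda> (x + y) = \<Lambda> x + \<Lambda> y"
    and \<Lambda>_scale: "\<And>c x. \<Lambda> (\<lambda>i. fls_const c * x i) = c * \<Lambda> x"
    and \<Lambda>_G: "\<And>z c. (z, c) \<in> G \<Longrightarrow> \<Lambda> z = c"
    by (rule fls_tuples.ex_linear_functional[OF G_0 G_add G_scale G_fun]) (assumption | blast)+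
  define unit where "unit l q = (\<lambda>m. if m = l then q else (0 :: 'k fls))" for l :: nat and q
  have "\<exists>w\<in>supported K. \<forall>q. \<Lambda> (unit l q) = (q * w) $$ F" if "l < n ?Q" for l
  proof (rule ex_functional_representative[of "\<lambda>q. \<Lambda> (unit l q)"])
    have "unit l (x + y) = unit l x + unit l y" for x y
      by (auto simp: unit_def)
    thus "\<Lambda> (unit l (x + y)) = \<Lambda> (unit l x) + \<Lambda> (unit l y)" for x y
      by (simp add: \<Lambda>_add)
    have "unit l (fls_const c * x) = (\<lambda>i. fls_const c * unit l x i)" for c x
      by (auto simp: unit_def)
    thus "\<Lambda> (unit l (fls_const c * x)) = c * \<Lambda> (unit l x)" for c x
      by (simp add: \<Lambda>_scale)
    show "\<Lambda> (unit l x) = 0" if "x \<in> supported Z" for x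
      using that by (intro \<Lambda>_G) (auto simp: G_def d_def ev_def unit_def intro!: exI[of _ "\<lambda>_. 0"])
  qed blast
  then obtain w where w: "\<And>l. l < n ?Q \<Longrightarrow> w l \<in> supported K"
    "\<And>l q. l < n ?Q \<Longrightarrow> \<Lambda> (unit l q) = (q * w l) $$ F" by metis
  have \<Lambda>_sum: "\<Lambda> (\<Sum>l\<in>I. f l) = (\<Sum>l\<in>I. \<Lambda> (f l))" if "finite I" for f and I :: "nat set"
    using that \<Lambda>_scale[of 0 0] by (induction I rule: finite_induct) (auto simp: \<Lambda>_add zero_fun_def)
  \<comment> \<open>Both sides are tested at \<open>F\<close> against every \<open>q\<close>. The
    vector \<open>q * D ?Q i l\<close> is \<open>d\<close> of \<open>q\<close> times the basis
    vector \<open>i\<close>, so \<open>\<Lambda>\<close> takes the value of \<open>ev\<close>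
    there.\<close>
  have vw: "v i = (\<Sum>l<n ?Q. D ?Q i l * w l)" if i: "i < n ?P" for i
  proof (rule eq_if_F_coeffs_eq)
    fix q
    define z where "z = (\<Sum>l<n ?Q. unit l (q * D ?Q i l))"
    have z: "z l = q * D ?Q i l" if "l < n ?Q" for l
    proof -
      have "(\<Sum>l\<in>I. f l) x = (\<Sum>l\<in>I. f l x)" for f :: "nat \<Rightarrow> nat \<Rightarrow> 'k fls" and I x
        by (induction I rule: infinite_finite_induct) auto
      thus ?thesis using that by (simp add: z_def unit_def)
    qed
    define y where "y = (\<lambda>j. if j = i then q else 0)"
    have "d y l = q * D ?Q i l" for l
      using i by (simp add: d_def y_def if_distrib[of "\<lambda>x. x * _"] cong: if_cong)
    moreover have "ev y = q * v i"
      using i by (simp add: ev_def y_def if_distrib[of "\<lambda>x. x * _"] cong: if_cong)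
    ultimately have "(z, (q * v i) $$ F) \<in> G"
      by (auto simp: G_def z intro!: exI[of _ y])
    hence "(q * v i) $$ F = \<Lambda> z" by (simp add: \<Lambda>_G)
    also have "\<dots> = (\<Sum>l<n ?Q. (q * D ?Q i l * w l) $$ F)"
      unfolding z_def by (simp add: \<Lambda>_sum w(2))
    also have "\<dots> = (q * (\<Sum>l<n ?Q. D ?Q i l * w l)) $$ F"
      by (simp add: sum_distrib_left fls_nth_sum mult.assoc)
    finally show "(q * v i) $$ F = (q * (\<Sum>l<n ?Q. D ?Q i l * w l)) $$ F" .
  qed
  have "v = (\<lambda>i\<in>{..<n ?P}. \<Sum>l<n ?Q. D ?Q i l * (\<lambda>l\<in>{..<n ?Q}. w l) l)"
    using vw vext by (auto simp: fun_eq_iff extensional_def)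
  thus ?thesis
    unfolding coboundaries_lmod[OF Z_module_K] using w(1)
    by (intro bexI[of _ "\<lambda>l\<in>{..<n ?Q}. w l"]) auto
qed

lemma ext_ge_2:
  "residue_ext_dim (laurent_subring (supported Z)) (lmod (supported K :: 'k fls set)) (Suc (Suc p)) 0"
  unfolding residue_ext_dim_def
proof (intro exI conjI ballI impI)
  show "residue_resolution (laurent_subring (supported Z)) n D" by (rule resolution)
  fix v assume v: "v \<in> cocycles (lmod (supported K)) n D (Suc (Suc p))"
  show "\<exists>r\<in>{..<0} \<rightarrow> carrier (laurent_subring (supported Z)). \<exists>b\<in>coboundaries (lmod (supported K)) n D (Suc (Suc p)).
      \<forall>i<n (Suc (Suc p)). v i = tuple_comb (lmod (supported K)) (n (Suc (Suc p))) 0 r (\<lambda>_ _. 0) i \<oplus>\<^bsub>lmod (supported K)\<^esub> b i"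
    using cocycle_is_coboundary[OF v] by (intro bexI[of _ "\<lambda>_. 0"] bexI[of _ v]) (auto simp: tuple_comb_lmod)
qed simp_all

end

section \<open>The trace of the canonical ideal\<close>

context numerical_semigroup_loc begin

lemma module_lmod_K:
  "module (laurent_subring (supported Z)) (lmod (supported K :: 'k::field fls set))"
  by (rule moduleI) (auto simp: cring_Z abelian_group_lmod supported_Z_K_mult algebra_simps)

lemma fin_gen_module_K:
  "fin_gen_module (laurent_subring (supported Z)) (lmod (supported K :: 'k::field fls set))"
proof -
  \<comment> \<open>Monomials handle the degrees below \<open>N\<close>. A remainder of order at
    least twice the conductor is a multiple of \<open>tpow conductor\<close>, stored at index
    \<open>N\<close>, with a cofactor in the ring.\<close>
  define N where "N = 2 * conductor"
  define g :: "nat \<Rightarrow> 'k fls" where "g = (\<lambda>k. if k = N then tpow (int conductor) else if int k \<in> K then tpow (int k) else 0)"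
  have cK: "int conductor \<in> K" using Z_nonneg[of "-1"] by (auto simp: K_def F_def)
  have g: "g k \<in> supported K" for k using cK by (simp add: g_def)
  have "\<exists>r\<in>{..<Suc N} \<rightarrow> supported Z. x = (\<Sum>k<Suc N. r k * g k)" if x: "x \<in> supported K" for x
  proof -
    define p where "p = x - (\<Sum>k<N. fls_const (x $$ int k) * g k)"
    have sum: "(\<Sum>k<N. fls_const (x $$ int k) * g k) $$ j = (if j < int N then x $$ j else 0)" for j
    proof -
      have "(\<Sum>k<N. fls_const (x $$ int k) * g k) $$ j = (\<Sum>k<N. if int k = j then x $$ j else 0)"
        unfolding fls_nth_sum
        by (rule sum.cong) (auto simp: g_def tpow_nth dest: supported_nth_eq_0[OF x])
      also have "\<dots> = (if j < int N then x $$ j else 0)"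
      proof (cases "0 \<le> j \<and> j < int N")
        case True
        hence "(\<Sum>k<N. if int k = j then x $$ j else 0) = (\<Sum>k<N. if k = nat j then x $$ j else 0)"
          by (intro sum.cong) auto
        thus ?thesis using True by auto
      next
        case False
        hence "x $$ j = 0" if "j < int N"
          using that K_nonneg[of j] by (intro supported_nth_eq_0[OF x]) auto
        thus ?thesis using False by (auto intro!: sum.neutral)
      qed
      finally show ?thesis .
    qed
    have pn: "p $$ j = (if j < int N then 0 else x $$ j)" for j
      by (simp add: p_def sum)
    have "tpow (- int conductor) * p \<in> supported Z"
      unfolding tpow_times_supported_iff by (auto simp: pn N_def F_def split: if_splits intro!: Z_above_F)
    moreover have "x = (\<Sum>k<N. fls_const (x $$ int k) * g k) + tpow (- int conductor) * p * g N"
    proof -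
      have "tpow (- int conductor) * p * g N = tpow (- int conductor) * tpow (int conductor) * p" by (simp add: g_def mult_ac)
      hence "tpow (- int conductor) * p * g N = p" by (simp add: tpow_mult)
      moreover have "x = (\<Sum>k<N. fls_const (x $$ int k) * g k) + p" by (simp add: p_def)
      ultimately show ?thesis by (simp only:)
    qed
    ultimately show ?thesis
      by (intro bexI[of _ "\<lambda>k. if k = N then tpow (- int conductor) * p else fls_const (x $$ int k)"]) auto
  qed
  moreover have "finsum (lmod (supported K)) (\<lambda>k. r k * g k) {..<Suc N} = (\<Sum>k<Suc N. r k * g k)"
    if "r \<in> {..<Suc N} \<rightarrow> supported Z" for r
    using that by (intro finsum_lmod) (auto intro!: supported_Z_K_mult g)
  ultimately show ?thesis
    unfolding fin_gen_module_def using g by (intro exI[of _ "Suc N"] exI[of _ g]) fastforce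
qed

text \<open>Multiplying by a power of \<open>t\<close> that carries \<open>x\<close> into the ring
  reduces linearity to the value at 1.\<close>

lemma hom_K_Z:
  assumes "\<phi> \<in> module_homs (laurent_subring (supported Z)) (lmod (supported K)) (lmod (supported Z :: 'k::field fls set))"
    and x: "x \<in> supported K"
  shows "\<phi> x = \<phi> 1 * x"
proof -
  have smult: "\<phi> (a * y) = a * \<phi> y" if "a \<in> supported Z" "y \<in> supported K" for a y
    using assms(1) that by (auto simp: module_homs_def)
  obtain N where N: "N > F" "tpow N * x \<in> supported Z"
    using ex_tpow_times_in_Z[of "{()}" "\<lambda>_. x"] by (metis finite.intros insertI1 order_refl)
  have "tpow N * \<phi> x = \<phi> (tpow N * x * 1)"
    using smult[of "tpow N" x] x N(1) by (simp add: Z_above_F)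
  also have "\<dots> = tpow N * (\<phi> 1 * x)"
    using smult[of "tpow N * x" 1] N(2) K_zero by (simp add: mult_ac)
  finally show ?thesis by simp
qed

text \<open>Every homomorphism is multiplication by \<open>\<phi> 1\<close>, whose exponents
  \<open>b\<close> satisfy \<open>b + K \<subseteq> Z\<close> and so exceed \<open>F\<close>.
  Conversely, multiplication by \<open>f\<close> in the conductor maps into the ring and takes 1 to
  \<open>f\<close>.\<close>

lemma trace_ideal_K:
  assumes far: "\<And>b. (\<And>k. k \<in> K \<Longrightarrow> b + k \<in> Z) \<Longrightarrow> b > F"
  shows "trace_ideal (laurent_subring (supported Z)) (lmod (supported K)) = (supported {F<..} :: 'k::field fls set)"
proof -
  let ?R = "laurent_subring (supported Z) :: 'k fls ring"
  have hom: "\<phi> x \<in> supported {F<..}" if \<phi>: "\<phi> \<in> module_homs ?R (lmod (supported K)) (self_module ?R)"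
    and x: "x \<in> supported K" for \<phi> x
  proof -
    have \<phi>': "\<phi> \<in> module_homs ?R (lmod (supported K)) (lmod (supported Z))"
      using \<phi> by (simp only: self_module_laurent)
    have "\<phi> 1 \<in> supported {F<..}"
    proof (rule supportedI)
      fix b assume b: "\<phi> 1 $$ b \<noteq> 0"
      have "b + k \<in> Z" if "k \<in> K" for k
      proof -
        have "\<phi> (tpow k) \<in> supported Z" using \<phi>' that by (auto simp: module_homs_def)
        hence "\<phi> 1 * tpow k \<in> supported Z" using hom_K_Z[OF \<phi>', of "tpow k"] that by simp
        moreover have "(\<phi> 1 * tpow k) $$ (b + k) \<noteq> 0" using b by simp
        ultimately show ?thesis by (rule supportedD)
      qed
      hence "b > F" by (rule far)
      thus "b \<in> {F<..}" by simp
    qed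
    hence "\<phi> 1 * x \<in> supported {F<..}"
      using x by (rule supported_mult) (use K_nonneg in force)
    thus ?thesis using hom_K_Z[OF \<phi>' x] by simp
  qed
  have sub: "supported {F<..} \<subseteq> (supported Z :: 'k fls set)"
    using Z_above_F by (auto intro: supported_mono[rotated])
  have in_tr: "f \<in> trace_ideal ?R (lmod (supported K))" if f: "f \<in> supported {F<..}" for f
  proof -
    have "(\<lambda>x. f * x) \<in> module_homs ?R (lmod (supported K)) (lmod (supported Z))"
    proof -
      have "f * x \<in> supported Z" if "x \<in> supported K" for x
        by (rule supported_mult[OF f that]) (use K_nonneg in \<open>force intro: Z_above_F\<close>)
      thus ?thesis by (auto simp: module_homs_def algebra_simps)
    qed
    moreover have "f = finsum ?R (\<lambda>k. f * 1) {..<1::nat}"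
      using f sub by (subst finsum_Z) auto
    ultimately show ?thesis
      unfolding trace_ideal_def self_module_laurent
      using K_zero by (intro CollectI exI[of _ "1::nat"] exI[of _ "\<lambda>_ x. f * x"] exI[of _ "\<lambda>_. 1"]) simp
  qed
  show ?thesis
  proof (intro equalityI subsetI)
    fix f assume "f \<in> trace_ideal ?R (lmod (supported K))"
    then obtain m :: nat and \<phi> x where f: "f = finsum ?R (\<lambda>k. \<phi> k (x k)) {..<m}"
      and "\<phi> \<in> {..<m} \<rightarrow> module_homs ?R (lmod (supported K)) (self_module ?R)" "x \<in> {..<m} \<rightarrow> supported K"
      unfolding trace_ideal_def by auto
    hence *: "\<phi> k (x k) \<in> supported {F<..}" if "k < m" for k using that by (intro hom) auto
    hence "f = (\<Sum>k<m. \<phi> k (x k))" unfolding f using sub by (intro finsum_Z) auto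
    thus "f \<in> supported {F<..}" using * by (auto intro: supported_sum)
  qed (rule in_tr)
qed

end

context residue_resolution_loc begin

lemma canonical_module_K:
  "canonical_module 1 (laurent_subring (supported Z)) (lmod (supported K :: 'k fls set))"
  unfolding canonical_module_def
proof (intro conjI allI)
  fix p :: nat
  consider "p = 0" | "p = 1" | q where "p = Suc (Suc q)"
    by (metis One_nat_def not0_implies_Suc)
  thus "residue_ext_dim (laurent_subring (supported Z)) (lmod (supported K :: 'k fls set)) p (if p = 1 then 1 else 0)"
    using ext_0[OF Z_module_K] ext_1_of_socle_basis[OF Z_module_K socle_basis_K] ext_ge_2
    by cases auto
qed (fact module_lmod_K fin_gen_module_K)+

lemma far_flung_if:
  assumes "\<And>b. (\<And>k. k \<in> K \<Longrightarrow> b + k \<in> Z) \<Longrightarrow> b > F"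
  shows "far_flung_gorenstein laurent_field (supported Z :: 'k fls set)"
  unfolding far_flung_gorenstein_def colon_Z using canonical_module_K trace_ideal_K[OF assms] by blast

end

context numerical_semigroup_loc begin

text \<open>The second conclusion retains the resolution hidden in the type hypothesis; it is the
  one on which \<open>\<omega>\<close> is checked to be canonical.\<close>

lemma type_eq_card_PF:
  assumes "cohen_macaulay_type 1 (laurent_subring (supported Z :: 'k::field fls set)) d"
  shows "card (pseudo_frobenius H) = d"
    and "\<exists>n D. residue_resolution (laurent_subring (supported Z :: 'k fls set)) n D"
proof -
  obtain n D z where res: "residue_resolution (laurent_subring (supported Z :: 'k fls set)) n D"
    and z: "z \<in> {..<d} \<rightarrow> cocycles (lmod (supported Z :: 'k fls set)) n D 1"
      "\<forall>v\<in>cocycles (lmod (supported Z)) n D 1. \<exists>r\<in>{..<d} \<rightarrow> carrier (laurent_subring (supported Z)).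
      \<exists>b\<in>coboundaries (lmod (supported Z)) n D 1.
           \<forall>i<n 1. v i = tuple_comb (lmod (supported Z)) (n 1) d r z i \<oplus>\<^bsub>lmod (supported Z)\<^esub> b i"
      "\<forall>r\<in>{..<d} \<rightarrow> carrier (laurent_subring (supported Z)).
           tuple_comb (lmod (supported Z)) (n 1) d r z \<in> coboundaries (lmod (supported Z)) n D 1 \<longrightarrow>
             (\<forall>k<d. r k \<in> nonunits (laurent_subring (supported Z)))"
    using assms unfolding cohen_macaulay_type_def residue_ext_dim_def self_module_laurent by blast
  interpret residue_resolution_loc H n D by unfold_locales (rule res)
  obtain q :: "nat \<Rightarrow> 'k fls" where "socle_basis Z d q"
    using socle_basis_of_ext_1[OF Z_module_Z z] by blast
  thus "card (pseudo_frobenius H) = d"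
    using card_rel_pseudo_frobenius[OF Z_module_Z] finite_PF unfolding rel_pseudo_frobenius_Z by blast
  show "\<exists>n D. residue_resolution (laurent_subring (supported Z :: 'k fls set)) n D" using res by blast
qed

end

section \<open>Arbitrary canonical modules\<close>

context numerical_semigroup_loc begin

text \<open>As \<open>I\<close> contains every series of order at least \<open>M\<close>, only the
  finitely many monomials of \<open>u\<close> below \<open>M\<close> have to be treated.\<close>

lemma supported_subset_subspace:
  fixes I :: "'k::field fls set"
  assumes add: "\<And>x y. x \<in> I \<Longrightarrow> y \<in> I \<Longrightarrow> x + y \<in> I" and const: "\<And>c x. x \<in> I \<Longrightarrow> fls_const c * x \<in> I"
    and high: "supported {M..} \<subseteq> I" and mono: "\<And>j. j \<in> J \<Longrightarrow> tpow j \<in> I" and u: "u \<in> supported J"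
  shows "u \<in> I"
proof -
  define p where "p = (\<Sum>j\<in>{fls_subdegree u..<M}. fls_const (u $$ j) * tpow j)"
  have sum: "(\<Sum>j\<in>A. f j) \<in> I" if "finite A" "\<And>j. j \<in> A \<Longrightarrow> f j \<in> I" for f and A :: "int set"
    using that high by (induction A rule: finite_induct) (auto intro: add)
  have "fls_const (u $$ j) * tpow j \<in> I" for j
    using high mono[OF supportedD[OF u]] const[of "tpow j" "u $$ j"] by (cases "u $$ j = 0") auto
  hence "p \<in> I" unfolding p_def by (intro sum) simp_all
  have pn: "p $$ j = (if j \<in> {fls_subdegree u..<M} then u $$ j else 0)" for j
    by (simp add: p_def fls_nth_sum tpow_nth if_distrib[of "\<lambda>x. _ * x"] cong: if_cong)
  have "u - p \<in> supported {M..}"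
    by (rule supportedI) (auto simp: pn split: if_splits)
  hence "u - p \<in> I" using high by blast
  from add[OF \<open>p \<in> I\<close> this] show ?thesis by simp
qed

text \<open>With \<open>I\<close> the annihilator of an element modulo a submodule, this says that
  the socle is essential. The largest \<open>h\<close> in \<open>Z\<close> with
  \<open>tpow h\<close> outside \<open>I\<close> works, since every product with the maximal ideal
  has only larger exponents from \<open>Z\<close>.\<close>

lemma ex_socle_monomial:
  fixes I :: "'k::field fls set"
  assumes add: "\<And>x y. x \<in> I \<Longrightarrow> y \<in> I \<Longrightarrow> x + y \<in> I" and const: "\<And>c x. x \<in> I \<Longrightarrow> fls_const c * x \<in> I"
    and high: "supported {M..} \<subseteq> I" and one: "1 \<notin> I"
  obtains h where "h \<in> Z" "tpow h \<notin> I" "\<And>x. x \<in> supported (Z - {0}) \<Longrightarrow> x * tpow h \<in> I"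
proof -
  define A where "A = {h \<in> Z. (tpow h :: 'k fls) \<notin> I}"
  have "A \<subseteq> {0..M}"
  proof
    fix h assume h: "h \<in> A"
    hence "(tpow h :: 'k fls) \<notin> supported {M..}" using high unfolding A_def by blast
    thus "h \<in> {0..M}" using h Z_nonneg[of h] by (auto simp: A_def)
  qed
  hence fin: "finite A" by (rule finite_subset) simp
  have ne: "A \<noteq> {}" using one by (auto simp: A_def intro!: exI[of _ 0])
  define h where "h = Max A"
  have h: "h \<in> Z" "(tpow h :: 'k fls) \<notin> I" using Max_in[OF fin ne] by (auto simp: h_def A_def)
  have J: "tpow j \<in> I" if "j \<in> {j\<in>Z. j > h}" for j
  proof (rule ccontr)
    assume "tpow j \<notin> I"
    hence "j \<in> A" using that by (simp add: A_def)
    hence "j \<le> h" unfolding h_def using fin by (intro Max_ge)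
    thus False using that by simp
  qed
  have "x * tpow h \<in> I" if x: "x \<in> supported (Z - {0})" for x
  proof (rule supported_subset_subspace[OF add const high J])
    have "tpow h \<in> supported {h}" by simp
    thus "x * tpow h \<in> supported {j\<in>Z. j > h}"
      by (rule supported_mult[OF x]) (use h(1) Z_nonneg in \<open>force intro: Z_add\<close>)
  qed
  thus thesis using that h by blast
qed

text \<open>The annihilator of a nonzero torsion element contains all series of high order. A
  suitable monomial multiple of that element is then nonzero and killed by the maximal ideal, which
  is a nonzero class in degree 0.\<close>

lemma torsion_free_of_ext_0:
  fixes W :: "('k::field fls, 'm, 'c) module_scheme"
  assumes "module (laurent_subring (supported Z)) W" and ext: "residue_ext_dim (laurent_subring (supported Z)) W 0 0"
    and a: "a \<in> supported Z" "a \<noteq> 0" and w: "w \<in> carrier W" and aw: "a \<odot>\<^bsub>W\<^esub> w = \<zero>\<^bsub>W\<^esub>"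
  shows "w = \<zero>\<^bsub>W\<^esub>"
proof (rule ccontr)
  assume "w \<noteq> \<zero>\<^bsub>W\<^esub>"
  interpret W: module "laurent_subring (supported Z)" W by fact
  have smult_add: "(x + y) \<odot>\<^bsub>W\<^esub> v = x \<odot>\<^bsub>W\<^esub> v \<oplus>\<^bsub>W\<^esub> y \<odot>\<^bsub>W\<^esub> v"
    and smult_mult: "(x * y) \<odot>\<^bsub>W\<^esub> v = x \<odot>\<^bsub>W\<^esub> (y \<odot>\<^bsub>W\<^esub> v)"
    if "x \<in> supported Z" "y \<in> supported Z" "v \<in> carrier W" for x y v
    using W.smult_l_distr[of x y v] W.smult_assoc1[of x y v] that by simp_all
  define I where "I = {u \<in> supported Z. u \<odot>\<^bsub>W\<^esub> w = \<zero>\<^bsub>W\<^esub>}"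
  \<comment> \<open>The first bound puts a series \<open>u\<close> into the ring. The second does
    the same for \<open>u / a\<close>, so that \<open>u\<close> is a multiple of \<open>a\<close>
    and kills \<open>w\<close>.\<close>
  define M where "M = max (F + 1) (F + 1 + fls_subdegree a)"
  obtain h where h: "h \<in> Z" "tpow h \<notin> I" "\<And>x. x \<in> supported (Z - {0}) \<Longrightarrow> x * tpow h \<in> I"
  proof (rule ex_socle_monomial[of I M])
    show "x + y \<in> I" if "x \<in> I" "y \<in> I" for x y
      using that w smult_add[of x y w] by (auto simp: I_def intro: supported_add)
    show "fls_const c * x \<in> I" if "x \<in> I" for c x
      using that w smult_mult[of "fls_const c" x w] W.smult_r_null[of "fls_const c"]
      by (auto simp: I_def intro: supported_const_mult)
    show "supported {M..} \<subseteq> I"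
    proof
      fix u :: "'k fls" assume u: "u \<in> supported {M..}"
      have uZ: "u \<in> supported Z"
        by (rule supported_mono[OF _ u]) (auto simp: M_def intro: Z_above_F)
      have "inverse a \<in> supported {- fls_subdegree a..}"
        by (rule supportedI) (metis atLeast_iff fls_inverse_subdegree fls_subdegree_leI)
      with u have q: "u * inverse a \<in> supported Z"
        by (rule supported_mult) (auto simp: M_def intro!: Z_above_F)
      have "u \<odot>\<^bsub>W\<^esub> w = (u * inverse a * a) \<odot>\<^bsub>W\<^esub> w"
        by (simp only: mult.assoc left_inverse[OF a(2)] mult_1_right)
      also have "\<dots> = \<zero>\<^bsub>W\<^esub>" using smult_mult[OF q a(1) w] aw W.smult_r_null[of "u * inverse a"] q by simp
      finally show "u \<in> I" using uZ by (simp add: I_def)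
    qed
    show "1 \<notin> I" using W.smult_one[OF w] \<open>w \<noteq> _\<close> by (simp add: I_def)
  qed blast
  define y where "y = tpow h \<odot>\<^bsub>W\<^esub> w"
  have y: "y \<in> carrier W" "y \<noteq> \<zero>\<^bsub>W\<^esub>" using h(1,2) w W.smult_closed[of "tpow h" w] by (auto simp: y_def I_def)
  have my: "x \<odot>\<^bsub>W\<^esub> y = \<zero>\<^bsub>W\<^esub>" if x: "x \<in> supported (Z - {0})" for x
  proof -
    have "x \<in> supported Z" by (rule supported_mono[OF _ x]) blast
    thus ?thesis using h(1) h(3)[OF x] smult_mult[of x "tpow h" w] w by (simp add: y_def I_def)
  qed
  from ext obtain n D z where res: "residue_resolution (laurent_subring (supported Z :: 'k fls set)) n D"
    and span: "\<forall>v\<in>cocycles W n D 0. \<exists>r\<in>{..<0} \<rightarrow> carrier (laurent_subring (supported Z)). \<exists>b\<in>coboundaries W n D 0.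
           \<forall>i<n 0. v i = tuple_comb W (n 0) 0 r z i \<oplus>\<^bsub>W\<^esub> b i"
    unfolding residue_ext_dim_def by blast
  interpret residue_resolution_loc H n D by unfold_locales (rule res)
  define v where "v = (\<lambda>i\<in>{..<1::nat}. y)"
  have "v \<in> cocycles W n D 0"
    using y(1) my[OF gen_in] W.smult_closed[OF _ y(1)] gen_Z
    by (auto simp: cocycles_def v_def tuples_def n_0 coboundary_map_def zero_tuple_def gen_def lessThan_Suc
      intro!: restrict_ext)
  hence "v 0 = \<zero>\<^bsub>W\<^esub>"
    using span n_0 by (auto simp: tuple_comb_def zero_tuple_def)
  thus False using y by (simp add: v_def)
qed

end

section \<open>Torsion-free modules described by coordinates\<close>

locale presented_module = residue_resolution_loc H n D
  for H :: "nat set" and n :: "nat \<Rightarrow> nat" and D :: "nat \<Rightarrow> nat \<Rightarrow> nat \<Rightarrow> 'k::field fls" +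
  fixes W :: "('k fls, 'm, 'c) module_scheme" and m :: nat and g :: "nat \<Rightarrow> 'm"
  assumes W_module: "module (laurent_subring (supported Z)) W"
    and g_in: "k < m \<Longrightarrow> g k \<in> carrier W"
    and generate: "x \<in> carrier W \<Longrightarrow> \<exists>r. (\<forall>k<m. r k \<in> supported Z) \<and> x = (\<Oplus>\<^bsub>W\<^esub>k\<in>{..<m}. r k \<odot>\<^bsub>W\<^esub> g k)"
    and torsion_free: "a \<in> supported Z \<Longrightarrow> a \<noteq> 0 \<Longrightarrow> w \<in> carrier W \<Longrightarrow> a \<odot>\<^bsub>W\<^esub> w = \<zero>\<^bsub>W\<^esub> \<Longrightarrow> w = \<zero>\<^bsub>W\<^esub>"
begin

sublocale W: module "laurent_subring (supported Z)" W by (rule W_module)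

text \<open>Tuples are total functions of which only the first \<open>m\<close> coordinates, one per
  generator of \<open>W\<close>, count.\<close>

definition integral :: "(nat \<Rightarrow> 'k fls) \<Rightarrow> bool" where
  "integral s \<longleftrightarrow> (\<forall>k<m. s k \<in> supported Z)"

definition ev :: "(nat \<Rightarrow> 'k fls) \<Rightarrow> 'm" where
  "ev s = (\<Oplus>\<^bsub>W\<^esub>k\<in>{..<m}. s k \<odot>\<^bsub>W\<^esub> g k)"

lemma smult_in: "a \<in> supported Z \<Longrightarrow> w \<in> carrier W \<Longrightarrow> a \<odot>\<^bsub>W\<^esub> w \<in> carrier W"
  using W.smult_closed[of a w] by simp

lemma ev_in: "integral s \<Longrightarrow> ev s \<in> carrier W"
  unfolding ev_def integral_def by (intro W.finsum_closed) (auto intro: smult_in g_in)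

lemma ev_surj: "x \<in> carrier W \<Longrightarrow> \<exists>s. integral s \<and> x = ev s"
  using generate[of x] by (simp add: ev_def integral_def)

lemma ev_add:
  assumes "integral s" "integral t" shows "ev (\<lambda>l. s l + t l) = ev s \<oplus>\<^bsub>W\<^esub> ev t"
proof -
  have "ev (\<lambda>l. s l + t l) = (\<Oplus>\<^bsub>W\<^esub>k\<in>{..<m}. s k \<odot>\<^bsub>W\<^esub> g k \<oplus>\<^bsub>W\<^esub> t k \<odot>\<^bsub>W\<^esub> g k)"
    unfolding ev_def
  proof (rule W.finsum_cong')
    fix k assume "k \<in> {..<m}"
    thus "(s k + t k) \<odot>\<^bsub>W\<^esub> g k = s k \<odot>\<^bsub>W\<^esub> g k \<oplus>\<^bsub>W\<^esub> t k \<odot>\<^bsub>W\<^esub> g k"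
      using W.smult_l_distr[of "s k" "t k" "g k"] assms g_in by (simp add: integral_def)
  qed (use assms g_in smult_in in \<open>auto simp: integral_def\<close>)
  also have "\<dots> = ev s \<oplus>\<^bsub>W\<^esub> ev t"
    unfolding ev_def using assms g_in smult_in by (intro W.finsum_addf) (auto simp: integral_def)
  finally show ?thesis .
qed

lemma ev_smult:
  assumes "a \<in> supported Z" "integral s" shows "ev (\<lambda>l. a * s l) = a \<odot>\<^bsub>W\<^esub> ev s"
proof -
  have "a \<odot>\<^bsub>W\<^esub> ev s = (\<Oplus>\<^bsub>W\<^esub>k\<in>{..<m}. a \<odot>\<^bsub>W\<^esub> (s k \<odot>\<^bsub>W\<^esub> g k))"
    unfolding ev_def using assms g_in smult_in
    by (intro W.finsum_smult_ldistr) (auto simp: integral_def)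
  also have "\<dots> = ev (\<lambda>l. a * s l)"
    unfolding ev_def
  proof (rule W.finsum_cong'[symmetric])
    fix k assume "k \<in> {..<m}"
    thus "(a * s k) \<odot>\<^bsub>W\<^esub> g k = a \<odot>\<^bsub>W\<^esub> (s k \<odot>\<^bsub>W\<^esub> g k)"
      using W.smult_assoc1[of a "s k" "g k"] assms g_in by (simp add: integral_def)
  qed (use assms g_in smult_in in \<open>auto simp: integral_def\<close>)
  finally show ?thesis by simp
qed

lemma ev_zero: "ev (\<lambda>_. 0) = \<zero>\<^bsub>W\<^esub>"
  using ev_smult[of 0 "\<lambda>_. 0"] W.smult_l_null[OF ev_in, of "\<lambda>_. 0"] by (simp add: integral_def)

lemma integral_add: "integral s \<Longrightarrow> integral t \<Longrightarrow> integral (\<lambda>l. s l + t l)"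
  and integral_diff: "integral s \<Longrightarrow> integral t \<Longrightarrow> integral (\<lambda>l. s l - t l)"
  and integral_mult: "a \<in> supported Z \<Longrightarrow> integral s \<Longrightarrow> integral (\<lambda>l. a * s l)"
  and integral_zero: "integral (\<lambda>_. 0)"
  by (auto simp: integral_def intro: supported_add supported_diff supported_Z_mult)

lemma integral_sum: "(\<And>k. k \<in> A \<Longrightarrow> integral (s k)) \<Longrightarrow> integral (\<lambda>l. \<Sum>k\<in>A. s k l)"
  by (auto simp: integral_def intro: supported_sum)

lemma ev_diff_eq_0_iff:
  assumes "integral s" "integral t" shows "ev (\<lambda>l. s l - t l) = \<zero>\<^bsub>W\<^esub> \<longleftrightarrow> ev s = ev t"
proof -
  have "ev (\<lambda>l. s l - t l) \<oplus>\<^bsub>W\<^esub> ev t = ev s"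
    using ev_add[OF integral_diff[OF assms] assms(2)] by simp
  thus ?thesis using ev_in[OF assms(1)] ev_in[OF assms(2)] ev_in[OF integral_diff[OF assms]]
    by (metis W.add.l_cancel_one' W.add.r_cancel_one W.l_zero)
qed

lemma ev_comb:
  fixes d :: nat
  assumes "\<And>k. k < d \<Longrightarrow> y k \<in> supported Z" "\<And>k. k < d \<Longrightarrow> integral (s k)"
  shows "(\<Oplus>\<^bsub>W\<^esub>k\<in>{..<d}. y k \<odot>\<^bsub>W\<^esub> ev (s k)) = ev (\<lambda>l. \<Sum>k<d. y k * s k l)"
  using assms
proof (induction d)
  case 0
  thus ?case by (simp add: ev_zero)
next
  case (Suc d)
  have "(\<Oplus>\<^bsub>W\<^esub>k\<in>{..<Suc d}. y k \<odot>\<^bsub>W\<^esub> ev (s k)) =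
      y d \<odot>\<^bsub>W\<^esub> ev (s d) \<oplus>\<^bsub>W\<^esub> (\<Oplus>\<^bsub>W\<^esub>k\<in>{..<d}. y k \<odot>\<^bsub>W\<^esub> ev (s k))"
    unfolding lessThan_Suc using Suc.prems ev_in smult_in by (intro W.finsum_insert) auto
  also have "\<dots> = ev (\<lambda>l. y d * s d l) \<oplus>\<^bsub>W\<^esub> ev (\<lambda>l. \<Sum>k<d. y k * s k l)"
    using Suc by (simp add: ev_smult)
  also have "\<dots> = ev (\<lambda>l. y d * s d l + (\<Sum>k<d. y k * s k l))"
    using Suc.prems by (intro ev_add[symmetric] integral_mult integral_sum) auto
  finally show ?case by (simp add: add.commute)
qed

text \<open>The relations between the generators of \<open>W\<close> over the fraction field. Modulo these, \<open>lattice\<close> below is \<open>W\<close> inside \<open>W \<otimes> K((t))\<close>.\<close>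

definition rels :: "(nat \<Rightarrow> 'k fls) set" where
  "rels = {s. \<exists>a\<in>supported Z. a \<noteq> 0 \<and> integral (\<lambda>l. a * s l) \<and> ev (\<lambda>l. a * s l) = \<zero>\<^bsub>W\<^esub>}"

text \<open>Torsion-freeness cancels the denominator: on integral tuples a relation over the
  fraction field is already a relation in \<open>W\<close>.\<close>

lemma rels_integral_iff:
  assumes "integral s" shows "s \<in> rels \<longleftrightarrow> ev s = \<zero>\<^bsub>W\<^esub>"
proof
  assume "s \<in> rels"
  then obtain a where "a \<in> supported Z" "a \<noteq> 0" "ev (\<lambda>l. a * s l) = \<zero>\<^bsub>W\<^esub>"
    by (auto simp: rels_def)
  thus "ev s = \<zero>\<^bsub>W\<^esub>" using assms ev_smult[of a s] torsion_free[of a "ev s"] ev_in by simp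
next
  assume "ev s = \<zero>\<^bsub>W\<^esub>"
  thus "s \<in> rels" unfolding rels_def using assms by (intro CollectI bexI[of _ 1]) auto
qed

lemma rels_add:
  assumes "s \<in> rels" "t \<in> rels" shows "(\<lambda>l. s l + t l) \<in> rels"
proof -
  obtain a where a: "a \<in> supported Z" "a \<noteq> 0" "integral (\<lambda>l. a * s l)" "ev (\<lambda>l. a * s l) = \<zero>\<^bsub>W\<^esub>"
    using assms by (auto simp: rels_def)
  obtain b where b: "b \<in> supported Z" "b \<noteq> 0" "integral (\<lambda>l. b * t l)" "ev (\<lambda>l. b * t l) = \<zero>\<^bsub>W\<^esub>"
    using assms by (auto simp: rels_def)
  have eq: "(\<lambda>l. a * b * (s l + t l)) = (\<lambda>l. b * (a * s l) + a * (b * t l))"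
    by (simp add: algebra_simps)
  note ia = integral_mult[OF b(1) a(3)] and ib = integral_mult[OF a(1) b(3)]
  have "integral (\<lambda>l. a * b * (s l + t l))"
    unfolding eq by (rule integral_add[OF ia ib])
  moreover have "ev (\<lambda>l. a * b * (s l + t l)) = \<zero>\<^bsub>W\<^esub>"
  proof -
    have "ev (\<lambda>l. a * b * (s l + t l)) = b \<odot>\<^bsub>W\<^esub> \<zero>\<^bsub>W\<^esub> \<oplus>\<^bsub>W\<^esub> a \<odot>\<^bsub>W\<^esub> \<zero>\<^bsub>W\<^esub>"
      unfolding eq ev_add[OF ia ib] ev_smult[OF b(1) a(3)] ev_smult[OF a(1) b(3)] a(4) b(4) ..
    thus ?thesis using W.smult_r_null[of a] W.smult_r_null[of b] a b by simp
  qed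
  ultimately show ?thesis unfolding rels_def using a b
    by (intro CollectI bexI[of _ "a * b"] conjI supported_Z_mult) auto
qed

lemma rels_mult:
  assumes "s \<in> rels" shows "(\<lambda>l. q * s l) \<in> rels"
proof -
  obtain a where a: "a \<in> supported Z" "a \<noteq> 0" "integral (\<lambda>l. a * s l)" "ev (\<lambda>l. a * s l) = \<zero>\<^bsub>W\<^esub>"
    using assms by (auto simp: rels_def)
  obtain N where N: "N > F" "tpow N * q \<in> supported Z"
    using ex_tpow_times_in_Z[of "{()}" "\<lambda>_. q"] by (metis finite.intros insertI1 order_refl)
  have eq: "(\<lambda>l. tpow N * a * (q * s l)) = (\<lambda>l. tpow N * q * (a * s l))"
    by (simp add: mult_ac)
  have "ev (\<lambda>l. tpow N * a * (q * s l)) = \<zero>\<^bsub>W\<^esub>"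
    unfolding eq using ev_smult[OF N(2) a(3)] a(4) W.smult_r_null[of "tpow N * q"] N(2) by simp
  moreover have "integral (\<lambda>l. tpow N * a * (q * s l))"
    unfolding eq by (rule integral_mult[OF N(2) a(3)])
  ultimately show ?thesis unfolding rels_def using a N
    by (intro CollectI bexI[of _ "tpow N * a"] conjI supported_Z_mult) (auto intro: Z_above_F)
qed

lemma rels_zero: "(\<lambda>_. 0) \<in> rels"
  using rels_integral_iff[OF integral_zero] ev_zero by simp

lemma rels_diff: "s \<in> rels \<Longrightarrow> t \<in> rels \<Longrightarrow> (\<lambda>l. s l - t l) \<in> rels"
  using rels_add[of s "\<lambda>l. (-1) * t l"] rels_mult[of t "-1"] by simp

lemma rels_sum: "finite A \<Longrightarrow> (\<And>k. k \<in> A \<Longrightarrow> s k \<in> rels) \<Longrightarrow> (\<lambda>l. \<Sum>k\<in>A. s k l) \<in> rels"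
  by (induction A rule: finite_induct) (auto intro: rels_zero rels_add)

lemma rels_divide:
  assumes "(\<lambda>l. q * s l) \<in> rels" "q \<noteq> 0" shows "s \<in> rels"
proof -
  have "(\<lambda>l. inverse q * (q * s l)) = s" 
    by (simp only: mult.assoc[symmetric] left_inverse[OF assms(2)] mult_1_left)
  thus ?thesis using rels_mult[OF assms(1), of "inverse q"] by simp
qed

definition lattice :: "(nat \<Rightarrow> 'k fls) set" where
  "lattice = {x. \<exists>p\<in>rels. integral (\<lambda>l. x l - p l)}"

lemma lattice_of_rels: "p \<in> rels \<Longrightarrow> p \<in> lattice"
  unfolding lattice_def by (intro CollectI bexI[of _ p]) (simp_all add: integral_zero)

lemma lattice_of_integral: "integral x \<Longrightarrow> x \<in> lattice"
  unfolding lattice_def using rels_zero by (intro CollectI bexI[of _ "\<lambda>_. 0"]) simp_all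

lemma lattice_add:
  assumes "x \<in> lattice" "y \<in> lattice" shows "(\<lambda>l. x l + y l) \<in> lattice"
proof -
  obtain p where p: "p \<in> rels" "integral (\<lambda>l. x l - p l)" using assms(1) by (auto simp: lattice_def)
  obtain q where q: "q \<in> rels" "integral (\<lambda>l. y l - q l)" using assms(2) by (auto simp: lattice_def)
  have "(\<lambda>l. x l + y l - (p l + q l)) = (\<lambda>l. (x l - p l) + (y l - q l))" by auto
  hence "integral (\<lambda>l. x l + y l - (p l + q l))" using integral_add[OF p(2) q(2)] by simp
  thus ?thesis using rels_add[OF p(1) q(1)] unfolding lattice_def by (intro CollectI bexI)
qed

lemma lattice_mult:
  assumes "a \<in> supported Z" "x \<in> lattice" shows "(\<lambda>l. a * x l) \<in> lattice"
proof -
  obtain p where p: "p \<in> rels" "integral (\<lambda>l. x l - p l)" using assms(2) by (auto simp: lattice_def)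
  have "integral (\<lambda>l. a * x l - a * p l)" using integral_mult[OF assms(1) p(2)] by (simp add: right_diff_distrib)
  thus ?thesis using rels_mult[OF p(1), of a] unfolding lattice_def by (intro CollectI bexI)
qed

lemma lattice_sum: "finite A \<Longrightarrow> (\<And>k. k \<in> A \<Longrightarrow> s k \<in> lattice) \<Longrightarrow> (\<lambda>l. \<Sum>k\<in>A. s k l) \<in> lattice"
  by (induction A rule: finite_induct) (auto intro: lattice_of_integral integral_zero lattice_add)

lemma cocycle_iff_rels:
  assumes s': "\<forall>j<n 1. integral (s j)" and v: "v = (\<lambda>j\<in>{..<n 1}. ev (s j))"
  shows "v \<in> cocycles W n D 1 \<longleftrightarrow> (\<forall>i<n 2. (\<lambda>l. \<Sum>j<n 1. D 1 i j * s j l) \<in> rels)"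
proof -
  have s: "integral (s j)" if "j < n 1" for j using s' that by blast
  have D1: "D 1 i j \<in> supported Z" if "i < n 2" "j < n 1" for i j
    using D_in[of i 1 j] that by (simp add: numeral_2_eq_2)
  have "(\<Oplus>\<^bsub>W\<^esub>j\<in>{..<n 1}. D 1 i j \<odot>\<^bsub>W\<^esub> v j) = ev (\<lambda>l. \<Sum>j<n 1. D 1 i j * s j l)" if "i < n 2" for i
  proof -
    have "(\<Oplus>\<^bsub>W\<^esub>j\<in>{..<n 1}. D 1 i j \<odot>\<^bsub>W\<^esub> v j) = (\<Oplus>\<^bsub>W\<^esub>j\<in>{..<n 1}. D 1 i j \<odot>\<^bsub>W\<^esub> ev (s j))"
      using D1[OF that] s by (intro W.finsum_cong') (auto simp: v intro!: smult_in ev_in)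
    thus ?thesis using ev_comb[of "n 1" "D 1 i" s] D1[OF that] s by simp
  qed
  hence "coboundary_map W n D 1 v = zero_tuple W (n 2) \<longleftrightarrow> (\<forall>i<n 2. ev (\<lambda>l. \<Sum>j<n 1. D 1 i j * s j l) = \<zero>\<^bsub>W\<^esub>)"
    by (auto simp: coboundary_map_def zero_tuple_def restrict_eq_iff numeral_2_eq_2)
  also have "\<dots> \<longleftrightarrow> (\<forall>i<n 2. (\<lambda>l. \<Sum>j<n 1. D 1 i j * s j l) \<in> rels)"
  proof -
    have "integral (\<lambda>l. \<Sum>j<n 1. D 1 i j * s j l)" if "i < n 2" for i
      using D1[OF that] s by (intro integral_sum integral_mult) simp_all
    thus ?thesis by (simp add: rels_integral_iff del: One_nat_def)
  qed
  finally show ?thesis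
    using s by (auto simp: cocycles_def tuples_def v numeral_2_eq_2 intro: ev_in)
qed

text \<open>The Koszul syzygies lie in the image of the second differential. Conversely they suffice
  because \<open>rels\<close> is a subspace over K((t)), where a nonzero \<open>gen j0\<close> may
  be divided out.\<close>

lemma cocycle_iff_koszul:
  assumes s': "\<forall>j<n 1. integral (s j)" and v: "v = (\<lambda>j\<in>{..<n 1}. ev (s j))"
  shows "v \<in> cocycles W n D 1 \<longleftrightarrow>
    (\<forall>i<n 1. \<forall>j<n 1. (\<lambda>l. gen j * s i l - gen i * s j l) \<in> rels)"
  unfolding cocycle_iff_rels[OF s' v]
proof (intro iffI allI impI)
  fix i j assume *: "\<forall>i<n 2. (\<lambda>l. \<Sum>j<n 1. D 1 i j * s j l) \<in> rels" and ij: "i < n 1" "j < n 1"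
  define y where "y = (\<lambda>k. (if k = i then gen j else 0) - (if k = j then gen i else 0))"
  have yZ: "y k \<in> supported Z" if "k < n (Suc 0)" for k
    using ij gen_Z by (auto simp: y_def intro!: supported_diff)
  have y0: "(\<Sum>k<n (Suc 0). y k * D 0 k l) = 0" if "l < n 0" for l
    using ij that by (simp add: y_def n_0 gen_def[symmetric] left_diff_distrib sum_subtractf
        if_distrib[of "\<lambda>x. x * _"] cong: if_cong)
  obtain t where "\<And>k. k < n (Suc (Suc 0)) \<Longrightarrow> t k \<in> supported Z"
    and t: "\<And>k. k < n (Suc 0) \<Longrightarrow> y k = (\<Sum>p<n (Suc (Suc 0)). t p * D (Suc 0) p k)"
    by (rule exact[OF yZ y0]) (assumption | blast)+
  have "gen j * s i l - gen i * s j l = (\<Sum>p<n 2. t p * (\<Sum>k<n 1. D 1 p k * s k l))" for l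
  proof -
    have "gen j * s i l - gen i * s j l = (\<Sum>k<n 1. y k * s k l)"
      using ij by (simp add: y_def left_diff_distrib sum_subtractf if_distrib[of "\<lambda>x. x * _"] cong: if_cong)
    also have "\<dots> = (\<Sum>k<n 1. \<Sum>p<n 2. t p * (D 1 p k * s k l))"
      by (simp add: t sum_distrib_right mult.assoc numeral_2_eq_2)
    also have "\<dots> = (\<Sum>p<n 2. t p * (\<Sum>k<n 1. D 1 p k * s k l))"
      by (subst sum.swap) (simp add: sum_distrib_left)
    finally show ?thesis .
  qed
  moreover have "(\<lambda>l. \<Sum>p<n 2. t p * (\<Sum>k<n 1. D 1 p k * s k l)) \<in> rels"
    by (rule rels_sum) (use * in \<open>auto intro: rels_mult\<close>)
  ultimately show "(\<lambda>l. gen j * s i l - gen i * s j l) \<in> rels" by simp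
next
  fix i assume *: "\<forall>i<n 1. \<forall>j<n 1. (\<lambda>l. gen j * s i l - gen i * s j l) \<in> rels" and i: "i < n 2"
  obtain j0 where j0: "j0 < n 1" "gen j0 \<noteq> 0" by (rule gen_nonzero_ex)
  have "(\<Sum>j<n 1. D 1 i j * gen j) = 0"
    using complex[of i 0 0] i by (simp add: n_0 gen_def numeral_2_eq_2)
  \<comment> \<open>Subtracting the vanishing sum times \<open>s j0 l\<close> turns the expression
    into a combination of Koszul relations.\<close>
  hence "gen j0 * (\<Sum>j<n 1. D 1 i j * s j l) = gen j0 * (\<Sum>j<n 1. D 1 i j * s j l) - (\<Sum>j<n 1. D 1 i j * gen j) * s j0 l" for l
    by simp
  also have "\<dots> l = (\<Sum>j<n 1. D 1 i j * (gen j0 * s j l - gen j * s j0 l))" for l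
    by (simp add: sum_distrib_left sum_distrib_right right_diff_distrib sum_subtractf mult_ac)
  finally have eq: "gen j0 * (\<Sum>j<n 1. D 1 i j * s j l) = (\<Sum>j<n 1. D 1 i j * (gen j0 * s j l - gen j * s j0 l))" for l .
  have "(\<lambda>l. gen j0 * (\<Sum>j<n 1. D 1 i j * s j l)) \<in> rels"
    unfolding eq using * j0(1) by (intro rels_sum rels_mult) auto
  thus "(\<lambda>l. \<Sum>j<n 1. D 1 i j * s j l) \<in> rels" using j0(2) by (rule rels_divide)
qed

text \<open>\<open>u\<close> generates the socle of \<open>(W \<otimes> K((t)))/W\<close>, which is \<open>Ext\<^sup>1(k, W)\<close>.\<close>

lemma ex_socle_generator:
  assumes z: "z \<in> {..<1} \<rightarrow> cocycles W n D 1"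
    and span: "\<forall>v\<in>cocycles W n D 1. \<exists>r\<in>{..<1} \<rightarrow> carrier (laurent_subring (supported Z)). \<exists>b\<in>coboundaries W n D 1.
           \<forall>i<n 1. v i = tuple_comb W (n 1) 1 r z i \<oplus>\<^bsub>W\<^esub> b i"
    and ind: "\<forall>r\<in>{..<1} \<rightarrow> carrier (laurent_subring (supported Z)).
           tuple_comb W (n 1) 1 r z \<in> coboundaries W n D 1 \<longrightarrow> (\<forall>k<1. r k \<in> nonunits (laurent_subring (supported Z)))"
  obtains u where "u \<notin> lattice" "\<And>x. x \<in> supported (Z - {0}) \<Longrightarrow> (\<lambda>l. x * u l) \<in> lattice"
    "\<And>y. (\<And>x. x \<in> supported (Z - {0}) \<Longrightarrow> (\<lambda>l. x * y l) \<in> lattice) \<Longrightarrow>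
      \<exists>r\<in>supported Z. (\<lambda>l. y l - r * u l) \<in> lattice"
proof -
  have z0: "z 0 \<in> cocycles W n D 1" using z by auto
  hence z0_in: "z 0 \<in> {..<n 1} \<rightarrow>\<^sub>E carrier W" by (auto simp: cocycles_def tuples_def)
  have "\<forall>j<n 1. \<exists>s. integral s \<and> z 0 j = ev s" using z0_in ev_surj by blast
  then obtain s where s: "\<And>j. j < n 1 \<Longrightarrow> integral (s j)" "\<And>j. j < n 1 \<Longrightarrow> z 0 j = ev (s j)" by metis
  have z_eq: "z 0 = (\<lambda>j\<in>{..<n 1}. ev (s j))"
    using z0_in s(2) by (auto simp: PiE_def extensional_def fun_eq_iff)
  have s': "\<forall>j<n 1. integral (s j)" using s(1) by blast
  have koszul: "(\<lambda>l. gen j * s i l - gen i * s j l) \<in> rels" if "i < n 1" "j < n 1" for i j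
    using z0 that unfolding cocycle_iff_koszul[OF s' z_eq] by blast
  have comb: "tuple_comb W (n 1) 1 r z = (\<lambda>i\<in>{..<n 1}. r 0 \<odot>\<^bsub>W\<^esub> z 0 i)" if r: "r 0 \<in> supported Z" for r
    unfolding tuple_comb_def
  proof (rule restrict_ext)
    fix i assume "i \<in> {..<n 1}"
    hence "r 0 \<odot>\<^bsub>W\<^esub> z 0 i \<in> carrier W" using z0_in by (intro smult_in r) auto
    moreover have "{..<1::nat} = {0}" by auto
    ultimately show "(\<Oplus>\<^bsub>W\<^esub>k\<in>{..<1::nat}. r k \<odot>\<^bsub>W\<^esub> z k i) = r 0 \<odot>\<^bsub>W\<^esub> z 0 i"
      by simp
  qed
  have cob: "v \<in> coboundaries W n D 1 \<longleftrightarrow> (\<exists>w\<in>carrier W. v = (\<lambda>i\<in>{..<n 1}. gen i \<odot>\<^bsub>W\<^esub> w))" for v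
  proof -
    have map: "coboundary_map W n D 0 w = (\<lambda>i\<in>{..<n 1}. gen i \<odot>\<^bsub>W\<^esub> w 0)" if "w 0 \<in> carrier W" for w
      unfolding coboundary_map_def using smult_in[OF gen_Z that]
      by (auto simp: n_0 gen_def lessThan_Suc intro!: restrict_ext)
    show ?thesis
    proof
      assume "v \<in> coboundaries W n D 1"
      then obtain w where "w \<in> {..<n 0} \<rightarrow>\<^sub>E carrier W" "v = coboundary_map W n D 0 w" by (auto simp: tuples_def)
      thus "\<exists>w\<in>carrier W. v = (\<lambda>i\<in>{..<n 1}. gen i \<odot>\<^bsub>W\<^esub> w)"
        using map[of w] by (intro bexI[of _ "w 0"]) (auto simp: n_0)
    next
      assume "\<exists>w\<in>carrier W. v = (\<lambda>i\<in>{..<n 1}. gen i \<odot>\<^bsub>W\<^esub> w)"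
      then obtain w where w: "w \<in> carrier W" "v = (\<lambda>i\<in>{..<n 1}. gen i \<odot>\<^bsub>W\<^esub> w)" by blast
      have "v = coboundary_map W n D 0 (\<lambda>j\<in>{..<n 0}. w)" using map[of "\<lambda>j\<in>{..<n 0}. w"] w by (simp add: n_0)
      thus "v \<in> coboundaries W n D 1" using w by (auto simp: tuples_def)
    qed
  qed
  obtain j0 where j0: "j0 < n 1" "gen j0 \<noteq> 0" by (rule gen_nonzero_ex)
  \<comment> \<open>\<open>u\<close> plays the role of the quotient \<open>q\<close> in
    \<open>cocycles_1\<close>: modulo \<open>rels\<close>, every \<open>gen k * u\<close> is
    \<open>s k\<close>.\<close>
  define u where "u = (\<lambda>l. s j0 l / gen j0)"
  have ju: "gen j0 * u l = s j0 l" for l using j0(2) by (simp add: u_def)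
  have gu: "(\<lambda>l. gen k * u l - s k l) \<in> rels" if "k < n 1" for k
  proof (rule rels_divide[OF _ j0(2)])
    have "(\<lambda>l. gen j0 * (gen k * u l - s k l)) = (\<lambda>l. gen k * s j0 l - gen j0 * s k l)"
      unfolding ju[symmetric] by (simp add: algebra_simps)
    thus "(\<lambda>l. gen j0 * (gen k * u l - s k l)) \<in> rels" using koszul[OF j0(1) that] by simp
  qed
  show thesis
  proof (rule that)
    show "u \<notin> lattice"
    proof
      assume "u \<in> lattice"
      then obtain p where p: "p \<in> rels" "integral (\<lambda>l. u l - p l)" by (auto simp: lattice_def)
      define t where "t = (\<lambda>l. u l - p l)"
      have t: "integral t" using p(2) by (simp add: t_def)
      have "z 0 k = gen k \<odot>\<^bsub>W\<^esub> ev t" if "k < n 1" for k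
      proof -
        have "(\<lambda>l. gen k * t l - s k l) = (\<lambda>l. (gen k * u l - s k l) - gen k * p l)"
          by (simp add: t_def algebra_simps)
        hence "(\<lambda>l. gen k * t l - s k l) \<in> rels" using rels_diff[OF gu[OF that] rels_mult[OF p(1)]] by simp
        moreover have int: "integral (\<lambda>l. gen k * t l)" by (rule integral_mult[OF gen_Z[OF that] t])
        ultimately have "ev (\<lambda>l. gen k * t l) = ev (s k)"
          using rels_integral_iff[OF integral_diff[OF int s(1)[OF that]]] ev_diff_eq_0_iff[OF int s(1)[OF that]] by blast
        thus ?thesis using ev_smult[OF gen_Z[OF that] t] s(2)[OF that] by simp
      qed
      hence "tuple_comb W (n 1) 1 (\<lambda>_. 1) z = (\<lambda>i\<in>{..<n 1}. gen i \<odot>\<^bsub>W\<^esub> ev t)"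
        using smult_in[OF gen_Z ev_in[OF t]] W.smult_one
        by (subst comb) (auto intro!: restrict_ext)
      hence "tuple_comb W (n 1) 1 (\<lambda>_. 1) z \<in> coboundaries W n D 1"
        unfolding cob using ev_in[OF t] by blast
      \<comment> \<open>If \<open>u\<close> were in the lattice, the basis cocycle itself, with
        coefficient 1, would be a coboundary.\<close>
      hence "(1 :: 'k fls) \<in> nonunits (laurent_subring (supported Z))" 
        using ind[rule_format, of "\<lambda>_. 1" 0] by simp
      thus False by (simp add: nonunits_Z)
    qed
    show "(\<lambda>l. x * u l) \<in> lattice" if x: "x \<in> supported (Z - {0})" for x
    proof -
      obtain y where y: "\<And>i. i < n 1 \<Longrightarrow> y i \<in> supported Z" "x = (\<Sum>i<n 1. y i * gen i)"
        using gen_obtain[OF x] by blast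
      have gl: "(\<lambda>l. gen i * u l) \<in> lattice" if "i < n 1" for i
        using lattice_add[OF lattice_of_rels[OF gu[OF that]] lattice_of_integral[OF s(1)[OF that]]] by simp
      have "(\<lambda>l. x * u l) = (\<lambda>l. \<Sum>i<n 1. y i * (gen i * u l))"
        unfolding y(2) by (simp add: sum_distrib_right mult.assoc)
      also have "\<dots> \<in> lattice" by (rule lattice_sum) (simp_all add: lattice_mult[OF y(1) gl])
      finally show ?thesis .
    qed
    fix y assume y: "\<And>x. x \<in> supported (Z - {0}) \<Longrightarrow> (\<lambda>l. x * y l) \<in> lattice"
    have "\<forall>j<n 1. \<exists>p\<in>rels. integral (\<lambda>l. gen j * y l - p l)"
      using y[OF gen_in] by (auto simp: lattice_def)
    then obtain p where p: "\<And>j. j < n 1 \<Longrightarrow> p j \<in> rels" "\<And>j. j < n 1 \<Longrightarrow> integral (\<lambda>l. gen j * y l - p j l)"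
      by metis
    define t where "t = (\<lambda>j l. gen j * y l - p j l)"
    have t: "integral (t j)" if "j < n 1" for j using p(2)[OF that] by (simp add: t_def)
    have "(\<lambda>l. gen j * t i l - gen i * t j l) \<in> rels" if "i < n 1" "j < n 1" for i j
    proof -
      have "(\<lambda>l. gen j * t i l - gen i * t j l) = (\<lambda>l. gen i * p j l - gen j * p i l)"
        by (simp add: t_def algebra_simps)
      thus ?thesis using rels_diff[OF rels_mult[OF p(1)] rels_mult[OF p(1)]] that by simp
    qed
    hence "(\<lambda>j\<in>{..<n 1}. ev (t j)) \<in> cocycles W n D 1"
      using cocycle_iff_koszul[of t, OF _ refl] t by blast
    then obtain r b where r: "r \<in> {..<1} \<rightarrow> carrier (laurent_subring (supported Z))" and b: "b \<in> coboundaries W n D 1"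
      and eq: "\<forall>i<n 1. (\<lambda>j\<in>{..<n 1}. ev (t j)) i = tuple_comb W (n 1) 1 r z i \<oplus>\<^bsub>W\<^esub> b i"
      using span by blast
    have r0: "r 0 \<in> supported Z" using r by auto
    obtain w where w: "w \<in> carrier W" "b = (\<lambda>i\<in>{..<n 1}. gen i \<odot>\<^bsub>W\<^esub> w)" using b unfolding cob by blast
    obtain q where q: "integral q" "w = ev q" using ev_surj[OF w(1)] by blast
    have gen0: "gen j0 \<in> supported Z" by (rule gen_Z[OF j0(1)])
    have "ev (t j0) = r 0 \<odot>\<^bsub>W\<^esub> ev (s j0) \<oplus>\<^bsub>W\<^esub> gen j0 \<odot>\<^bsub>W\<^esub> ev q"
      using eq[rule_format, OF j0(1)] j0(1) s(2)[OF j0(1)] unfolding comb[of r, OF r0] w(2) q(2) by simp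
    also have "\<dots> = ev (\<lambda>l. r 0 * s j0 l + gen j0 * q l)"
      using r0 s(1)[OF j0(1)] gen0 q(1) by (simp add: ev_smult ev_add integral_mult)
    finally have "(\<lambda>l. t j0 l - (r 0 * s j0 l + gen j0 * q l)) \<in> rels"
      using r0 s(1)[OF j0(1)] gen0 q(1) t[OF j0(1)]
      by (simp add: rels_integral_iff integral_diff integral_add integral_mult ev_diff_eq_0_iff)
    \<comment> \<open>Adding \<open>p j0\<close> turns \<open>t j0\<close> back into
      \<open>gen j0 * y\<close>, and \<open>gen j0\<close> factors out of the whole
      relation.\<close>
    hence "(\<lambda>l. t j0 l - (r 0 * s j0 l + gen j0 * q l) + p j0 l) \<in> rels"
      using p(1)[OF j0(1)] by (rule rels_add)
    moreover have "t j0 l - (r 0 * s j0 l + gen j0 * q l) + p j0 l = gen j0 * (y l - r 0 * u l - q l)" for l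
      by (simp add: t_def algebra_simps flip: ju)
    ultimately have "(\<lambda>l. gen j0 * (y l - r 0 * u l - q l)) \<in> rels" by simp
    hence "(\<lambda>l. y l - r 0 * u l - q l) \<in> rels" using j0(2) by (rule rels_divide)
    hence "(\<lambda>l. (y l - r 0 * u l - q l) + q l) \<in> lattice"
      using q(1) by (intro lattice_add lattice_of_rels lattice_of_integral)
    thus "\<exists>r\<in>supported Z. (\<lambda>l. y l - r * u l) \<in> lattice" using r0 by (intro bexI[of _ "r 0"]) simp_all
  qed
qed

text \<open>A functional with value \<open>1\<close> at \<open>u\<close> that vanishes on the lattice is represented by a map \<open>\<Phi>\<close> to \<open>K((t))\<close>. As the socle is essential and generated by \<open>u\<close>, the preimage of \<open>\<omega>\<close> under \<open>\<Phi>\<close> is the lattice, so \<open>1\<close> is attained on \<open>W\<close>.\<close>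

lemma ex_hom_to_K:
  assumes u: "u \<notin> lattice" and mu: "\<And>x. x \<in> supported (Z - {0}) \<Longrightarrow> (\<lambda>l. x * u l) \<in> lattice"
    and socle: "\<And>y. (\<And>x. x \<in> supported (Z - {0}) \<Longrightarrow> (\<lambda>l. x * y l) \<in> lattice) \<Longrightarrow>
      \<exists>r\<in>supported Z. (\<lambda>l. y l - r * u l) \<in> lattice"
  obtains w t where "\<And>l. l < m \<Longrightarrow> w l \<in> supported K" "\<And>p. p \<in> rels \<Longrightarrow> (\<Sum>l<m. p l * w l) = 0"
    "integral t" "(\<Sum>l<m. t l * w l) = 1"
proof -
  interpret fls_tuples: vector_space "\<lambda>(c :: 'k) (x :: nat \<Rightarrow> 'k fls) i. fls_const c * x i"
    by (rule vector_space_fls_tuples)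
  have lat_const: "(\<lambda>l. fls_const c * x l) \<in> lattice" if "x \<in> lattice" for c x
    using that by (intro lattice_mult) simp_all
  \<comment> \<open>The functional takes \<open>c * u\<close> plus a lattice element to
    \<open>c\<close>. It is well defined because no nonzero constant multiple of \<open>u\<close>
    lies in the lattice.\<close>
  define G where "G = {(x, c). (\<lambda>l. x l - fls_const c * u l) \<in> lattice}"
  have G_0: "(0, 0) \<in> G" by (simp add: G_def lattice_of_integral integral_zero)
  have G_add: "(x + y, a + b) \<in> G" if "(x, a) \<in> G" "(y, b) \<in> G" for x y a b
  proof -
    have "(\<lambda>l. (x l - fls_const a * u l) + (y l - fls_const b * u l)) \<in> lattice"
      using that by (intro lattice_add) (simp_all add: G_def)
    moreover have "(x l - fls_const a * u l) + (y l - fls_const b * u l) = x l + y l - fls_const (a + b) * u l" for l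
      by (simp add: algebra_simps flip: fls_plus_const)
    ultimately show ?thesis by (simp add: G_def)
  qed
  have G_scale: "((\<lambda>l. fls_const c * x l), c * a) \<in> G" if "(x, a) \<in> G" for c x a
  proof -
    have "(\<lambda>l. fls_const c * (x l - fls_const a * u l)) \<in> lattice"
      using that by (intro lat_const) (simp add: G_def)
    moreover have "fls_const c * (x l - fls_const a * u l) = fls_const c * x l - fls_const (c * a) * u l" for l
      by (simp add: right_diff_distrib mult.assoc flip: fls_const_mult_const)
    ultimately show ?thesis by (simp add: G_def)
  qed
  have G_fun: "c = 0" if "(0, c) \<in> G" for c
  proof (rule ccontr)
    assume "c \<noteq> 0"
    have "(\<lambda>l. - (fls_const c * u l)) \<in> lattice" using that by (simp add: G_def)
    hence "(\<lambda>l. fls_const (- inverse c) * - (fls_const c * u l)) \<in> lattice" by (rule lat_const)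
    moreover have "fls_const (- inverse c) * - (fls_const c * u l) = u l" for l
    proof -
      have "fls_const (- inverse c) * - (fls_const c * u l) = fls_const (inverse c * c) * u l"
        by (simp add: mult.assoc flip: fls_const_mult_const)
      thus ?thesis using \<open>c \<noteq> 0\<close> by simp
    qed
    ultimately have "u \<in> lattice" by (simp only:)
    thus False using u by blast
  qed
  obtain \<Lambda> where \<Lambda>_add: "\<And>x y. \<Lambda> (x + y) = \<Lambda> x + \<Lambda> y"
    and \<Lambda>_scale: "\<And>c x. \<Lambda> (\<lambda>i. fls_const c * x i) = c * \<Lambda> x"
    and \<Lambda>_G: "\<And>z c. (z, c) \<in> G \<Longrightarrow> \<Lambda> z = c"
    by (rule fls_tuples.ex_linear_functional[OF G_0 G_add G_scale G_fun]) (assumption | blast)+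
  have \<Lambda>_lattice: "\<Lambda> x = 0" if "x \<in> lattice" for x
    using that by (intro \<Lambda>_G) (simp add: G_def)
  have \<Lambda>_u: "\<Lambda> u = 1"
    by (intro \<Lambda>_G) (simp add: G_def lattice_of_integral integral_zero)
  define unit where "unit l q = (\<lambda>i. if i = l then q else (0 :: 'k fls))" for l :: nat and q
  have "\<exists>w\<in>supported K. \<forall>q. \<Lambda> (unit l q) = (q * w) $$ F" for l
  proof (rule ex_functional_representative[of "\<lambda>q. \<Lambda> (unit l q)"])
    have "unit l (x + y) = unit l x + unit l y" for x y
      by (auto simp: unit_def)
    thus "\<Lambda> (unit l (x + y)) = \<Lambda> (unit l x) + \<Lambda> (unit l y)" for x y
      by (simp add: \<Lambda>_add)
    have "unit l (fls_const c * x) = (\<lambda>i. fls_const c * unit l x i)" for c x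
      by (auto simp: unit_def)
    thus "\<Lambda> (unit l (fls_const c * x)) = c * \<Lambda> (unit l x)" for c x
      by (simp add: \<Lambda>_scale)
    show "\<Lambda> (unit l x) = 0" if "x \<in> supported Z" for x
      using that by (intro \<Lambda>_lattice lattice_of_integral) (simp add: unit_def integral_def)
  qed blast
  then obtain w where w: "\<And>l. w l \<in> supported K" "\<And>l q. \<Lambda> (unit l q) = (q * w l) $$ F" by metis
  define \<Phi> where "\<Phi> x = (\<Sum>l<m. x l * w l)" for x
  have \<Phi>_mult: "\<Phi> (\<lambda>l. q * x l) = q * \<Phi> x" for q x
    by (simp add: \<Phi>_def sum_distrib_left mult.assoc)
  have \<Lambda>_sum: "\<Lambda> (\<Sum>l\<in>I. f l) = (\<Sum>l\<in>I. \<Lambda> (f l))" if "finite I" for f and I :: "nat set"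
    using that \<Lambda>_scale[of 0 0] by (induction I rule: finite_induct) (auto simp: \<Lambda>_add zero_fun_def)
  have \<Lambda>_eq: "\<Lambda> x = \<Phi> x $$ F" for x
  proof -
    define x' where "x' = (\<Sum>l<m. unit l (x l))"
    have x': "x' i = (if i < m then x i else 0)" for i
    proof -
      have "(\<Sum>l\<in>I. f l) j = (\<Sum>l\<in>I. f l j)" for f :: "nat \<Rightarrow> nat \<Rightarrow> 'k fls" and I j
        by (induction I rule: infinite_finite_induct) auto
      thus ?thesis by (simp add: x'_def unit_def)
    qed
    have "\<Lambda> (\<lambda>i. x i - x' i) = 0"
      by (intro \<Lambda>_lattice lattice_of_integral) (simp add: integral_def x')
    moreover have "x = x' + (\<lambda>i. x i - x' i)" by auto
    ultimately have "\<Lambda> x = \<Lambda> x'" using \<Lambda>_add[of x' "\<lambda>i. x i - x' i"] by simp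
    also have "\<dots> = \<Phi> x $$ F" by (simp add: x'_def \<Lambda>_sum w(2) \<Phi>_def fls_nth_sum)
    finally show ?thesis .
  qed
  have \<Phi>_rels: "\<Phi> p = 0" if "p \<in> rels" for p
  proof (rule eq_if_F_coeffs_eq)
    fix q
    have "\<Lambda> (\<lambda>l. q * p l) = 0" using rels_mult[OF that] by (intro \<Lambda>_lattice lattice_of_rels)
    thus "(q * \<Phi> p) $$ F = (q * 0) $$ F" unfolding \<Lambda>_eq \<Phi>_mult by simp
  qed
  have "\<Phi> u \<noteq> 0" using \<Lambda>_eq[of u] \<Lambda>_u by auto
  \<comment> \<open>A multiple of \<open>u\<close> over K((t)) normalised to value 1 under
    \<open>\<Phi>\<close>; what remains is to see that it lies in the lattice.\<close>
  define x where "x = (\<lambda>l. inverse (\<Phi> u) * u l)"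
  have \<Phi>x: "\<Phi> x = 1" unfolding x_def \<Phi>_mult using \<open>\<Phi> u \<noteq> 0\<close> by (rule left_inverse)
  have "x \<in> lattice"
  proof (rule ccontr)
    assume "x \<notin> lattice"
    define I where "I = {a. (\<lambda>l. a * x l) \<in> lattice}"
    obtain N where "N > F" and N: "\<And>i M. i \<in> {..<m} \<Longrightarrow> M \<ge> N \<Longrightarrow> tpow M * x i \<in> supported Z"
      by (rule ex_tpow_times_in_Z[OF finite_lessThan, of m x]) (assumption | blast)+
    \<comment> \<open>From a series of order at least \<open>M\<close> a factor
      \<open>tpow N\<close>, which clears the denominators of \<open>x\<close>, can be split off
      with a cofactor of order above \<open>F\<close>.\<close>
    define M where "M = F + 1 + N"
    obtain h where h: "h \<in> Z" "tpow h \<notin> I" "\<And>y. y \<in> supported (Z - {0}) \<Longrightarrow> y * tpow h \<in> I"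
    proof (rule ex_socle_monomial[of I M])
      show "a + b \<in> I" if "a \<in> I" "b \<in> I" for a b
        using that lattice_add[of "\<lambda>l. a * x l" "\<lambda>l. b * x l"] by (simp add: I_def distrib_right)
      show "fls_const c * a \<in> I" if "a \<in> I" for c a
        using that lat_const[of "\<lambda>l. a * x l" c] by (simp add: I_def mult.assoc)
      show "supported {M..} \<subseteq> I"
      proof
        fix a :: "'k fls" assume a: "a \<in> supported {M..}"
        have b: "tpow (- N) * a \<in> supported Z"
          unfolding tpow_times_supported_iff
          using supportedD[OF a] by (fastforce simp: M_def intro: Z_above_F)
        have eq: "a * x i = (tpow (- N) * a) * (tpow N * x i)" for i
        proof -
          have "(tpow (- N) * a) * (tpow N * x i) = (tpow (- N) * tpow N) * (a * x i)" by (simp only: mult_ac)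
          thus ?thesis by (simp add: tpow_mult)
        qed
        have "integral (\<lambda>i. tpow N * x i)" unfolding integral_def using N[of _ N] by simp
        hence "integral (\<lambda>i. a * x i)" unfolding eq by (rule integral_mult[OF b])
        thus "a \<in> I" unfolding I_def by (intro CollectI lattice_of_integral)
      qed
      show "1 \<notin> I" using \<open>x \<notin> lattice\<close> by (simp add: I_def)
    qed blast
    define y where "y = (\<lambda>l. tpow h * x l)"
    have y: "y \<notin> lattice" using h(2) by (simp add: I_def y_def)
    have "\<exists>r\<in>supported Z. (\<lambda>l. y l - r * u l) \<in> lattice"
    proof (rule socle)
      show "(\<lambda>l. a * y l) \<in> lattice" if "a \<in> supported (Z - {0})" for a
        using h(3)[OF that] by (simp add: I_def y_def mult.assoc)
    qed
    then obtain r where r: "r \<in> supported Z" "(\<lambda>l. y l - r * u l) \<in> lattice" by blast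
    \<comment> \<open>The maximal ideal multiplies \<open>u\<close> into the lattice, so
      \<open>r\<close> may be replaced by its constant term, which is
      \<open>\<Lambda> y\<close>.\<close>
    have "r - fls_const (r $$ 0) \<in> supported (Z - {0})"
      using r(1) by (intro supportedI) (auto split: if_splits dest: supportedD)
    hence "(\<lambda>l. (y l - r * u l) + (r - fls_const (r $$ 0)) * u l) \<in> lattice"
      by (intro lattice_add r(2) mu)
    hence lat: "(\<lambda>l. y l - fls_const (r $$ 0) * u l) \<in> lattice" by (simp add: algebra_simps)
    hence "\<Lambda> y = r $$ 0" by (intro \<Lambda>_G) (simp add: G_def)
    \<comment> \<open>\<open>\<Lambda> y\<close> is the coefficient of \<open>tpow h\<close> at
      \<open>F\<close>, and \<open>F\<close> is not in \<open>Z\<close> while \<open>h\<close>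
      is.\<close>
    moreover have "h \<noteq> F" using h(1) F_notin by blast
    hence "\<Lambda> y = 0" unfolding \<Lambda>_eq y_def \<Phi>_mult \<Phi>x by (simp add: tpow_nth)
    ultimately have "r $$ 0 = 0" by simp
    thus False using lat y by simp
  qed
  then obtain p where p: "p \<in> rels" "integral (\<lambda>l. x l - p l)" by (auto simp: lattice_def)
  have "\<Phi> (\<lambda>l. x l - p l) = \<Phi> x - \<Phi> p" by (simp add: \<Phi>_def left_diff_distrib sum_subtractf)
  hence "\<Phi> (\<lambda>l. x l - p l) = 1" using \<Phi>x \<Phi>_rels[OF p(1)] by simp
  thus thesis using that[of w "\<lambda>l. x l - p l"] w(1) \<Phi>_rels p(2) unfolding \<Phi>_def by blast
qed

text \<open>\<open>\<Phi>\<close> kills the relations and hence descends to a map from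
  \<open>W\<close> to \<open>\<omega>\<close>. Multiplying by \<open>tpow b\<close> takes its values
  into the ring, and \<open>ev t\<close> goes to \<open>tpow b\<close>.\<close>

lemma tpow_in_trace_ideal:
  assumes w: "\<And>l. l < m \<Longrightarrow> w l \<in> supported K" "\<And>p. p \<in> rels \<Longrightarrow> (\<Sum>l<m. p l * w l) = 0"
    and t: "integral t" "(\<Sum>l<m. t l * w l) = 1" and b: "\<And>k. k \<in> K \<Longrightarrow> b + k \<in> Z"
  shows "tpow b \<in> trace_ideal (laurent_subring (supported Z)) W"
proof -
  let ?R = "laurent_subring (supported Z) :: 'k fls ring"
  define \<Phi> where "\<Phi> x = (\<Sum>l<m. x l * w l)" for x
  define \<psi> where "\<psi> v = tpow b * \<Phi> (SOME s. integral s \<and> v = ev s)" for v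
  have \<psi>_ev: "\<psi> (ev s) = tpow b * \<Phi> s" if s: "integral s" for s
  proof -
    define s' where "s' = (SOME s'. integral s' \<and> ev s = ev s')"
    have s': "integral s'" "ev s = ev s'"
      unfolding s'_def using someI[of "\<lambda>s'. integral s' \<and> ev s = ev s'" s] s by auto
    have "(\<lambda>l. s' l - s l) \<in> rels"
      using rels_integral_iff[OF integral_diff[OF s'(1) s]] ev_diff_eq_0_iff[OF s'(1) s] s'(2) by simp
    hence "(\<Sum>l<m. (s' l - s l) * w l) = 0" by (rule w(2))
    hence "\<Phi> s' = \<Phi> s" by (simp add: \<Phi>_def left_diff_distrib sum_subtractf)
    thus ?thesis by (simp add: \<psi>_def s'_def)
  qed
  have \<Phi>_K: "\<Phi> s \<in> supported K" if "integral s" for s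
    unfolding \<Phi>_def using that w(1) by (intro supported_sum supported_Z_K_mult) (auto simp: integral_def)
  have \<Phi>_add: "\<Phi> (\<lambda>l. s l + s' l) = \<Phi> s + \<Phi> s'" and \<Phi>_mult: "\<Phi> (\<lambda>l. a * s l) = a * \<Phi> s" for s s' a
    by (simp_all add: \<Phi>_def distrib_right sum.distrib sum_distrib_left mult.assoc)
  have "\<psi> \<in> module_homs ?R W (lmod (supported Z))"
    unfolding module_homs_def
  proof (intro CollectI conjI ballI funcsetI)
    fix v assume "v \<in> carrier W"
    then obtain s where s: "integral s" "v = ev s" using ev_surj by blast
    have "tpow b * \<Phi> s \<in> supported Z"
      by (rule supported_mult[of _ "{b}", OF _ \<Phi>_K[OF s(1)]]) (auto simp: b)
    thus "\<psi> v \<in> carrier (lmod (supported Z))" using \<psi>_ev[OF s(1)] s(2) by simp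
    {
      fix v' assume "v' \<in> carrier W"
      then obtain s' where s': "integral s'" "v' = ev s'" using ev_surj by blast
      have "v \<oplus>\<^bsub>W\<^esub> v' = ev (\<lambda>l. s l + s' l)" using ev_add[OF s(1) s'(1)] s s' by simp
      thus "\<psi> (v \<oplus>\<^bsub>W\<^esub> v') = \<psi> v \<oplus>\<^bsub>lmod (supported Z)\<^esub> \<psi> v'"
        using s s' \<psi>_ev integral_add[OF s(1) s'(1)] by (simp add: \<Phi>_add distrib_left)
    }
    fix a assume "a \<in> carrier ?R"
    hence a: "a \<in> supported Z" by simp
    have "a \<odot>\<^bsub>W\<^esub> v = ev (\<lambda>l. a * s l)" using ev_smult[OF a s(1)] s(2) by simp
    thus "\<psi> (a \<odot>\<^bsub>W\<^esub> v) = a \<odot>\<^bsub>lmod (supported Z)\<^esub> \<psi> v"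
      using s \<psi>_ev integral_mult[OF a s(1)] by (simp add: \<Phi>_mult mult_ac)
  qed
  moreover have "\<psi> (ev t) = tpow b" using \<psi>_ev[OF t(1)] t(2) by (simp add: \<Phi>_def)
  moreover have "tpow b \<in> supported Z" using b[OF K_zero] by simp
  hence "tpow b = finsum ?R (\<lambda>k. tpow b) {..<1::nat}" by (subst finsum_Z) auto
  ultimately show ?thesis
    unfolding trace_ideal_def self_module_laurent using ev_in[OF t(1)]
    by (intro CollectI exI[of _ "1::nat"] exI[of _ "\<lambda>_. \<psi>"] exI[of _ "\<lambda>_. ev t"]) simp
qed

end

section \<open>Far-flung Gorenstein as a condition on the semigroup\<close>

context numerical_semigroup_loc begin

lemma tpow_in_trace_of_canonical_module:
  fixes W :: "('k::field fls, 'm, 'c) module_scheme"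
  assumes can: "canonical_module 1 (laurent_subring (supported Z)) W" and b: "\<And>k. k \<in> K \<Longrightarrow> b + k \<in> Z"
  shows "tpow b \<in> trace_ideal (laurent_subring (supported Z)) W"
proof -
  let ?R = "laurent_subring (supported Z) :: 'k fls ring"
  have W: "module ?R W" "residue_ext_dim ?R W 0 0" "residue_ext_dim ?R W 1 1" "fin_gen_module ?R W"
    using can by (auto simp: canonical_module_def dest: spec[of _ 0] spec[of _ 1])
  obtain n D z where res: "residue_resolution ?R n D"
    and z: "z \<in> {..<1} \<rightarrow> cocycles W n D 1"
      "\<forall>v\<in>cocycles W n D 1. \<exists>r\<in>{..<1} \<rightarrow> carrier ?R. \<exists>b\<in>coboundaries W n D 1.
           \<forall>i<n 1. v i = tuple_comb W (n 1) 1 r z i \<oplus>\<^bsub>W\<^esub> b i"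
      "\<forall>r\<in>{..<1} \<rightarrow> carrier ?R.
           tuple_comb W (n 1) 1 r z \<in> coboundaries W n D 1 \<longrightarrow> (\<forall>k<1. r k \<in> nonunits ?R)"
    using W(3) unfolding residue_ext_dim_def by blast
  obtain m :: nat and g where g: "g \<in> {..<m} \<rightarrow> carrier W"
    "\<forall>x\<in>carrier W. \<exists>r\<in>{..<m} \<rightarrow> carrier ?R. x = (\<Oplus>\<^bsub>W\<^esub>k\<in>{..<m}. r k \<odot>\<^bsub>W\<^esub> g k)"
    using W(4) unfolding fin_gen_module_def by blast
  interpret residue_resolution_loc H n D by unfold_locales (rule res)
  interpret presented_module H n D W m g
  proof (intro presented_module.intro presented_module_axioms.intro)
    show "residue_resolution_loc H n D" by (rule residue_resolution_loc_axioms)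
    show "module ?R W" by (rule W(1))
    show "g k \<in> carrier W" if "k < m" for k using g(1) that by auto
    show "\<exists>r. (\<forall>k<m. r k \<in> supported Z) \<and> x = (\<Oplus>\<^bsub>W\<^esub>k\<in>{..<m}. r k \<odot>\<^bsub>W\<^esub> g k)" if x: "x \<in> carrier W" for x
    proof -
      obtain r where r: "r \<in> {..<m} \<rightarrow> carrier ?R" "x = (\<Oplus>\<^bsub>W\<^esub>k\<in>{..<m}. r k \<odot>\<^bsub>W\<^esub> g k)"
        using bspec[OF g(2) x] by (rule bexE)
      have "\<forall>k<m. r k \<in> supported Z" using r(1) by (simp add: Pi_iff)
      thus ?thesis using r(2) by (intro exI conjI)
    qed
    show "w = \<zero>\<^bsub>W\<^esub>" if "a \<in> supported Z" "a \<noteq> 0" "w \<in> carrier W" "a \<odot>\<^bsub>W\<^esub> w = \<zero>\<^bsub>W\<^esub>" for a w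
      using torsion_free_of_ext_0[OF W(1,2) that] .
  qed
  obtain u where u: "u \<notin> lattice" "\<And>x. x \<in> supported (Z - {0}) \<Longrightarrow> (\<lambda>l. x * u l) \<in> lattice"
    "\<And>y. (\<And>x. x \<in> supported (Z - {0}) \<Longrightarrow> (\<lambda>l. x * y l) \<in> lattice) \<Longrightarrow>
      \<exists>r\<in>supported Z. (\<lambda>l. y l - r * u l) \<in> lattice"
    by (rule ex_socle_generator[OF z]) (assumption | blast)+
  obtain w t where w: "\<And>l. l < m \<Longrightarrow> w l \<in> supported K" "\<And>p. p \<in> rels \<Longrightarrow> (\<Sum>l<m. p l * w l) = 0"
    and t: "integral t" "(\<Sum>l<m. t l * w l) = 1"
    by (rule ex_hom_to_K[OF u]) (assumption | blast)+
  show ?thesis by (rule tpow_in_trace_ideal[OF w t b])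
qed

text \<open>The forward direction tests the trace of the given \<open>W\<close> on monomials; in the
  converse \<open>res\<close> certifies \<open>\<omega>\<close> as the canonical module.\<close>

lemma far_flung_iff:
  assumes res: "residue_resolution (laurent_subring (supported Z :: 'k::field fls set)) n D"
  shows "far_flung_gorenstein laurent_field (supported Z :: 'k fls set) \<longleftrightarrow>
    (\<forall>b. (\<forall>k\<in>K. b + k \<in> Z) \<longrightarrow> b > F)"
proof
  assume "far_flung_gorenstein laurent_field (supported Z :: 'k fls set)"
  then obtain W :: "('k fls, 'k fls) module" where W: "canonical_module 1 (laurent_subring (supported Z)) W"
    "trace_ideal (laurent_subring (supported Z)) W = supported {F<..}"
    unfolding far_flung_gorenstein_def colon_Z by blast
  show "\<forall>b. (\<forall>k\<in>K. b + k \<in> Z) \<longrightarrow> b > F"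
  proof (intro allI impI)
    fix b assume "\<forall>k\<in>K. b + k \<in> Z"
    hence "tpow b \<in> (supported {F<..} :: 'k fls set)"
      using tpow_in_trace_of_canonical_module[OF W(1)] W(2) by blast
    thus "b > F" by simp
  qed
next
  interpret residue_resolution_loc H n D by unfold_locales (rule res)
  assume "\<forall>b. (\<forall>k\<in>K. b + k \<in> Z) \<longrightarrow> b > F"
  thus "far_flung_gorenstein laurent_field (supported Z :: 'k fls set)" by (intro far_flung_if) blast
qed

end

theorem theorem1p5:
  fixes H :: "nat set"
  assumes "numerical_semigroup H"
    and "cohen_macaulay_type 1
           (laurent_field\<lparr>carrier := (semigroup_ring_carrier H :: 'k::field fls set)\<rparr>) 3"
  shows "far_flung_gorenstein laurent_field (semigroup_ring_carrier H :: 'k fls set) \<longleftrightarrow>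
    (\<exists>m::nat. m \<ge> 1 \<and>
      (H = submonoid_generated {4, 4*m+1, 4*m+2, 4*m+3} \<or>
       H = submonoid_generated {4, 4*m+3, 4*m+5, 4*m+6} \<or>
       H = submonoid_generated {5, 5*m+4, 10*m+6, 10*m+7} \<or>
       H = submonoid_generated {5, 5*m+1, 10*m+3, 10*m+4} \<or>
       H = submonoid_generated {5, 5*m+2, 10*m+1, 10*m+3} \<or>
       H = submonoid_generated {5, 5*m+3, 10*m+4, 10*m+7}))"
proof -
  interpret numerical_semigroup_loc H by unfold_locales (rule assms(1))
  have ring: "semigroup_ring_carrier H = (supported Z :: 'k fls set)"
    by (simp add: semigroup_ring_carrier_eq Z_def)
  note type3 = type_eq_card_PF[OF assms(2)[unfolded ring]]
  have "far_flung_gorenstein laurent_field (supported Z :: 'k fls set) \<longleftrightarrow>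
      (\<forall>n\<ge>0. \<exists>k\<in>K. \<exists>l\<in>K. n = k + l)"
    using type3(2) far_flung_iff unfolding double_K_iff by blast
  also have "\<dots> \<longleftrightarrow> in_type3_family H"
    using family_of_double_K[OF type3(1)] double_K_of_family by blast
  finally show ?thesis unfolding ring in_type3_family_def .
qed

end
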